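(* Let $(M,g)$ be a non-compact and complete Riemannian manifold and let $A\colon M\to(0,\infty)$ be a positive (smooth) function. Denote by $g'=\frac{g}{A^2}$ the conformally transformed Riemannian metric on $M$. Then $(M,g')$ is complete if and only if $\frac{1}{A}\colon M\to(0,\infty)$ is not $L^1$ on any escaping curve with respect to $g$ (i.e., it is not the case that $\frac1A$ is $L^1$ on an escaping curve with respect to $g$). Moreover, if $A$ grows at most linearly towards $g$-infinity on $M$, then $(M,g')$ is complete; and if $A$ grows superlinearly towards $g$-infinity on $M$, then $g'$ is a bounded metric on $M$ (i.e., $\sup_{x,y\in M}d_{g'}(x,y)<\infty$), and in particular $(M,g')$ is incomplete.
   Context: Conventions: manifolds are smooth, connected and non-compact; functions used as conformal factors are smooth; all curves are regular (smooth with nowhere vanishing velocity). For a Riemannian metric $g$ on $M$, $d_g$ denotes the associated distance function, and $g$ (or $(M,g)$) is called complete if $M$ is complete as a metric space with respect to $d_g$. Escaping rays: a ray is a curve $\alpha\colon[0,b)\to M$ with $0<b\le\infty$. It is called escaping (to infinity) on $M$ if there are a sequence $\{t_n\}_{n\in\mathbb{N}}\subset[0,b)$ with $t_n\to b$ as $n\to\infty$ and an exhaustion of $M$ by compact sets $\{K_n\}_{n\in\mathbb{N}_0}$, $M=\bigcup_{n\in\mathbb{N}_0}K_n$, with $K_0=\{\alpha(0)\}$ and $K_n\subset\mathring{K}_{n+1}$ (the interior of $K_{n+1}$) for all $n\in\mathbb{N}_0$, such that $\alpha(t_n)\in K_n\setminus K_{n-1}$ for all $n\in\mathbb{N}$.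 Let $(M,g)$ be a complete Riemannian manifold and $f\colon M\to(0,\infty)$ a function. (i) $f$ grows at most linearly towards $g$-infinity on $(M,g)$ if for every fixed $x_0\in M$ there are constants $c_1,c_2>0$ such that $f(x)\le c_1 d_g(x_0,x)+c_2$ for all $x\in M$. (ii) $f$ grows superlinearly towards $g$-infinity on $(M,g)$ if for every fixed $x_0\in M$ there are constants $\epsilon,c_1,c_2>0$ such that $f(x)\ge c_1 d_g(x_0,x)^{1+\epsilon}+c_2$ for all $x\in M$. (iii) $f$ is $L^1$ on an escaping curve with respect to $g$ if there are $x_0\in M$ and an escaping ray $\gamma\colon[0,\infty)\to M$ with $\gamma(0)=x_0$ such that $\int_0^\infty (f\circ\gamma)(s)\sqrt{g_{\gamma(s)}(\dot\gamma(s),\dot\gamma(s))}\,\mathrm{d}s<\infty$. (This condition is independent of the parametrization of $\gamma$.) *)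

theory Defs
  imports "HOL-Analysis.Analysis"
begin

section \<open>Smooth maps between subsets of Euclidean spaces\<close>

text \<open>
  The derivative is taken within the set; the same notion then covers open sets and
  (relatively open subsets of) intervals with end points, where it means one-sided
  smoothness. It is only used on such sets, on which the derivative is unique.
\<close>

primrec times_differentiable_on ::
  "nat \<Rightarrow> 'b::real_normed_vector set \<Rightarrow> ('b \<Rightarrow> 'c::real_normed_vector) \<Rightarrow> bool" where
  "times_differentiable_on 0 S f \<longleftrightarrow> continuous_on S f"
| "times_differentiable_on (Suc n) S f \<longleftrightarrow>
     (\<forall>x\<in>S. f differentiable (at x within S)) \<and>
     (\<forall>v. times_differentiable_on n S (\<lambda>x. frechet_derivative f (at x within S) v))"

definition smooth_on :: "'b::real_normed_vector set \<Rightarrow> ('b \<Rightarrow> 'c::real_normed_vector) \<Rightarrow> bool" where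
  "smooth_on S f \<longleftrightarrow> (\<forall>n. times_differentiable_on n S f)"

section \<open>Smooth manifolds\<close>

text \<open>
  A chart is a pair of its domain and its coordinate map. Only the values of the map on
  the domain matter. The manifold is the whole type \<open>'a\<close>; its dimension is \<open>DIM('e)\<close>.
  Dimension 0 is thereby excluded, but a connected 0-dimensional manifold is a single
  point, hence compact.
\<close>

type_synonym ('a, 'e) chart = "'a set \<times> ('a \<Rightarrow> 'e)"

abbreviation chart_dom :: "('a, 'e) chart \<Rightarrow> 'a set" where
  "chart_dom c \<equiv> fst c"

abbreviation chart_map :: "('a, 'e) chart \<Rightarrow> 'a \<Rightarrow> 'e" where
  "chart_map c \<equiv> snd c"

definition chart_inv :: "('a, 'e) chart \<Rightarrow> 'e \<Rightarrow> 'a" where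
  "chart_inv c = inv_into (chart_dom c) (chart_map c)"

definition is_chart :: "('a::topological_space, 'e::euclidean_space) chart \<Rightarrow> bool" where
  "is_chart c \<longleftrightarrow> open (chart_dom c) \<and> open (chart_map c ` chart_dom c) \<and>
     homeomorphism (chart_dom c) (chart_map c ` chart_dom c) (chart_map c) (chart_inv c)"

definition smooth_atlas ::
  "('a::{t2_space,second_countable_topology}, 'e::euclidean_space) chart set \<Rightarrow> bool" where
  "smooth_atlas \<A> \<longleftrightarrow>
     (\<forall>c\<in>\<A>. is_chart c) \<and> (\<Union>c\<in>\<A>. chart_dom c) = UNIV \<and>
     (\<forall>c\<in>\<A>. \<forall>c'\<in>\<A>. smooth_on (chart_map c ` (chart_dom c \<inter> chart_dom c'))
                          (chart_map c' \<circ> chart_inv c))"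

definition smooth_function :: "('a::topological_space, 'e::euclidean_space) chart set \<Rightarrow> ('a \<Rightarrow> real) \<Rightarrow> bool" where
  "smooth_function \<A> f \<longleftrightarrow>
     (\<forall>c\<in>\<A>. smooth_on (chart_map c ` chart_dom c) (f \<circ> chart_inv c))"

section \<open>Tangent vectors and Riemannian metrics\<close>

text \<open>
  A tangent vector at \<open>p\<close> is the family of its coordinate representations in all charts
  of the atlas around \<open>p\<close>, related by the differentials of the transition maps, and
  extended by 0 to all other arguments to make it unique.
\<close>

type_synonym ('a, 'e) tangent = "('a, 'e) chart \<Rightarrow> 'e"

definition charts_at :: "('a, 'e) chart set \<Rightarrow> 'a \<Rightarrow> ('a, 'e) chart set" where
  "charts_at \<A> p = {c \<in> \<A>. p \<in> chart_dom c}"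

definition transition_deriv ::
  "('a, 'e::euclidean_space) chart \<Rightarrow> ('a, 'e) chart \<Rightarrow> 'a \<Rightarrow> 'e \<Rightarrow> 'e" where
  "transition_deriv c c' p = frechet_derivative (chart_map c' \<circ> chart_inv c) (at (chart_map c p))"

definition tangent_space ::
  "('a, 'e::euclidean_space) chart set \<Rightarrow> 'a \<Rightarrow> ('a, 'e) tangent set" where
  "tangent_space \<A> p =
     {v. (\<forall>c. c \<notin> charts_at \<A> p \<longrightarrow> v c = 0) \<and>
         (\<forall>c\<in>charts_at \<A> p. \<forall>c'\<in>charts_at \<A> p. v c' = transition_deriv c c' p (v c))}"

text \<open>The tangent vector at \<open>p\<close> with coordinates \<open>u\<close> in the chart \<open>c\<close>.\<close>

definition tangent_of_coords ::
  "('a, 'e::euclidean_space) chart set \<Rightarrow> ('a, 'e) chart \<Rightarrow> 'a \<Rightarrow> 'e \<Rightarrow> ('a, 'e) tangent" where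
  "tangent_of_coords \<A> c p u =
     (\<lambda>c'. if c' \<in> charts_at \<A> p then transition_deriv c c' p u else 0)"

type_synonym ('a, 'e) metric_tensor = "'a \<Rightarrow> ('a, 'e) tangent \<Rightarrow> ('a, 'e) tangent \<Rightarrow> real"

definition riemannian_metric ::
  "('a::topological_space, 'e::euclidean_space) chart set \<Rightarrow> ('a, 'e) metric_tensor \<Rightarrow> bool" where
  "riemannian_metric \<A> g \<longleftrightarrow>
     (\<forall>p. \<forall>v\<in>tangent_space \<A> p. \<forall>w\<in>tangent_space \<A> p. g p v w = g p w v) \<and>
     (\<forall>p. \<forall>v\<in>tangent_space \<A> p. \<forall>w\<in>tangent_space \<A> p. \<forall>z\<in>tangent_space \<A> p. \<forall>a b.
        g p (\<lambda>c. a *\<^sub>R v c + b *\<^sub>R w c) z = a * g p v z + b * g p w z) \<and>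
     (\<forall>p. \<forall>v\<in>tangent_space \<A> p. v \<noteq> (\<lambda>c. 0) \<longrightarrow> g p v v > 0) \<and>
     (\<forall>c\<in>\<A>. \<forall>u w. smooth_on (chart_map c ` chart_dom c)
        (\<lambda>x. g (chart_inv c x) (tangent_of_coords \<A> c (chart_inv c x) u)
                               (tangent_of_coords \<A> c (chart_inv c x) w)))"

definition conformal_metric ::
  "('a, 'e) metric_tensor \<Rightarrow> ('a \<Rightarrow> real) \<Rightarrow> ('a, 'e) metric_tensor" where
  "conformal_metric g A = (\<lambda>p v w. g p v w / (A p)\<^sup>2)"

section \<open>Curves, length and distance\<close>

text \<open>The velocity at time \<open>t\<close> of a curve defined on \<open>I\<close> (one-sided at end points of \<open>I\<close>).\<close>

definition velocity ::
  "('a, 'e::euclidean_space) chart set \<Rightarrow> real set \<Rightarrow> (real \<Rightarrow> 'a) \<Rightarrow> real \<Rightarrow> ('a, 'e) tangent" where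
  "velocity \<A> I \<gamma> t =
     (\<lambda>c. if c \<in> charts_at \<A> (\<gamma> t)
          then vector_derivative (chart_map c \<circ> \<gamma>) (at t within I) else 0)"

definition speed ::
  "('a, 'e::euclidean_space) chart set \<Rightarrow> ('a, 'e) metric_tensor \<Rightarrow> real set \<Rightarrow> (real \<Rightarrow> 'a) \<Rightarrow> real \<Rightarrow> real" where
  "speed \<A> g I \<gamma> t = sqrt (g (\<gamma> t) (velocity \<A> I \<gamma> t) (velocity \<A> I \<gamma> t))"

definition regular_curve ::
  "('a::topological_space, 'e::euclidean_space) chart set \<Rightarrow> real set \<Rightarrow> (real \<Rightarrow> 'a) \<Rightarrow> bool" where
  "regular_curve \<A> I \<gamma> \<longleftrightarrow>
     continuous_on I \<gamma> \<and>
     (\<forall>c\<in>\<A>. smooth_on (I \<inter> \<gamma> -` chart_dom c) (chart_map c \<circ> \<gamma>)) \<and>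
     (\<forall>t\<in>I. velocity \<A> I \<gamma> t \<noteq> (\<lambda>c. 0))"

text \<open>
  The distance is the infimum of the lengths of piecewise regular curves. The case
  \<open>k = 0\<close> below is the trivial curve on \<open>{a..a}\<close>, of length 0. The velocity may be
  undefined at the finitely many break points, which does not affect the integral.
\<close>

definition piecewise_regular_curve ::
  "('a::topological_space, 'e::euclidean_space) chart set \<Rightarrow> real \<Rightarrow> real \<Rightarrow> (real \<Rightarrow> 'a) \<Rightarrow> bool" where
  "piecewise_regular_curve \<A> a b \<gamma> \<longleftrightarrow>
     (\<exists>(k::nat) s. s 0 = a \<and> s k = b \<and>
        (\<forall>i<k. s i < s (Suc i) \<and> regular_curve \<A> {s i..s (Suc i)} \<gamma>))"

definition curve_length ::
  "('a, 'e::euclidean_space) chart set \<Rightarrow> ('a, 'e) metric_tensor \<Rightarrow> real \<Rightarrow> real \<Rightarrow> (real \<Rightarrow> 'a) \<Rightarrow> real" where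
  "curve_length \<A> g a b \<gamma> = integral {a..b} (speed \<A> g {a..b} \<gamma>)"

definition riemannian_dist ::
  "('a::topological_space, 'e::euclidean_space) chart set \<Rightarrow> ('a, 'e) metric_tensor \<Rightarrow> 'a \<Rightarrow> 'a \<Rightarrow> real" where
  "riemannian_dist \<A> g x y =
     Inf {curve_length \<A> g a b \<gamma> | a b \<gamma>.
            piecewise_regular_curve \<A> a b \<gamma> \<and> \<gamma> a = x \<and> \<gamma> b = y}"

definition complete_metric ::
  "('a::topological_space, 'e::euclidean_space) chart set \<Rightarrow> ('a, 'e) metric_tensor \<Rightarrow> bool" where
  "complete_metric \<A> g \<longleftrightarrow> Metric_space.mcomplete UNIV (riemannian_dist \<A> g)"

definition bounded_metric ::
  "('a::topological_space, 'e::euclidean_space) chart set \<Rightarrow> ('a, 'e) metric_tensor \<Rightarrow> bool" where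
  "bounded_metric \<A> g \<longleftrightarrow> (\<exists>B. \<forall>x y. riemannian_dist \<A> g x y \<le> B)"

section \<open>Escaping rays and growth conditions\<close>

definition ray_dom :: "ereal \<Rightarrow> real set" where
  "ray_dom b = {t. 0 \<le> t \<and> ereal t < b}"

definition escaping_ray ::
  "('a::topological_space, 'e::euclidean_space) chart set \<Rightarrow> ereal \<Rightarrow> (real \<Rightarrow> 'a) \<Rightarrow> bool" where
  "escaping_ray \<A> b \<alpha> \<longleftrightarrow>
     0 < b \<and> regular_curve \<A> (ray_dom b) \<alpha> \<and>
     (\<exists>(t :: nat \<Rightarrow> real) (K :: nat \<Rightarrow> 'a set).
        (\<forall>n. t n \<in> ray_dom b) \<and> (\<lambda>n. ereal (t n)) \<longlonglongrightarrow> b \<and>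
        (\<forall>n. compact (K n)) \<and> (\<Union>n. K n) = UNIV \<and> K 0 = {\<alpha> 0} \<and>
        (\<forall>n. K n \<subseteq> interior (K (Suc n))) \<and>
        (\<forall>n\<ge>1. \<alpha> (t n) \<in> K n - K (n - 1)))"

definition grows_at_most_linearly ::
  "('a::topological_space, 'e::euclidean_space) chart set \<Rightarrow> ('a, 'e) metric_tensor \<Rightarrow> ('a \<Rightarrow> real) \<Rightarrow> bool" where
  "grows_at_most_linearly \<A> g f \<longleftrightarrow>
     (\<forall>x0. \<exists>c1>0. \<exists>c2>0. \<forall>x. f x \<le> c1 * riemannian_dist \<A> g x0 x + c2)"

definition grows_superlinearly ::
  "('a::topological_space, 'e::euclidean_space) chart set \<Rightarrow> ('a, 'e) metric_tensor \<Rightarrow> ('a \<Rightarrow> real) \<Rightarrow> bool" where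
  "grows_superlinearly \<A> g f \<longleftrightarrow>
     (\<forall>x0. \<exists>\<epsilon>>0. \<exists>c1>0. \<exists>c2>0. \<forall>x.
        f x \<ge> c1 * riemannian_dist \<A> g x0 x powr (1 + \<epsilon>) + c2)"

definition L1_on_escaping_curve ::
  "('a::topological_space, 'e::euclidean_space) chart set \<Rightarrow> ('a, 'e) metric_tensor \<Rightarrow> ('a \<Rightarrow> real) \<Rightarrow> bool" where
  "L1_on_escaping_curve \<A> g f \<longleftrightarrow>
     (\<exists>x0 \<gamma>. escaping_ray \<A> \<infinity> \<gamma> \<and> \<gamma> 0 = x0 \<and>
        (\<integral>\<^sup>+ s\<in>{0..}. ennreal (f (\<gamma> s) * speed \<A> g {0..} \<gamma> s) \<partial>lborel) < \<infinity>)"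

end

theory Submission
  imports Defs
begin

text \<open>
  For an incomplete metric the escape radius \<open>\<rho>\<close> of a point, the supremum of the radii of compact balls
  around it, is finite. By compactness there is for every \<open>s < \<rho>(p)\<close> a point \<open>q\<close> with \<open>d(p, q) = s\<close> and
  \<open>\<rho>(q) = \<rho>(p) - s\<close>. Steps proportional to a Lipschitz function therefore give a geodesic chain of finite
  total length that leaves every compact set; in a complete space it cannot exist, which is the Hopf--Rinow
  theorem. Consecutive points of the chain are connected in coordinates, where the metric is almost constant.
  Near each point the curve is a straight germ, and neighbouring germs are blended by a
  cut-off function. In dimension at least two a generic perturbation makes the blend regular; in dimension
  one the chain cannot turn back, since it is geodesic. This yields a regular escaping ray of finite length.

  Conversely the points of an escaping ray of finite length form a Cauchy sequence that cannot converge. The growth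
  criteria follow by integrating \<open>1 / A\<close> along curves, parametrized by their \<open>g\<close>-length \<open>\<sigma>\<close>: for linear
  growth unit \<open>g / A\<^sup>2\<close>-balls are \<open>g\<close>-bounded, hence relatively compact, and for superlinear growth
  \<open>\<integral> (1 + \<sigma>) powr (- 1 - \<epsilon>) d\<sigma>\<close> is bounded along almost minimal \<open>g\<close>-curves. By Hopf--Rinow a
  bounded metric on a non-compact manifold is incomplete.
\<close>

text \<open>An escaping ray must be smooth with nowhere vanishing velocity, whereas distances are
  infima over piecewise regular curves; this gap shapes the proof. No geodesic equation is solved:
  minimality is replaced by exact additivity of distances along the chain, and each link becomes one
  smooth curve in one chart. Corners are avoided by passing every chain point on a short straight
  segment of that point's own chart, run through slowly. How slowly is decided by two charts only,
  its own and the preceding one, so all choices are independent of each other. The distortion 11/10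
  comes from dimension one: excluding a turn costs its fourth power 1.4641, which must stay below (s
  + t)^2 / (s^2 + t^2), a ratio close to 2 for nearly equal steps. Steps are an eighth of the chart
  radius, so that neighbouring points and almost shortest curves between them stay in the chart. The
  speed on each link is at most a fixed multiple of the chart radius, and the radii are summable.
  That the ray escapes in the sense of an exhaustion is seen from the balls of the complete metric
  \<open>g\<close>, which are compact.\<close>

section \<open>Calculus of smooth maps\<close>

text \<open>This is the hypothesis of \<open>frechet_derivative_unique_within\<close>. It holds for
  open sets and nondegenerate intervals and passes to relatively open subsets, so that one calculus
  serves coordinate domains and curves with end points.\<close>

definition thick :: "'b::euclidean_space set \<Rightarrow> bool" where
  "thick S \<longleftrightarrow> (\<forall>x\<in>S. \<forall>i\<in>Basis. \<forall>e>0. \<exists>d. 0 < \<bar>d\<bar> \<and> \<bar>d\<bar> < e \<and> x + d *\<^sub>R i \<in> S)"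

lemma thick_derivative_unique:
  fixes f :: "'b::euclidean_space \<Rightarrow> 'c::real_normed_vector"
  assumes "thick S" "x \<in> S" "(f has_derivative f') (at x within S)" "(f has_derivative f'') (at x within S)"
  shows "f' = f''"
  using assms(3,4)
  by (rule frechet_derivative_unique_within) (use assms(1,2) in \<open>auto simp: thick_def\<close>)

lemma thick_frechet_derivative:
  fixes f :: "'b::euclidean_space \<Rightarrow> 'c::real_normed_vector"
  assumes "thick S" "x \<in> S" "(f has_derivative f') (at x within S)"
  shows "frechet_derivative f (at x within S) = f'"
  using thick_derivative_unique[OF assms(1,2) _ assms(3)] assms(3)
  by (meson differentiableI frechet_derivative_works)

lemma thick_Int_open:
  assumes "thick S" "open U"
  shows "thick (S \<inter> U)"
  unfolding thick_def
proof (intro ballI allI impI)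
  fix x i :: 'a and e :: real
  assume x: "x \<in> S \<inter> U" and i: "i \<in> Basis" and e: "0 < e"
  obtain r where r: "r > 0" "ball x r \<subseteq> U" using assms(2) x by (meson IntE openE)
  obtain d where d: "0 < \<bar>d\<bar>" "\<bar>d\<bar> < min e r" "x + d *\<^sub>R i \<in> S"
    using assms(1) x i e r unfolding thick_def by (metis IntE min_less_iff_conj)
  moreover have "x + d *\<^sub>R i \<in> ball x r"
    using d i by (simp add: dist_norm)
  ultimately show "\<exists>d. 0 < \<bar>d\<bar> \<and> \<bar>d\<bar> < e \<and> x + d *\<^sub>R i \<in> S \<inter> U"
    using r by (intro exI[of _ d]) auto
qed

lemma thick_UNIV: "thick UNIV"
  unfolding thick_def by (metis UNIV_I abs_of_pos field_lbound_gt_zero)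

lemma thick_open: "open S \<Longrightarrow> thick S"
  using thick_Int_open[OF thick_UNIV] by simp

lemma thick_Icc:
  fixes a b :: real
  assumes "a < b" shows "thick {a..b}"
  unfolding thick_def
proof (intro ballI allI impI)
  fix x i e :: real
  assume x: "x \<in> {a..b}" and i: "i \<in> Basis" and e: "0 < e"
  have i1: "i = 1" using i by simp
  show "\<exists>d. 0 < \<bar>d\<bar> \<and> \<bar>d\<bar> < e \<and> x + d *\<^sub>R i \<in> {a..b}"
  proof (cases "x < b")
    case True
    then show ?thesis using x e i1 by (intro exI[of _ "min (e/2) (b - x)"]) auto
  next
    case False
    then show ?thesis using x e i1 assms by (intro exI[of _ "- min (e/2) (b - a)"]) (auto simp: min_def)
  qed
qed

lemma thick_atLeast: "thick {a::real..}"
  unfolding thick_def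
proof (intro ballI allI impI)
  fix x i e :: real
  assume "x \<in> {a..}" "i \<in> Basis" "0 < e"
  then show "\<exists>d. 0 < \<bar>d\<bar> \<and> \<bar>d\<bar> < e \<and> x + d *\<^sub>R i \<in> {a..}"
    by (intro exI[of _ "e/2"]) auto
qed

lemma thick_not_bot:
  fixes S :: "real set"
  assumes "thick S" "x \<in> S"
  shows "at x within S \<noteq> bot"
proof -
  have "x islimpt S"
    unfolding islimpt_approachable
  proof (intro allI impI)
    fix e :: real assume "0 < e"
    then obtain d where "0 < \<bar>d\<bar>" "\<bar>d\<bar> < e" "x + d *\<^sub>R 1 \<in> S"
      using assms unfolding thick_def by force
    then show "\<exists>x'\<in>S. x' \<noteq> x \<and> dist x' x < e"
      by (intro bexI[of _ "x + d"]) (auto simp: dist_real_def)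
  qed
  then show ?thesis by (simp add: trivial_limit_within)
qed

lemma frechet_derivative_cong_on:
  assumes "\<And>x. x \<in> S \<Longrightarrow> f x = g x" "x \<in> S"
  shows "frechet_derivative f (at x within S) = frechet_derivative g (at x within S)"
proof -
  have "(f has_derivative f') (at x within S) \<longleftrightarrow> (g has_derivative f') (at x within S)" for f'
    using assms by (metis has_derivative_transform)
  then show ?thesis unfolding frechet_derivative_def by simp
qed

lemma times_differentiable_on_cong:
  assumes "\<And>x. x \<in> S \<Longrightarrow> f x = g x" "times_differentiable_on n S f"
  shows "times_differentiable_on n S g"
  using assms
proof (induction n arbitrary: f g)
  case 0
  then show ?case by (simp cong: continuous_on_cong)
next
  case (Suc n)
  have "g differentiable (at x within S)" if "x \<in> S" for x
    using Suc.prems that by (auto simp: differentiable_def) (metis has_derivative_transform)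
  moreover have "times_differentiable_on n S (\<lambda>x. frechet_derivative g (at x within S) v)" for v
    by (rule Suc.IH[of "\<lambda>x. frechet_derivative f (at x within S) v"])
       (use Suc.prems frechet_derivative_cong_on[of S f g] in auto)
  ultimately show ?case by simp
qed

text \<open>\<open>frechet_derivative\<close> is a choice, but on a thick set it agrees with every
  derivative that can be exhibited; the recursion can thus be entered with an explicit
  formula.\<close>

lemma times_differentiable_on_SucI:
  fixes f :: "'b::euclidean_space \<Rightarrow> 'c::real_normed_vector"
  assumes "thick S" "\<And>x. x \<in> S \<Longrightarrow> (f has_derivative f' x) (at x within S)"
    and "\<And>v. times_differentiable_on n S (\<lambda>x. f' x v)"
  shows "times_differentiable_on (Suc n) S f"
proof -
  have "times_differentiable_on n S (\<lambda>x. frechet_derivative f (at x within S) v)" for v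
    by (rule times_differentiable_on_cong[OF _ assms(3)[of v]])
       (simp add: thick_frechet_derivative[OF assms(1) _ assms(2)])
  then show ?thesis using assms(2) by (auto simp: differentiable_def)
qed

lemma times_differentiable_on_SucE:
  fixes f :: "'b::euclidean_space \<Rightarrow> 'c::real_normed_vector"
  assumes "times_differentiable_on (Suc n) S f"
  obtains f' where "\<And>x. x \<in> S \<Longrightarrow> (f has_derivative f' x) (at x within S)"
    "\<And>v. times_differentiable_on n S (\<lambda>x. f' x v)"
  using assms that[of "\<lambda>x. frechet_derivative f (at x within S)"]
  by (auto simp: frechet_derivative_works)

lemma times_differentiable_on_Suc_imp:
  "times_differentiable_on (Suc n) S f \<Longrightarrow> times_differentiable_on n S f"
proof (induction n arbitrary: f)
  case 0
  then show ?case by (simp add: differentiable_imp_continuous_on differentiable_on_def)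
next
  case (Suc n)
  then show ?case by (metis times_differentiable_on.simps(2))
qed

lemma times_differentiable_on_subset:
  fixes f :: "'b::euclidean_space \<Rightarrow> 'c::real_normed_vector"
  assumes "thick S" "S \<subseteq> T" "times_differentiable_on n T f"
  shows "times_differentiable_on n S f"
  using assms(3)
proof (induction n arbitrary: f)
  case 0
  then show ?case using assms(2) by (simp add: continuous_on_subset)
next
  case (Suc n)
  then obtain f' where f': "\<And>x. x \<in> T \<Longrightarrow> (f has_derivative f' x) (at x within T)"
    "\<And>v. times_differentiable_on n T (\<lambda>x. f' x v)" by (metis times_differentiable_on_SucE)
  show ?case
    by (rule times_differentiable_on_SucI[OF assms(1), of f f'])
       (use f' Suc.IH assms(2) has_derivative_subset in blast)+
qed

text \<open>An open neighbourhood of \<open>x\<close> does not change the filter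
  \<open>at x within S\<close>, so the derivatives of the localized map are those of the map
  itself.\<close>

lemma times_differentiable_on_local:
  fixes f :: "'b::euclidean_space \<Rightarrow> 'c::real_normed_vector"
  assumes "thick S" "\<And>x. x \<in> S \<Longrightarrow> \<exists>U. open U \<and> x \<in> U \<and> times_differentiable_on n (S \<inter> U) f"
  shows "times_differentiable_on n S f"
  using assms(2)
proof (induction n arbitrary: f)
  case 0
  show ?case
    unfolding times_differentiable_on.simps continuous_on_eq_continuous_within
  proof
    fix x assume "x \<in> S"
    then obtain U where U: "open U" "x \<in> U" "continuous_on (S \<inter> U) f" using 0 by auto
    then have "continuous (at x within S \<inter> U) f"
      using \<open>x \<in> S\<close> by (simp add: continuous_on_eq_continuous_within)
    then show "continuous (at x within S) f"
      using U(1,2) by (simp add: continuous_within at_within_nhd[of x U S "S \<inter> U"])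
  qed
next
  case (Suc n)
  have loc: "at x within S \<inter> U = at x within S" if "open U" "x \<in> U" for x U
    using that by (simp add: at_within_nhd[of x U "S \<inter> U" S])
  show ?case
    unfolding times_differentiable_on.simps
  proof (intro conjI ballI allI)
    fix x assume "x \<in> S"
    then obtain U where "open U" "x \<in> U" "times_differentiable_on (Suc n) (S \<inter> U) f" using Suc.prems by blast
    then show "f differentiable at x within S" using \<open>x \<in> S\<close> loc by auto
  next
    fix v
    show "times_differentiable_on n S (\<lambda>x. frechet_derivative f (at x within S) v)"
    proof (rule Suc.IH)
      fix x assume "x \<in> S"
      then obtain U where U: "open U" "x \<in> U" "times_differentiable_on (Suc n) (S \<inter> U) f" using Suc.prems by blast
      have "times_differentiable_on n (S \<inter> U) (\<lambda>x. frechet_derivative f (at x within S) v)"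
        by (rule times_differentiable_on_cong[of _ "\<lambda>x. frechet_derivative f (at x within S \<inter> U) v"])
           (use U loc in auto)
      then show "\<exists>U. open U \<and> x \<in> U \<and> times_differentiable_on n (S \<inter> U) (\<lambda>x. frechet_derivative f (at x within S) v)"
        using U by blast
    qed
  qed
qed

lemma times_differentiable_on_const:
  fixes S :: "'b::euclidean_space set"
  assumes "thick S" shows "times_differentiable_on n S (\<lambda>x. k)"
proof (induction n arbitrary: k)
  case (Suc n)
  then show ?case by (intro times_differentiable_on_SucI[OF assms, of _ "\<lambda>x v. 0"]) auto
qed simp

lemma times_differentiable_on_bounded_linear:
  fixes S :: "'b::euclidean_space set"
  assumes "thick S" "bounded_linear L"
  shows "times_differentiable_on n S L"
proof (cases n)
  case 0
  then show ?thesis using assms(2) by (simp add: linear_continuous_on)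
next
  case (Suc m)
  show ?thesis unfolding Suc
    by (rule times_differentiable_on_SucI[OF assms(1), of _ "\<lambda>x. L"])
       (use assms in \<open>auto intro: bounded_linear_imp_has_derivative times_differentiable_on_const\<close>)
qed

lemma times_differentiable_on_linear_comp:
  fixes S :: "'b::euclidean_space set"
  assumes "thick S" "bounded_linear L" "times_differentiable_on n S f"
  shows "times_differentiable_on n S (\<lambda>x. L (f x))"
  using assms(3)
proof (induction n arbitrary: f)
  case 0
  then show ?case using assms(2) by (simp add: bounded_linear.continuous_on)
next
  case (Suc n)
  then obtain f' where f': "\<And>x. x \<in> S \<Longrightarrow> (f has_derivative f' x) (at x within S)"
    "\<And>v. times_differentiable_on n S (\<lambda>x. f' x v)" by (metis times_differentiable_on_SucE)
  show ?case
    by (rule times_differentiable_on_SucI[OF assms(1), of _ "\<lambda>x v. L (f' x v)"])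
       (use f' Suc.IH bounded_linear.has_derivative[OF assms(2)] in blast)+
qed

lemma times_differentiable_on_add:
  fixes S :: "'b::euclidean_space set"
  assumes "thick S" "times_differentiable_on n S f" "times_differentiable_on n S g"
  shows "times_differentiable_on n S (\<lambda>x. f x + g x)"
  using assms(2,3)
proof (induction n arbitrary: f g)
  case 0
  then show ?case by (auto intro: continuous_intros)
next
  case (Suc n)
  obtain f' where f': "\<And>x. x \<in> S \<Longrightarrow> (f has_derivative f' x) (at x within S)"
    "\<And>v. times_differentiable_on n S (\<lambda>x. f' x v)" using Suc.prems(1) by (metis times_differentiable_on_SucE)
  obtain g' where g': "\<And>x. x \<in> S \<Longrightarrow> (g has_derivative g' x) (at x within S)"
    "\<And>v. times_differentiable_on n S (\<lambda>x. g' x v)" using Suc.prems(2) by (metis times_differentiable_on_SucE)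
  show ?case
    by (rule times_differentiable_on_SucI[OF assms(1), of _ "\<lambda>x v. f' x v + g' x v"])
       (use f' g' Suc.IH has_derivative_add in blast)+
qed

lemma times_differentiable_on_sum:
  fixes S :: "'b::euclidean_space set"
  assumes "thick S" "\<And>i. i \<in> I \<Longrightarrow> times_differentiable_on n S (f i)"
  shows "times_differentiable_on n S (\<lambda>x. \<Sum>i\<in>I. f i x)"
  using assms(2)
  by (induction I rule: infinite_finite_induct)
     (auto intro: times_differentiable_on_const[OF assms(1)] times_differentiable_on_add[OF assms(1)])

lemma times_differentiable_on_scaleR:
  fixes S :: "'b::euclidean_space set"
  assumes "thick S" "times_differentiable_on n S f" "times_differentiable_on n S g"
  shows "times_differentiable_on n S (\<lambda>x. f x *\<^sub>R g x)"
  using assms(2,3)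
proof (induction n arbitrary: f g)
  case 0
  then show ?case by (auto intro: continuous_intros)
next
  case (Suc n)
  obtain f' where f': "\<And>x. x \<in> S \<Longrightarrow> (f has_derivative f' x) (at x within S)"
    "\<And>v. times_differentiable_on n S (\<lambda>x. f' x v)" using Suc.prems(1) by (metis times_differentiable_on_SucE)
  obtain g' where g': "\<And>x. x \<in> S \<Longrightarrow> (g has_derivative g' x) (at x within S)"
    "\<And>v. times_differentiable_on n S (\<lambda>x. g' x v)" using Suc.prems(2) by (metis times_differentiable_on_SucE)
  show ?case
  proof (rule times_differentiable_on_SucI[OF assms(1), of _ "\<lambda>x v. f x *\<^sub>R g' x v + f' x v *\<^sub>R g x"])
    show "((\<lambda>x. f x *\<^sub>R g x) has_derivative (\<lambda>v. f x *\<^sub>R g' x v + f' x v *\<^sub>R g x)) (at x within S)" if "x \<in> S" for x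
      using has_derivative_scaleR[OF f'(1) g'(1)] that by simp
    show "times_differentiable_on n S (\<lambda>x. f x *\<^sub>R g' x v + f' x v *\<^sub>R g x)" for v
      by (intro times_differentiable_on_add[OF assms(1)] Suc.IH f' g'
          Suc.prems[THEN times_differentiable_on_Suc_imp])
  qed
qed

text \<open>The derivative of a composition is expanded in a basis, so that the induction only needs
  products of functions that are one time less differentiable.\<close>

lemma times_differentiable_on_compose:
  fixes S :: "'b::euclidean_space set" and T :: "'c::euclidean_space set"
  assumes "thick S" "thick T" "\<And>x. x \<in> S \<Longrightarrow> \<gamma> x \<in> T"
    "times_differentiable_on n T f" "times_differentiable_on n S \<gamma>"
  shows "times_differentiable_on n S (\<lambda>x. f (\<gamma> x))"
  using assms(3-)
proof (induction n arbitrary: f)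
  case 0
  then show ?case by (auto intro!: continuous_on_compose2[of T f S \<gamma>])
next
  case (Suc n)
  obtain f' where f': "\<And>x. x \<in> T \<Longrightarrow> (f has_derivative f' x) (at x within T)"
    "\<And>v. times_differentiable_on n T (\<lambda>x. f' x v)" using Suc.prems(2) by (metis times_differentiable_on_SucE)
  obtain \<gamma>' where \<gamma>': "\<And>x. x \<in> S \<Longrightarrow> (\<gamma> has_derivative \<gamma>' x) (at x within S)"
    "\<And>v. times_differentiable_on n S (\<lambda>x. \<gamma>' x v)" using Suc.prems(3) by (metis times_differentiable_on_SucE)
  have expand: "f' (\<gamma> x) (\<gamma>' x v) = (\<Sum>i\<in>Basis. (\<gamma>' x v \<bullet> i) *\<^sub>R f' (\<gamma> x) i)" if "x \<in> S" for x v
  proof -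
    have l: "linear (f' (\<gamma> x))" using f'(1)[OF Suc.prems(1)[OF that]] has_derivative_linear by blast
    have "f' (\<gamma> x) (\<gamma>' x v) = f' (\<gamma> x) (\<Sum>i\<in>Basis. (\<gamma>' x v \<bullet> i) *\<^sub>R i)"
      by (simp add: euclidean_representation)
    also have "\<dots> = (\<Sum>i\<in>Basis. (\<gamma>' x v \<bullet> i) *\<^sub>R f' (\<gamma> x) i)"
      by (simp add: linear_sum[OF l] linear_scale[OF l])
    finally show ?thesis .
  qed
  show ?case
  proof (rule times_differentiable_on_SucI[OF assms(1), of _ "\<lambda>x v. f' (\<gamma> x) (\<gamma>' x v)"])
    show "((\<lambda>x. f (\<gamma> x)) has_derivative (\<lambda>v. f' (\<gamma> x) (\<gamma>' x v))) (at x within S)" if "x \<in> S" for x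
      using has_derivative_in_compose2[of T f f' \<gamma> S x] f' \<gamma>' Suc.prems(1) that by blast
    fix v
    show "times_differentiable_on n S (\<lambda>x. f' (\<gamma> x) (\<gamma>' x v))"
    proof (rule times_differentiable_on_cong)
      show "times_differentiable_on n S (\<lambda>x. \<Sum>i\<in>Basis. (\<gamma>' x v \<bullet> i) *\<^sub>R f' (\<gamma> x) i)"
        by (intro times_differentiable_on_sum assms(1) times_differentiable_on_scaleR Suc.IH f'
            Suc.prems(1) Suc.prems(3)[THEN times_differentiable_on_Suc_imp]
            times_differentiable_on_linear_comp[OF assms(1) bounded_linear_inner_left] \<gamma>')
    qed (use expand in simp)
  qed
qed

lemma smooth_on_cong:
  assumes "smooth_on S f" "\<And>x. x \<in> S \<Longrightarrow> f x = g x"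
  shows "smooth_on S g"
  using assms times_differentiable_on_cong unfolding smooth_on_def by blast

lemma smooth_on_subset:
  fixes f :: "'b::euclidean_space \<Rightarrow> 'c::real_normed_vector"
  assumes "smooth_on T f" "thick S" "S \<subseteq> T"
  shows "smooth_on S f"
  using assms times_differentiable_on_subset unfolding smooth_on_def by blast

lemma smooth_on_local:
  fixes f :: "'b::euclidean_space \<Rightarrow> 'c::real_normed_vector"
  assumes "thick S" "\<And>x. x \<in> S \<Longrightarrow> \<exists>U. open U \<and> x \<in> U \<and> smooth_on (S \<inter> U) f"
  shows "smooth_on S f"
  using times_differentiable_on_local[OF assms(1)] assms(2) unfolding smooth_on_def by meson

lemma smooth_on_compose:
  fixes S :: "'b::euclidean_space set" and T :: "'c::euclidean_space set"
  assumes "smooth_on T f" "smooth_on S \<gamma>" "thick S" "thick T" "\<And>x. x \<in> S \<Longrightarrow> \<gamma> x \<in> T"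
  shows "smooth_on S (\<lambda>x. f (\<gamma> x))"
  using times_differentiable_on_compose[OF assms(3,4), of \<gamma>] assms(1,2,5) unfolding smooth_on_def by blast

lemma smooth_on_const: "thick S \<Longrightarrow> smooth_on S (\<lambda>x. k)" for S :: "'b::euclidean_space set"
  by (simp add: smooth_on_def times_differentiable_on_const)

lemma smooth_on_ident: "thick S \<Longrightarrow> smooth_on S (\<lambda>x. x)" for S :: "'b::euclidean_space set"
  by (simp add: smooth_on_def times_differentiable_on_bounded_linear bounded_linear_ident)

lemma smooth_on_add:
  fixes S :: "'b::euclidean_space set"
  assumes "smooth_on S f" "smooth_on S g" "thick S"
  shows "smooth_on S (\<lambda>x. f x + g x)"
  using times_differentiable_on_add[OF assms(3)] assms(1,2) unfolding smooth_on_def by blast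

lemma smooth_on_scaleR:
  fixes S :: "'b::euclidean_space set"
  assumes "smooth_on S f" "smooth_on S g" "thick S"
  shows "smooth_on S (\<lambda>x. f x *\<^sub>R g x)"
  using times_differentiable_on_scaleR[OF assms(3)] assms(1,2) unfolding smooth_on_def by blast

lemma smooth_on_mult:
  fixes S :: "'b::euclidean_space set" and f g :: "'b \<Rightarrow> real"
  assumes "smooth_on S f" "smooth_on S g" "thick S"
  shows "smooth_on S (\<lambda>x. f x * g x)"
  using smooth_on_scaleR[OF assms] by simp

lemma smooth_on_diff:
  fixes S :: "'b::euclidean_space set"
  assumes "smooth_on S f" "smooth_on S g" "thick S"
  shows "smooth_on S (\<lambda>x. f x - g x)"
  using smooth_on_add[OF assms(1) smooth_on_scaleR[OF smooth_on_const[OF assms(3), of "-1"] assms(2,3)] assms(3)]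
  by simp

lemma smooth_on_imp_continuous_on: "smooth_on S f \<Longrightarrow> continuous_on S f"
  using times_differentiable_on.simps(1) unfolding smooth_on_def by blast

lemma smooth_on_imp_has_derivative:
  assumes "smooth_on S f" "x \<in> S"
  shows "(f has_derivative frechet_derivative f (at x within S)) (at x within S)"
  using assms times_differentiable_on.simps(2)[of 0 S f]
  unfolding smooth_on_def frechet_derivative_works by blast

lemma smooth_on_imp_has_derivative_open:
  assumes "smooth_on S f" "x \<in> S" "open S"
  shows "(f has_derivative frechet_derivative f (at x)) (at x)"
  using smooth_on_imp_has_derivative[OF assms(1,2)] at_within_open[OF assms(2,3)] by simp

lemma smooth_on_derivative:
  assumes "smooth_on S f"
  shows "smooth_on S (\<lambda>x. frechet_derivative f (at x within S) v)"
  using assms times_differentiable_on.simps(2) unfolding smooth_on_def by blast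

lemma smooth_on_vector_derivative:
  fixes f :: "real \<Rightarrow> 'c::real_normed_vector"
  assumes "smooth_on S f" "thick S" 
  shows "smooth_on S (\<lambda>t. vector_derivative f (at t within S))"
    "t \<in> S \<Longrightarrow> (f has_vector_derivative vector_derivative f (at t within S)) (at t within S)"
proof -
  have 1: "(f has_vector_derivative vector_derivative f (at t within S)) (at t within S)" if "t \<in> S" for t
    using smooth_on_imp_has_derivative[OF assms(1) that]
    by (meson differentiableI vector_derivative_works)
  then have "frechet_derivative f (at t within S) 1 = vector_derivative f (at t within S)" if "t \<in> S" for t
    using thick_frechet_derivative[OF assms(2) that] that unfolding has_vector_derivative_def by fastforce
  then show "smooth_on S (\<lambda>t. vector_derivative f (at t within S))"
    using smooth_on_cong[OF smooth_on_derivative[OF assms(1), of 1]] by simp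
  show "(f has_vector_derivative vector_derivative f (at t within S)) (at t within S)" if "t \<in> S"
    using 1 that by blast
qed

text \<open>The derivative is a product of a constant and two copies of \<open>inverse\<close>, so
  the induction on the order closes by itself.\<close>

lemma smooth_on_inverse: "smooth_on {0<..} (inverse :: real \<Rightarrow> real)"
  unfolding smooth_on_def
proof
  have th: "thick {0::real<..}" by (simp add: thick_open)
  fix n show "times_differentiable_on n {0<..} (inverse :: real \<Rightarrow> real)"
  proof (induction n)
    case 0
    then show ?case by (auto intro!: continuous_on_inverse continuous_on_id)
  next
    case (Suc n)
    show ?case
    proof (rule times_differentiable_on_SucI[OF th, of _ "\<lambda>x v. (- v) *\<^sub>R (inverse x *\<^sub>R inverse x)"])
      show "(inverse has_derivative (\<lambda>v. - v *\<^sub>R inverse x *\<^sub>R inverse x)) (at x within {0<..})"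
        if "x \<in> {0<..}" for x :: real
        using has_derivative_inverse'[of x "{0<..}"] that
        by (auto simp: mult_ac)
      show "times_differentiable_on n {0<..} (\<lambda>x. (- v) *\<^sub>R inverse x *\<^sub>R inverse x)" for v :: real
        by (intro times_differentiable_on_scaleR th times_differentiable_on_const Suc)
    qed
  qed
qed

section \<open>A smooth step and a smooth bump\<close>

text \<open>The functions p(1/x) exp(-1/x), extended by 0 to the left, form a family closed under
  differentiation. Smoothness of exp(-1/x) at 0 is therefore proved for all polynomials at once by
  induction on the order.\<close>

definition flat_poly :: "real poly \<Rightarrow> real \<Rightarrow> real" where
  "flat_poly p x = (if x \<le> 0 then 0 else poly p (1 / x) * exp (- (1 / x)))"

lemma poly_times_exp_tendsto_0: "((\<lambda>y::real. poly p y * exp (- y)) \<longlongrightarrow> 0) at_top"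
proof -
  have "((\<lambda>y. \<Sum>i\<le>degree p. coeff p i * (y ^ i / exp y)) \<longlongrightarrow> (\<Sum>i\<le>degree p. coeff p i * 0)) at_top"
    by (intro tendsto_sum tendsto_mult tendsto_const tendsto_power_div_exp_0)
  moreover have "(\<lambda>y. \<Sum>i\<le>degree p. coeff p i * (y ^ i / exp y)) = (\<lambda>y. poly p y * exp (- y))"
    by (simp add: poly_altdef sum_distrib_right exp_minus divide_inverse mult.assoc)
  ultimately show ?thesis by simp
qed

lemma flat_poly_tendsto_0: "(flat_poly p \<longlongrightarrow> 0) (at 0)"
proof -
  have "((\<lambda>x. poly p (inverse x) * exp (- inverse x)) \<longlongrightarrow> 0) (at_right (0::real))"
    by (rule filterlim_compose[OF poly_times_exp_tendsto_0 filterlim_inverse_at_top_right])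
  then have "(flat_poly p \<longlongrightarrow> 0) (at_right 0)"
    by (rule Lim_transform_eventually)
       (auto simp: flat_poly_def eventually_at_filter inverse_eq_divide)
  moreover have "(flat_poly p \<longlongrightarrow> 0) (at_left 0)"
    by (rule tendsto_eventually) (auto simp: flat_poly_def eventually_at_filter)
  ultimately show ?thesis by (simp add: filterlim_split_at)
qed

text \<open>In the variable y = 1/x the chain rule contributes the factor -y^2, so p exp(-y) becomes
  y^2 (p - p') exp(-y); \<open>[:0, 0, 1:]\<close> is y^2.\<close>

lemma flat_poly_derivative:
  "(flat_poly p has_real_derivative flat_poly ([:0, 0, 1:] * (p - pderiv p)) x) (at x)"
proof -
  consider "x < 0" | "x = 0" | "x > 0" by linarith
  then show ?thesis
  proof cases
    case 1
    have "((\<lambda>x. 0) has_real_derivative 0) (at x)" by simp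
    then have "(flat_poly p has_real_derivative 0) (at x)"
      by (rule has_field_derivative_transform_within_open[of _ _ _ "{..<0}"]) (use 1 in \<open>auto simp: flat_poly_def\<close>)
    then show ?thesis using 1 by (simp add: flat_poly_def)
  next
    case 2
    \<comment> \<open>The difference quotient at 0 is again a member of the family, with the
      polynomial y p.\<close>
    have "(\<lambda>h. flat_poly p h / h) = flat_poly ([:0, 1:] * p)"
      by (auto simp: flat_poly_def fun_eq_iff field_simps)
    then have "((\<lambda>h. flat_poly p h / h) \<longlongrightarrow> 0) (at 0)" using flat_poly_tendsto_0 by simp
    then have "(flat_poly p has_real_derivative 0) (at 0)"
      by (simp add: DERIV_def flat_poly_def)
    then show ?thesis using 2 by (simp add: flat_poly_def)
  next
    case 3
    have "((\<lambda>x. poly p (1 / x) * exp (- (1 / x))) has_real_derivative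
       flat_poly ([:0, 0, 1:] * (p - pderiv p)) x) (at x)"
    proof -
      have i: "((\<lambda>x. 1 / x) has_real_derivative - (1 / x\<^sup>2)) (at x)"
        using 3 by (auto intro!: derivative_eq_intros simp: power2_eq_square)
      have "((\<lambda>x. poly p (1 / x)) has_real_derivative poly (pderiv p) (1 / x) * - (1 / x\<^sup>2)) (at x)"
        by (rule DERIV_chain2[OF poly_DERIV i])
      moreover have "((\<lambda>x. exp (- (1 / x))) has_real_derivative exp (- (1 / x)) * - (- (1 / x\<^sup>2))) (at x)"
        by (rule DERIV_chain2[OF DERIV_exp DERIV_minus[OF i]])
      ultimately have "((\<lambda>x. poly p (1 / x) * exp (- (1 / x))) has_real_derivative
         poly (pderiv p) (1 / x) * - (1 / x\<^sup>2) * exp (- (1 / x)) + exp (- (1 / x)) * - (- (1 / x\<^sup>2)) * poly p (1 / x)) (at x)"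
        by (rule DERIV_mult)
      moreover have "poly (pderiv p) (1 / x) * - (1 / x\<^sup>2) * exp (- (1 / x)) + exp (- (1 / x)) * - (- (1 / x\<^sup>2)) * poly p (1 / x)
        = flat_poly ([:0, 0, 1:] * (p - pderiv p)) x"
        using 3 by (simp add: flat_poly_def power2_eq_square algebra_simps)
      ultimately show ?thesis by simp
    qed
    then show ?thesis
      by (rule has_field_derivative_transform_within_open[of _ _ _ "{0<..}"]) (use 3 in \<open>auto simp: flat_poly_def\<close>)
  qed
qed

lemma smooth_flat_poly: "smooth_on UNIV (flat_poly p)"
  unfolding smooth_on_def
proof
  fix n show "times_differentiable_on n UNIV (flat_poly p)"
  proof (induction n arbitrary: p)
    case 0
    show ?case unfolding times_differentiable_on.simps
      by (intro continuous_at_imp_continuous_on ballI DERIV_isCont[OF flat_poly_derivative])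
  next
    case (Suc n)
    show ?case
    proof (rule times_differentiable_on_SucI[OF thick_UNIV])
      show "(flat_poly p has_derivative (\<lambda>v. flat_poly ([:0, 0, 1:] * (p - pderiv p)) x *\<^sub>R v)) (at x within UNIV)" for x
        using flat_poly_derivative[of p x] by (simp add: has_field_derivative_def)
      show "times_differentiable_on n UNIV (\<lambda>x. flat_poly ([:0, 0, 1:] * (p - pderiv p)) x *\<^sub>R v)" for v
        by (rule times_differentiable_on_scaleR[OF thick_UNIV Suc times_differentiable_on_const[OF thick_UNIV]])
    qed
  qed
qed

definition flat :: "real \<Rightarrow> real" where "flat = flat_poly 1"
definition flat' :: "real \<Rightarrow> real" where "flat' = flat_poly [:0, 0, 1:]"

lemma flat_derivative: "(flat has_real_derivative flat' x) (at x)"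
  using flat_poly_derivative[of 1 x] by (simp add: flat_def flat'_def)

lemma flat_nonneg: "flat x \<ge> 0" "flat' x \<ge> 0"
  by (auto simp: flat_def flat'_def flat_poly_def)

lemma flat_pos: "x > 0 \<Longrightarrow> flat x > 0"
  by (auto simp: flat_def flat_poly_def)

lemma flat_zero: "x \<le> 0 \<Longrightarrow> flat x = 0" "x \<le> 0 \<Longrightarrow> flat' x = 0"
  by (auto simp: flat_def flat'_def flat_poly_def)

lemma flat'_eq: "x > 0 \<Longrightarrow> flat' x = flat x / x\<^sup>2"
  by (auto simp: flat_def flat'_def flat_poly_def power2_eq_square)

lemma smooth_flat: "smooth_on UNIV flat"
  unfolding flat_def by (rule smooth_flat_poly)

definition step :: "real \<Rightarrow> real" where
  "step x = flat (4 * x - 1) * inverse (flat (4 * x - 1) + flat (2 - 4 * x))"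

definition step' :: "real \<Rightarrow> real" where
  "step' x = 4 * (flat' (4 * x - 1) * flat (2 - 4 * x) + flat (4 * x - 1) * flat' (2 - 4 * x)) /
     (flat (4 * x - 1) + flat (2 - 4 * x))\<^sup>2"

text \<open>Symmetric about 1/2, the only zero of its derivative in (1/4, 3/4). There a multiple of
  \<open>bump\<close> cannot change a velocity, but \<open>step\<close> is already 1 from 1/2 on, so
  the blend moves with the target curve.\<close>

definition bump :: "real \<Rightarrow> real" where
  "bump x = flat (2 * x - 1 / 2) * flat (3 / 2 - 2 * x)"

definition bump' :: "real \<Rightarrow> real" where
  "bump' x = 2 * (flat' (2 * x - 1 / 2) * flat (3 / 2 - 2 * x) - flat (2 * x - 1 / 2) * flat' (3 / 2 - 2 * x))"

text \<open>The two arguments add up to 1, so one of them is positive.\<close>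

lemma step_denominator_pos: "flat (4 * x - 1) + flat (2 - 4 * x) > 0"
proof (cases "4 * x - 1 > 0")
  case True
  then show ?thesis using flat_pos[of "4 * x - 1"] flat_nonneg(1)[of "2 - 4 * x"] by linarith
next
  case False
  then show ?thesis using flat_pos[of "2 - 4 * x"] flat_nonneg(1)[of "4 * x - 1"] by linarith
qed

lemma smooth_flat_affine: "smooth_on UNIV (\<lambda>x. flat (a * x + b))"
  by (rule smooth_on_compose[OF smooth_flat]) 
     (auto intro!: smooth_on_add smooth_on_mult smooth_on_const smooth_on_ident thick_UNIV)

lemma smooth_step: "smooth_on UNIV step"
proof -
  have "smooth_on UNIV (\<lambda>x. flat (4 * x + (- 1)) + flat ((- 4) * x + 2))"
    by (intro smooth_on_add smooth_flat_affine thick_UNIV)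
  then have d: "smooth_on UNIV (\<lambda>x. flat (4 * x - 1) + flat (2 - 4 * x))"
    by (rule smooth_on_cong) simp
  have "smooth_on UNIV (\<lambda>x. inverse (flat (4 * x - 1) + flat (2 - 4 * x)))"
    by (rule smooth_on_compose[OF smooth_on_inverse d])
       (simp_all add: step_denominator_pos thick_UNIV thick_open)
  from smooth_on_mult[OF smooth_flat_affine[of 4 "-1"] this thick_UNIV]
  show ?thesis by (rule smooth_on_cong) (simp add: step_def)
qed

lemma smooth_bump: "smooth_on UNIV bump"
  using smooth_on_mult[OF smooth_flat_affine[of 2 "-1/2"] smooth_flat_affine[of "-2" "3/2"] thick_UNIV]
  by (rule smooth_on_cong) (simp add: bump_def)

lemma step_derivative: "(step has_real_derivative step' x) (at x)"
proof -
  have 1: "((\<lambda>x. flat (4 * x - 1)) has_real_derivative flat' (4 * x - 1) * 4) (at x)"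
    by (rule DERIV_chain2[OF flat_derivative]) (auto intro!: derivative_eq_intros)
  have 2: "((\<lambda>x. flat (2 - 4 * x)) has_real_derivative flat' (2 - 4 * x) * (- 4)) (at x)"
    by (rule DERIV_chain2[OF flat_derivative]) (auto intro!: derivative_eq_intros)
  show ?thesis
    unfolding step_def divide_inverse[symmetric]
    by (rule DERIV_cong[OF DERIV_divide[OF 1 DERIV_add[OF 1 2]]])
       (use step_denominator_pos[of x] in \<open>auto simp: step'_def power2_eq_square algebra_simps\<close>)
qed

lemma bump_derivative: "(bump has_real_derivative bump' x) (at x)"
proof -
  have 1: "((\<lambda>x. flat (2 * x - 1 / 2)) has_real_derivative flat' (2 * x - 1 / 2) * 2) (at x)"
    by (rule DERIV_chain2[OF flat_derivative]) (auto intro!: derivative_eq_intros)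
  have 2: "((\<lambda>x. flat (3 / 2 - 2 * x)) has_real_derivative flat' (3 / 2 - 2 * x) * (- 2)) (at x)"
    by (rule DERIV_chain2[OF flat_derivative]) (auto intro!: derivative_eq_intros)
  show ?thesis
    unfolding bump_def
    by (rule DERIV_cong[OF DERIV_mult[OF 1 2]]) (simp add: bump'_def algebra_simps)
qed

lemma step_eq: "x \<le> 1/4 \<Longrightarrow> step x = 0" "x \<ge> 1/2 \<Longrightarrow> step x = 1"
  using step_denominator_pos[of x] by (auto simp: step_def flat_zero)

lemma step_range: "0 \<le> step x" "step x \<le> 1"
  using step_denominator_pos[of x] flat_nonneg(1)[of "4 * x - 1"] flat_nonneg(1)[of "2 - 4 * x"]
  by (auto simp: step_def field_simps)

lemma step'_nonneg: "step' x \<ge> 0"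
  by (simp add: step'_def flat_nonneg)

lemma step'_eq_0: "x \<le> 1/4 \<Longrightarrow> step' x = 0" "x \<ge> 1/2 \<Longrightarrow> step' x = 0"
  by (simp_all add: step'_def flat_zero)

lemma bump_eq_0: "x \<le> 1/4 \<Longrightarrow> bump x = 0" "x \<ge> 3/4 \<Longrightarrow> bump x = 0"
  by (simp_all add: bump_def flat_zero)

lemma bump'_eq_0: "x \<le> 1/4 \<Longrightarrow> bump' x = 0" "x \<ge> 3/4 \<Longrightarrow> bump' x = 0"
  by (simp_all add: bump'_def flat_zero)

text \<open>By \<open>flat'_eq\<close> the logarithmic derivative of the product is 2 (1/y^2 -
  1/z^2), which vanishes for positive y and z only if y = z, that is at 1/2.\<close>

lemma bump'_neq_0:
  assumes "1/4 < x" "x < 3/4" "x \<noteq> 1/2"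
  shows "bump' x \<noteq> 0"
proof -
  define y z where "y = 2 * x - 1/2" and "z = 3/2 - 2 * x"
  have yz: "y > 0" "z > 0" "y \<noteq> z" using assms by (auto simp: y_def z_def)
  have "bump' x = 2 * (flat y * flat z) * (1 / y\<^sup>2 - 1 / z\<^sup>2)"
    unfolding bump'_def y_def[symmetric] z_def[symmetric]
    using yz by (simp add: flat'_eq field_simps)
  moreover have "y\<^sup>2 \<noteq> z\<^sup>2" using yz by (simp add: power2_eq_iff)
  ultimately show ?thesis using yz flat_pos[of y] flat_pos[of z] by simp
qed

lemma continuous_derivative_of_smooth:
  assumes "smooth_on UNIV f" "\<And>x. (f has_real_derivative f' x) (at x)"
  shows "continuous_on UNIV f'"
proof -
  have "smooth_on UNIV (\<lambda>x. frechet_derivative f (at x) 1)"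
    using smooth_on_derivative[OF assms(1), of 1] by simp
  moreover have "frechet_derivative f (at x) 1 = f' x" for x
    using assms(2)[of x] unfolding has_field_derivative_def
    by (metis frechet_derivative_at mult.right_neutral)
  ultimately show ?thesis by (simp add: smooth_on_imp_continuous_on)
qed

text \<open>One constant for all links of the chain: the speed bound of the ray must not depend on
  the index of the link.\<close>

lemma step_bump_bounded:
  obtains C where "C \<ge> 1" "\<And>x. 0 \<le> x \<Longrightarrow> x \<le> 1 \<Longrightarrow> \<bar>step' x\<bar> \<le> C"
    "\<And>x. 0 \<le> x \<Longrightarrow> x \<le> 1 \<Longrightarrow> \<bar>bump x\<bar> \<le> C" "\<And>x. 0 \<le> x \<Longrightarrow> x \<le> 1 \<Longrightarrow> \<bar>bump' x\<bar> \<le> C"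
proof -
  have bd: "\<exists>C. \<forall>x\<in>{0..1}. \<bar>f x\<bar> \<le> C" if "continuous_on UNIV f" for f :: "real \<Rightarrow> real"
  proof -
    have "bounded (f ` {0..1})"
      by (meson compact_Icc compact_continuous_image compact_imp_bounded continuous_on_subset subset_UNIV that)
    then show ?thesis by (auto simp: bounded_iff)
  qed
  obtain a where a: "\<forall>x\<in>{0..1}. \<bar>step' x\<bar> \<le> a"
    using bd[OF continuous_derivative_of_smooth[OF smooth_step step_derivative]] by blast
  obtain b where b: "\<forall>x\<in>{0..1}. \<bar>bump x\<bar> \<le> b"
    using bd[OF smooth_on_imp_continuous_on[OF smooth_bump]] by blast
  obtain c where c: "\<forall>x\<in>{0..1}. \<bar>bump' x\<bar> \<le> c"
    using bd[OF continuous_derivative_of_smooth[OF smooth_bump bump_derivative]] by blast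
  show ?thesis
    by (rule that[of "max 1 (max a (max b c))"]) (use a b c in \<open>auto simp: le_max_iff_disj\<close>)
qed

section \<open>Inner products on coordinate space\<close>

text \<open>A predicate on forms rather than a type class instance, because the inner product varies
  with the chart and the point.\<close>

definition inner_form :: "('e::euclidean_space \<Rightarrow> 'e \<Rightarrow> real) \<Rightarrow> bool" where
  "inner_form B \<longleftrightarrow> (\<forall>u w. B u w = B w u) \<and>
     (\<forall>u w z a b. B (a *\<^sub>R u + b *\<^sub>R w) z = a * B u z + b * B w z) \<and> (\<forall>u. u \<noteq> 0 \<longrightarrow> B u u > 0)"

definition form_norm :: "('e::euclidean_space \<Rightarrow> 'e \<Rightarrow> real) \<Rightarrow> 'e \<Rightarrow> real" where
  "form_norm B u = sqrt (B u u)"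

context
  fixes B :: "'e::euclidean_space \<Rightarrow> 'e \<Rightarrow> real"
  assumes B: "inner_form B"
begin

lemma form_sym: "B u w = B w u" using B by (simp add: inner_form_def)

lemma form_linear_left: "linear (\<lambda>u. B u z)"
proof (rule linearI)
  fix u w :: 'e and a :: real
  show "B (u + w) z = B u z + B w z" using B unfolding inner_form_def by (metis mult_1 scaleR_one)
  show "B (a *\<^sub>R u) z = a *\<^sub>R B u z"
    using B unfolding inner_form_def
    by (metis add.right_neutral mult_zero_left real_scaleR_def scaleR_zero_left)
qed

lemma form_linear_right: "linear (B z)"
  using form_linear_left[of z] form_sym by presburger

lemma form_add_left: "B (u + w) z = B u z + B w z" by (rule linear_add[OF form_linear_left])
lemma form_add_right: "B z (u + w) = B z u + B z w" by (rule linear_add[OF form_linear_right])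
lemma form_diff_left: "B (u - w) z = B u z - B w z" by (rule linear_diff[OF form_linear_left])
lemma form_diff_right: "B z (u - w) = B z u - B z w" by (rule linear_diff[OF form_linear_right])
lemma form_scale_left: "B (a *\<^sub>R u) z = a * B u z" using linear_scale[OF form_linear_left] by simp
lemma form_scale_right: "B z (a *\<^sub>R u) = a * B z u" using linear_scale[OF form_linear_right] by simp
lemma form_minus_left: "B (- u) z = - B u z" by (rule linear_neg[OF form_linear_left])
lemma form_minus_right: "B z (- u) = - B z u" by (rule linear_neg[OF form_linear_right])

lemma form_pos: "u \<noteq> 0 \<Longrightarrow> B u u > 0" using B by (simp add: inner_form_def)

lemma form_zero: "B 0 z = 0" "B z 0 = 0"
  using linear_0[OF form_linear_left] linear_0[OF form_linear_right] by auto

lemma form_nonneg: "B u u \<ge> 0"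
  using form_pos[of u] form_zero by (cases "u = 0") auto

lemma form_expand: "B u w = (\<Sum>i\<in>Basis. \<Sum>j\<in>Basis. (u \<bullet> i) * (w \<bullet> j) * B i j)"
proof -
  have "B u w = B (\<Sum>i\<in>Basis. (u \<bullet> i) *\<^sub>R i) (\<Sum>j\<in>Basis. (w \<bullet> j) *\<^sub>R j)"
    by (simp add: euclidean_representation)
  also have "\<dots> = (\<Sum>i\<in>Basis. (u \<bullet> i) * B i (\<Sum>j\<in>Basis. (w \<bullet> j) *\<^sub>R j))"
    by (subst linear_sum[OF form_linear_left]) (simp add: form_scale_left)
  also have "\<dots> = (\<Sum>i\<in>Basis. (u \<bullet> i) * (\<Sum>j\<in>Basis. (w \<bullet> j) * B i j))"
    by (subst linear_sum[OF form_linear_right]) (simp add: form_scale_right)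
  finally show ?thesis by (simp add: sum_distrib_left mult_ac)
qed

lemma form_Cauchy_Schwarz: "\<bar>B u w\<bar> \<le> form_norm B u * form_norm B w"
proof (cases "w = 0")
  case False
  then have p: "B w w > 0" by (rule form_pos)
  define t where "t = B u w / B w w"
  have "0 \<le> B (u - t *\<^sub>R w) (u - t *\<^sub>R w)" by (rule form_nonneg)
  also have "\<dots> = B u u - 2 * t * B u w + t * t * B w w"
    by (simp add: form_diff_left form_diff_right form_scale_left form_scale_right form_sym[of w u] algebra_simps)
  also have "\<dots> = B u u - (B u w)\<^sup>2 / B w w"
    using p by (simp add: t_def power2_eq_square)
  finally have "(B u w)\<^sup>2 \<le> B u u * B w w" using p by (simp add: field_simps)
  then show ?thesis
    unfolding form_norm_def real_sqrt_mult[symmetric] by (rule real_le_rsqrt[of "\<bar>B u w\<bar>", simplified])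
qed (simp add: form_zero form_norm_def)

lemma form_norm_nonneg: "form_norm B u \<ge> 0"
  by (simp add: form_norm_def form_nonneg)

lemma form_norm_square: "(form_norm B u)\<^sup>2 = B u u"
  by (simp add: form_norm_def form_nonneg)

lemma form_norm_pos: "u \<noteq> 0 \<Longrightarrow> form_norm B u > 0"
  by (simp add: form_norm_def form_pos)

lemma form_norm_scale: "form_norm B (a *\<^sub>R u) = \<bar>a\<bar> * form_norm B u"
  by (simp add: form_norm_def form_scale_left form_scale_right real_sqrt_mult flip: mult.assoc)

lemma form_norm_minus: "form_norm B (- u) = form_norm B u"
  by (simp add: form_norm_def form_minus_left form_minus_right)

lemma form_norm_triangle: "form_norm B (u + w) \<le> form_norm B u + form_norm B w"
proof (rule power2_le_imp_le)
  have "(form_norm B (u + w))\<^sup>2 = B u u + 2 * B u w + B w w"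
    by (simp add: form_norm_square form_add_left form_add_right form_sym[of w u])
  also have "\<dots> \<le> (form_norm B u + form_norm B w)\<^sup>2"
    using form_Cauchy_Schwarz[of u w] by (simp add: power2_sum form_norm_square)
  finally show "(form_norm B (u + w))\<^sup>2 \<le> (form_norm B u + form_norm B w)\<^sup>2" .
qed (simp add: form_norm_nonneg)

lemma form_continuous: 
  assumes "continuous_on S f" "continuous_on S h"
  shows "continuous_on S (\<lambda>x. B (f x) (h x))"
  by (subst form_expand) (intro continuous_intros assms)

lemma form_norm_equiv:
  obtains m M where "m > 0" "M > 0" "\<And>u. m * norm u \<le> form_norm B u" "\<And>u. form_norm B u \<le> M * norm u"
proof -
  have c: "continuous_on (sphere 0 1) (form_norm B)"
    unfolding form_norm_def by (intro continuous_on_real_sqrt form_continuous continuous_on_id)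
  have ne: "sphere 0 1 \<noteq> ({} :: 'e set)" by simp
  obtain a where a: "a \<in> sphere 0 1" "\<And>u. u \<in> sphere 0 1 \<Longrightarrow> form_norm B a \<le> form_norm B u"
    using continuous_attains_inf[OF compact_sphere ne c] by blast
  obtain b where b: "b \<in> sphere 0 1" "\<And>u. u \<in> sphere 0 1 \<Longrightarrow> form_norm B u \<le> form_norm B b"
    using continuous_attains_sup[OF compact_sphere ne c] by blast
  have nz: "a \<noteq> 0" "b \<noteq> 0" using a b by auto
  have s: "form_norm B u = norm u * form_norm B (u /\<^sub>R norm u)" "u /\<^sub>R norm u \<in> sphere 0 1" if "u \<noteq> 0" for u
    using that by (auto simp: form_norm_scale)
  show ?thesis
  proof (rule that[of "form_norm B a" "form_norm B b"])
    fix u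
    show "form_norm B a * norm u \<le> form_norm B u"
    proof (cases "u = 0")
      case False
      then show ?thesis using s[OF False] a(2)[OF s(2)[OF False]] 
        by (metis mult.commute mult_left_mono norm_ge_zero)
    qed (simp add: form_norm_def form_zero)
    show "form_norm B u \<le> form_norm B b * norm u"
    proof (cases "u = 0")
      case False
      then show ?thesis using s[OF False] b(2)[OF s(2)[OF False]] 
        by (metis mult.commute mult_left_mono norm_ge_zero)
    qed (simp add: form_norm_def form_zero)
  qed (simp_all add: form_norm_pos nz)
qed

end

section \<open>Charts and tangent vectors\<close>

locale atlas =
  fixes \<A> :: "('a::{t2_space,second_countable_topology}, 'e::euclidean_space) chart set"
  assumes smooth_atlas: "smooth_atlas \<A>"
begin

lemma chart:
  assumes "c \<in> \<A>"
  shows open_dom: "open (chart_dom c)" and open_range: "open (chart_map c ` chart_dom c)"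
    and chart_inv_map: "\<And>p. p \<in> chart_dom c \<Longrightarrow> chart_inv c (chart_map c p) = p"
    and chart_map_inv: "\<And>x. x \<in> chart_map c ` chart_dom c \<Longrightarrow> chart_map c (chart_inv c x) = x"
    and chart_inv_dom: "\<And>x. x \<in> chart_map c ` chart_dom c \<Longrightarrow> chart_inv c x \<in> chart_dom c"
    and continuous_chart: "continuous_on (chart_dom c) (chart_map c)"
    and continuous_chart_inv: "continuous_on (chart_map c ` chart_dom c) (chart_inv c)"
  using assms smooth_atlas unfolding smooth_atlas_def is_chart_def homeomorphism_def by auto

lemma chart_cover: obtains c where "c \<in> \<A>" "p \<in> chart_dom c"
  using smooth_atlas unfolding smooth_atlas_def by blast

lemma open_overlap:
  assumes "c \<in> \<A>" "open U"
  shows "open (chart_map c ` (chart_dom c \<inter> U))"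
proof -
  have "chart_map c ` (chart_dom c \<inter> U) = chart_map c ` chart_dom c \<inter> chart_inv c -` U"
    using chart_inv_map[OF assms(1)] chart_map_inv[OF assms(1)] chart_inv_dom[OF assms(1)] by force
  then show ?thesis
    using continuous_open_preimage[OF continuous_chart_inv[OF assms(1)] open_range[OF assms(1)] assms(2)] by simp
qed

lemma open_chart_preimage:
  assumes "c \<in> \<A>" "open V"
  shows "open (chart_dom c \<inter> chart_map c -` V)"
  using continuous_open_preimage[OF continuous_chart[OF assms(1)] open_dom[OF assms(1)] assms(2)] .

lemma smooth_transition:
  assumes "c \<in> \<A>" "c' \<in> \<A>"
  shows "smooth_on (chart_map c ` (chart_dom c \<inter> chart_dom c')) (chart_map c' \<circ> chart_inv c)"
  using smooth_atlas assms unfolding smooth_atlas_def by blast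

lemma transition_derivative:
  assumes "c \<in> \<A>" "c' \<in> \<A>" "p \<in> chart_dom c" "p \<in> chart_dom c'"
  shows "((chart_map c' \<circ> chart_inv c) has_derivative transition_deriv c c' p) (at (chart_map c p))"
  unfolding transition_deriv_def
  by (rule smooth_on_imp_has_derivative_open[OF smooth_transition[OF assms(1,2)]])
     (use assms open_overlap[OF assms(1) open_dom[OF assms(2)]] in auto)

lemma transition_deriv_compose:
  assumes "c \<in> \<A>" "c' \<in> \<A>" "c'' \<in> \<A>" "p \<in> chart_dom c" "p \<in> chart_dom c'" "p \<in> chart_dom c''"
  shows "transition_deriv c' c'' p (transition_deriv c c' p u) = transition_deriv c c'' p u"
proof -
  let ?S = "chart_map c ` (chart_dom c \<inter> chart_dom c')"
  have "((chart_map c'' \<circ> chart_inv c' \<circ> (chart_map c' \<circ> chart_inv c)) has_derivative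
      (transition_deriv c' c'' p \<circ> transition_deriv c c' p)) (at (chart_map c p))"
    by (rule diff_chain_at[OF transition_derivative[OF assms(1,2,4,5)]])
       (use transition_derivative[OF assms(2,3,5,6)] chart_inv_map[OF assms(1,4)] in simp)
  then have "((chart_map c'' \<circ> chart_inv c) has_derivative
      (transition_deriv c' c'' p \<circ> transition_deriv c c' p)) (at (chart_map c p))"
    by (rule has_derivative_transform_within_open[where s = ?S])
       (use assms open_overlap[OF assms(1) open_dom[OF assms(2)]] chart_inv_map[OF assms(1)] chart_inv_map[OF assms(2)] in auto)
  then have "transition_deriv c' c'' p \<circ> transition_deriv c c' p = transition_deriv c c'' p"
    using transition_derivative[OF assms(1,3,4,6)] has_derivative_unique by blast
  then show ?thesis by (metis comp_apply)
qed

lemma transition_deriv_self: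
  assumes "c \<in> \<A>" "p \<in> chart_dom c"
  shows "transition_deriv c c p u = u"
proof -
  have "((\<lambda>x. x) has_derivative (\<lambda>x. x)) (at (chart_map c p))" by simp
  then have "((chart_map c \<circ> chart_inv c) has_derivative (\<lambda>x. x)) (at (chart_map c p))"
    by (rule has_derivative_transform_within_open[where s = "chart_map c ` chart_dom c"])
       (use assms open_range[OF assms(1)] chart_inv_map[OF assms(1)] in auto)
  then have "transition_deriv c c p = (\<lambda>x. x)"
    using transition_derivative[OF assms(1,1,2,2)] has_derivative_unique by blast
  then show ?thesis by simp
qed

lemma transition_deriv_nonzero:
  assumes "c \<in> \<A>" "c' \<in> \<A>" "p \<in> chart_dom c" "p \<in> chart_dom c'" "u \<noteq> 0"
  shows "transition_deriv c c' p u \<noteq> 0"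
proof
  assume "transition_deriv c c' p u = 0"
  then have "u = transition_deriv c' c p 0"
    using transition_deriv_compose[OF assms(1,2,1,3,4,3), of u] transition_deriv_self[OF assms(1,3)] by simp
  then show False
    using assms linear_0[OF has_derivative_linear[OF transition_derivative[OF assms(2,1,4,3)]]] by simp
qed

abbreviation toc where "toc \<equiv> tangent_of_coords \<A>"

lemma charts_at_iff: "c \<in> charts_at \<A> p \<longleftrightarrow> c \<in> \<A> \<and> p \<in> chart_dom c"
  by (simp add: charts_at_def)

lemma toc_in_tangent_space:
  assumes "c \<in> \<A>" "p \<in> chart_dom c"
  shows "toc c p u \<in> tangent_space \<A> p"
  unfolding tangent_space_def tangent_of_coords_def
  using transition_deriv_compose assms by (auto simp: charts_at_iff)

lemma toc_self: 
  assumes "c \<in> \<A>" "p \<in> chart_dom c"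
  shows "toc c p u c = u"
  using assms by (simp add: tangent_of_coords_def charts_at_iff transition_deriv_self)

lemma toc_linear:
  assumes "c \<in> \<A>" "p \<in> chart_dom c"
  shows "toc c p (a *\<^sub>R u + b *\<^sub>R w) = (\<lambda>c'. a *\<^sub>R toc c p u c' + b *\<^sub>R toc c p w c')"
proof
  fix c'
  have "transition_deriv c c' p (a *\<^sub>R u + b *\<^sub>R w) = a *\<^sub>R transition_deriv c c' p u + b *\<^sub>R transition_deriv c c' p w"
    if "c' \<in> charts_at \<A> p"
    using has_derivative_linear[OF transition_derivative[OF assms(1) _ assms(2)]] that
    by (simp add: charts_at_iff linear_add linear_scale)
  then show "toc c p (a *\<^sub>R u + b *\<^sub>R w) c' = a *\<^sub>R toc c p u c' + b *\<^sub>R toc c p w c'"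
    by (simp add: tangent_of_coords_def)
qed

lemma toc_eq_zero_iff:
  assumes "c \<in> \<A>" "p \<in> chart_dom c"
  shows "toc c p u = (\<lambda>c. 0) \<longleftrightarrow> u = 0"
  using toc_self[OF assms, of u] toc_linear[OF assms, of 0 0 0 0] by auto

text \<open>The derivative in a single chart determines the velocity: by the chain rule its
  representations in all other charts are exactly those prescribed by
  \<open>tangent_of_coords\<close>.\<close>

lemma velocity_eq:
  assumes "c \<in> \<A>" "\<gamma> t \<in> chart_dom c" "t \<in> I" "at t within I \<noteq> bot" "continuous (at t within I) \<gamma>"
    and h: "((chart_map c \<circ> \<gamma>) has_vector_derivative h') (at t within I)"
  shows "velocity \<A> I \<gamma> t = toc c (\<gamma> t) h'"
proof
  fix c'
  show "velocity \<A> I \<gamma> t c' = toc c (\<gamma> t) h' c'"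
  proof (cases "c' \<in> charts_at \<A> (\<gamma> t)")
    case True
    then have c': "c' \<in> \<A>" "\<gamma> t \<in> chart_dom c'" by (auto simp: charts_at_iff)
    have "((chart_map c' \<circ> chart_inv c) \<circ> (chart_map c \<circ> \<gamma>) has_derivative
       (transition_deriv c c' (\<gamma> t) \<circ> (\<lambda>x. x *\<^sub>R h'))) (at t within I)"
      by (rule diff_chain_within[OF h[unfolded has_vector_derivative_def]])
         (use transition_derivative[OF assms(1) c'(1) assms(2) c'(2)] in \<open>simp add: has_derivative_at_withinI\<close>)
    moreover have "eventually (\<lambda>s. \<gamma> s \<in> chart_dom c) (at t within I)"
      using assms(2,5) open_dom[OF assms(1)] topological_tendstoD unfolding continuous_within by blast
    then have "eventually (\<lambda>s. ((chart_map c' \<circ> chart_inv c) \<circ> (chart_map c \<circ> \<gamma>)) s = (chart_map c' \<circ> \<gamma>) s) (at t within I)"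
      by eventually_elim (simp add: chart_inv_map[OF assms(1)])
    ultimately have "((chart_map c' \<circ> \<gamma>) has_derivative (transition_deriv c c' (\<gamma> t) \<circ> (\<lambda>x. x *\<^sub>R h'))) (at t within I)"
      by (rule has_derivative_transform_eventually) (use assms chart_inv_map[OF assms(1)] in auto)
    moreover have "transition_deriv c c' (\<gamma> t) \<circ> (\<lambda>x. x *\<^sub>R h') = (\<lambda>x. x *\<^sub>R transition_deriv c c' (\<gamma> t) h')"
      using linear_scale[OF has_derivative_linear[OF transition_derivative[OF assms(1) c'(1) assms(2) c'(2)]]] by auto
    ultimately have "((chart_map c' \<circ> \<gamma>) has_vector_derivative transition_deriv c c' (\<gamma> t) h') (at t within I)"
      by (simp add: has_vector_derivative_def)
    from vector_derivative_within[OF assms(4) this] show ?thesis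
      using True by (simp add: velocity_def tangent_of_coords_def)
  qed (simp add: velocity_def tangent_of_coords_def)
qed

end

section \<open>Continuous Riemannian metrics\<close>

text \<open>Stated for continuous coefficients, so that \<open>g\<close> and
  \<open>conformal_metric g A\<close> are both instances and every later result applies to
  either.\<close>

locale cont_metric = atlas \<A> 
  for \<A> :: "('a::{t2_space,second_countable_topology}, 'e::euclidean_space) chart set" +
  fixes g :: "('a, 'e) metric_tensor"
  assumes connected: "connected (UNIV :: 'a set)"
    and g_sym: "\<And>p v w. v \<in> tangent_space \<A> p \<Longrightarrow> w \<in> tangent_space \<A> p \<Longrightarrow> g p v w = g p w v"
    and g_linear: "\<And>p v w z a b. v \<in> tangent_space \<A> p \<Longrightarrow> w \<in> tangent_space \<A> p \<Longrightarrow> z \<in> tangent_space \<A> p \<Longrightarrow>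
        g p (\<lambda>c. a *\<^sub>R v c + b *\<^sub>R w c) z = a * g p v z + b * g p w z"
    and g_pos: "\<And>p v. v \<in> tangent_space \<A> p \<Longrightarrow> v \<noteq> (\<lambda>c. 0) \<Longrightarrow> g p v v > 0"
    and g_cont: "\<And>c u w. c \<in> \<A> \<Longrightarrow> continuous_on (chart_map c ` chart_dom c)
        (\<lambda>x. g (chart_inv c x) (tangent_of_coords \<A> c (chart_inv c x) u)
                               (tangent_of_coords \<A> c (chart_inv c x) w))"
begin

text \<open>The coordinate expression of the metric: its Gram form at the coordinate point
  \<open>x\<close>.\<close>

definition G where "G c x u w = g (chart_inv c x) (toc c (chart_inv c x) u) (toc c (chart_inv c x) w)"

lemma G_form:
  assumes "c \<in> \<A>" "x \<in> chart_map c ` chart_dom c"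
  shows "inner_form (G c x)"
  unfolding inner_form_def G_def
  using g_sym g_linear g_pos toc_in_tangent_space[OF assms(1) chart_inv_dom[OF assms]]
    toc_linear[OF assms(1) chart_inv_dom[OF assms]] toc_eq_zero_iff[OF assms(1) chart_inv_dom[OF assms]] by simp

text \<open>By bilinearity the form is a finite sum over pairs of basis vectors, whose coefficients
  are continuous by \<open>g_cont\<close>.\<close>

lemma G_continuous:
  assumes "c \<in> \<A>" "continuous_on S x" "continuous_on S u" "continuous_on S w" 
    "x ` S \<subseteq> chart_map c ` chart_dom c"
  shows "continuous_on S (\<lambda>t. G c (x t) (u t) (w t))"
proof -
  have "continuous_on S (\<lambda>t. G c (x t) i j)" for i j
    using continuous_on_compose2[OF g_cont[OF assms(1)] assms(2,5)] unfolding G_def .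
  then have "continuous_on S (\<lambda>t. \<Sum>i\<in>Basis. \<Sum>j\<in>Basis. (u t \<bullet> i) * (w t \<bullet> j) * G c (x t) i j)"
    by (intro continuous_intros assms)
  moreover have "(\<Sum>i\<in>Basis. \<Sum>j\<in>Basis. (u t \<bullet> i) * (w t \<bullet> j) * G c (x t) i j) = G c (x t) (u t) (w t)" if "t \<in> S" for t
    using form_expand[OF G_form[OF assms(1)], of "x t" "u t" "w t"] that assms(5) by auto
  ultimately show ?thesis by (simp cong: continuous_on_cong)
qed

lemma speed_eq:
  assumes "c \<in> \<A>" "\<gamma> t \<in> chart_dom c" "t \<in> I" "at t within I \<noteq> bot" "continuous (at t within I) \<gamma>"
    and "((chart_map c \<circ> \<gamma>) has_vector_derivative h') (at t within I)"
  shows "speed \<A> g I \<gamma> t = form_norm (G c (chart_map c (\<gamma> t))) h'"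
  unfolding speed_def velocity_eq[OF assms] form_norm_def G_def
  by (simp add: chart_inv_map[OF assms(1,2)])

end

section \<open>Regular and piecewise regular curves\<close>

lemma continuous_preimage_relatively_open:
  assumes "continuous_on I \<gamma>" "open D"
  obtains U where "open U" "I \<inter> \<gamma> -` D = I \<inter> U"
  using assms unfolding continuous_on_open_invariant by (metis Int_commute)

context atlas
begin

text \<open>Regularity at a time, seen through one chart and one coordinate representative.
  \<open>regular_curve\<close> speaks about all charts and the whole interval; this form can be
  verified piece by piece.\<close>

definition regular_at :: "real set \<Rightarrow> (real \<Rightarrow> 'a) \<Rightarrow> real \<Rightarrow> bool" where
  "regular_at I \<gamma> t \<longleftrightarrow> (\<exists>c\<in>\<A>. \<exists>U \<beta>. open U \<and> t \<in> U \<and> smooth_on (I \<inter> U) \<beta> \<and>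
     (\<forall>s\<in>I \<inter> U. \<beta> s \<in> chart_map c ` chart_dom c \<and> \<gamma> s = chart_inv c (\<beta> s)) \<and>
     vector_derivative \<beta> (at t within I) \<noteq> 0)"

lemma at_within_Int_open: "open U \<Longrightarrow> t \<in> U \<Longrightarrow> at t within (I \<inter> U) = at t within I"
  for t :: "'b::topological_space"
  by (rule at_within_nhd[of t U]) auto

lemma regular_curve_chart:
  assumes "regular_curve \<A> I \<gamma>" "thick I" "c \<in> \<A>" 
  shows "smooth_on (I \<inter> \<gamma> -` chart_dom c) (\<lambda>t. vector_derivative (chart_map c \<circ> \<gamma>) (at t within I))"
    and "\<And>t. t \<in> I \<Longrightarrow> \<gamma> t \<in> chart_dom c \<Longrightarrow> ((chart_map c \<circ> \<gamma>) has_vector_derivative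
       vector_derivative (chart_map c \<circ> \<gamma>) (at t within I)) (at t within I)"
    and "\<And>t. t \<in> I \<Longrightarrow> \<gamma> t \<in> chart_dom c \<Longrightarrow> vector_derivative (chart_map c \<circ> \<gamma>) (at t within I) \<noteq> 0"
proof -
  have cont: "continuous_on I \<gamma>" and sm: "smooth_on (I \<inter> \<gamma> -` chart_dom c) (chart_map c \<circ> \<gamma>)"
    using assms unfolding regular_curve_def by auto
  obtain U where U: "open U" "I \<inter> \<gamma> -` chart_dom c = I \<inter> U"
    using continuous_preimage_relatively_open[OF cont open_dom[OF assms(3)]] .
  have th: "thick (I \<inter> U)" using thick_Int_open[OF assms(2) U(1)] .
  have w: "at t within (I \<inter> U) = at t within I" if "t \<in> I" "\<gamma> t \<in> chart_dom c" for t
    using that U by (intro at_within_Int_open) auto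
  show "smooth_on (I \<inter> \<gamma> -` chart_dom c) (\<lambda>t. vector_derivative (chart_map c \<circ> \<gamma>) (at t within I))"
    unfolding U(2)
    by (rule smooth_on_cong[OF smooth_on_vector_derivative(1)[OF sm[unfolded U(2)] th]])
       (metis IntE U(2) vimageE w)
  have der: "((chart_map c \<circ> \<gamma>) has_vector_derivative
       vector_derivative (chart_map c \<circ> \<gamma>) (at t within I)) (at t within I)" if t: "t \<in> I" "\<gamma> t \<in> chart_dom c" for t
    using smooth_on_vector_derivative(2)[OF sm[unfolded U(2)] th, of t] w[OF t] t U(2) by auto
  then show "t \<in> I \<Longrightarrow> \<gamma> t \<in> chart_dom c \<Longrightarrow> ((chart_map c \<circ> \<gamma>) has_vector_derivative
       vector_derivative (chart_map c \<circ> \<gamma>) (at t within I)) (at t within I)" for t .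
  show "vector_derivative (chart_map c \<circ> \<gamma>) (at t within I) \<noteq> 0" if t: "t \<in> I" "\<gamma> t \<in> chart_dom c" for t
  proof -
    have "velocity \<A> I \<gamma> t \<noteq> (\<lambda>c. 0)" using assms(1) t unfolding regular_curve_def by blast
    moreover have "continuous (at t within I) \<gamma>"
      using cont t by (simp add: continuous_on_eq_continuous_within)
    ultimately show ?thesis
      using velocity_eq[OF assms(3) t(2,1) thick_not_bot[OF assms(2) t(1)] _ der[OF t]]
        toc_eq_zero_iff[OF assms(3) t(2)] by metis
  qed
qed

lemma regular_curve_iff:
  assumes "thick I"
  shows "regular_curve \<A> I \<gamma> \<longleftrightarrow> (\<forall>t\<in>I. regular_at I \<gamma> t)"
proof (intro iffI ballI)
  fix t assume r: "regular_curve \<A> I \<gamma>" and t: "t \<in> I"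
  then have cont: "continuous_on I \<gamma>" unfolding regular_curve_def by auto
  obtain c where c: "c \<in> \<A>" "\<gamma> t \<in> chart_dom c" using chart_cover .
  obtain U where U: "open U" "I \<inter> \<gamma> -` chart_dom c = I \<inter> U"
    using continuous_preimage_relatively_open[OF cont open_dom[OF c(1)]] .
  have "t \<in> U" using U(2) t c(2) by auto
  moreover have "smooth_on (I \<inter> U) (chart_map c \<circ> \<gamma>)"
    using r c(1) unfolding regular_curve_def U(2)[symmetric] by blast
  moreover have "\<forall>s\<in>I \<inter> U. (chart_map c \<circ> \<gamma>) s \<in> chart_map c ` chart_dom c \<and> \<gamma> s = chart_inv c ((chart_map c \<circ> \<gamma>) s)"
    using chart_inv_map[OF c(1)] unfolding U(2)[symmetric] by auto
  ultimately show "regular_at I \<gamma> t"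
    using regular_curve_chart(3)[OF r assms c(1) t c(2)] U(1) c(1) unfolding regular_at_def by blast
next
  assume R: "\<forall>t\<in>I. regular_at I \<gamma> t"
  \<comment> \<open>Continuity comes first: it makes the preimage of a chart domain relatively open
    in \<open>I\<close>, hence thick.\<close>
  have *: "continuous (at t within I) \<gamma>" if t: "t \<in> I" for t
  proof -
    obtain c U \<beta> where c: "c \<in> \<A>" "open U" "t \<in> U" and sm: "smooth_on (I \<inter> U) \<beta>"
      and \<beta>: "\<forall>s\<in>I \<inter> U. \<beta> s \<in> chart_map c ` chart_dom c \<and> \<gamma> s = chart_inv c (\<beta> s)"
      using R t unfolding regular_at_def by blast
    have "continuous_on (I \<inter> U) (\<lambda>s. chart_inv c (\<beta> s))"
      by (rule continuous_on_compose2[OF continuous_chart_inv[OF c(1)] smooth_on_imp_continuous_on[OF sm]])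
         (use \<beta> in blast)
    then have "continuous_on (I \<inter> U) \<gamma>" by (rule continuous_on_eq) (use \<beta> in auto)
    then have "(\<gamma> \<longlongrightarrow> \<gamma> t) (at t within I \<inter> U)"
      using t c(3) unfolding continuous_on_def by blast
    then show ?thesis by (simp add: continuous_within at_within_Int_open[OF c(2,3)])
  qed
  then have cont: "continuous_on I \<gamma>" by (simp add: continuous_on_eq_continuous_within)
  have sm: "smooth_on (I \<inter> \<gamma> -` chart_dom c') (chart_map c' \<circ> \<gamma>)" if c': "c' \<in> \<A>" for c'
  proof -
    obtain W where W: "open W" "I \<inter> \<gamma> -` chart_dom c' = I \<inter> W"
      using continuous_preimage_relatively_open[OF cont open_dom[OF c']] .
    show ?thesis
    proof (rule smooth_on_local)
      show "thick (I \<inter> \<gamma> -` chart_dom c')" unfolding W(2) by (rule thick_Int_open[OF assms W(1)])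
      fix t assume t: "t \<in> I \<inter> \<gamma> -` chart_dom c'"
      obtain c U \<beta> where c: "c \<in> \<A>" "open U" "t \<in> U" and sm: "smooth_on (I \<inter> U) \<beta>"
        and \<beta>: "\<forall>s\<in>I \<inter> U. \<beta> s \<in> chart_map c ` chart_dom c \<and> \<gamma> s = chart_inv c (\<beta> s)"
        using R t unfolding regular_at_def by blast
      let ?S = "I \<inter> \<gamma> -` chart_dom c' \<inter> U" and ?T = "chart_map c ` (chart_dom c \<inter> chart_dom c')"
      have th: "thick ?S" unfolding W(2) by (intro thick_Int_open assms W(1) c(2))
      have "smooth_on ?S \<beta>" by (rule smooth_on_subset[OF sm th]) auto
      moreover have "\<beta> s \<in> ?T" if "s \<in> ?S" for s
        using \<beta> that chart_map_inv[OF c(1)] chart_inv_dom[OF c(1)] 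
        by (intro image_eqI[of _ _ "chart_inv c (\<beta> s)"]) auto
      ultimately have "smooth_on ?S (\<lambda>s. (chart_map c' \<circ> chart_inv c) (\<beta> s))"
        using smooth_on_compose[OF smooth_transition[OF c(1) c'], of ?S \<beta>] th 
          thick_open[OF open_overlap[OF c(1) open_dom[OF c']]] by blast
      then have "smooth_on ?S (chart_map c' \<circ> \<gamma>)"
        by (rule smooth_on_cong) (use \<beta> in auto)
      then show "\<exists>U. open U \<and> t \<in> U \<and> smooth_on (I \<inter> \<gamma> -` chart_dom c' \<inter> U) (chart_map c' \<circ> \<gamma>)"
        using c by blast
    qed
  qed
  have "velocity \<A> I \<gamma> t \<noteq> (\<lambda>c. 0)" if t: "t \<in> I" for t
  proof -
    obtain c U \<beta> where c: "c \<in> \<A>" "open U" "t \<in> U" and sm: "smooth_on (I \<inter> U) \<beta>"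
      and \<beta>: "\<forall>s\<in>I \<inter> U. \<beta> s \<in> chart_map c ` chart_dom c \<and> \<gamma> s = chart_inv c (\<beta> s)"
      and nz: "vector_derivative \<beta> (at t within I) \<noteq> 0"
      using R t unfolding regular_at_def by blast
    have dom: "\<gamma> t \<in> chart_dom c" using \<beta> t c chart_inv_dom[OF c(1)] by auto
    have "(\<beta> has_vector_derivative vector_derivative \<beta> (at t within I \<inter> U)) (at t within I \<inter> U)"
      using smooth_on_vector_derivative(2)[OF sm thick_Int_open[OF assms c(2)]] t c(3) by blast
    then have "((chart_map c \<circ> \<gamma>) has_vector_derivative vector_derivative \<beta> (at t within I \<inter> U)) (at t within I \<inter> U)"
      by (rule has_vector_derivative_transform[rotated 2]) 
         (use t c \<beta> chart_map_inv[OF c(1)] in auto)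
    then have "((chart_map c \<circ> \<gamma>) has_vector_derivative vector_derivative \<beta> (at t within I)) (at t within I)"
      by (simp add: at_within_Int_open[OF c(2,3), of I])
    from velocity_eq[OF c(1) dom t thick_not_bot[OF assms t] *[OF t] this]
    show ?thesis using toc_eq_zero_iff[OF c(1) dom] nz by simp
  qed
  then show "regular_curve \<A> I \<gamma>" using cont sm unfolding regular_curve_def by blast
qed

lemma regular_curve_subset:
  assumes "regular_curve \<A> I \<gamma>" "thick I" "thick J" "J \<subseteq> I"
  shows "regular_curve \<A> J \<gamma>"
  unfolding regular_curve_iff[OF assms(3)]
proof
  fix t assume t: "t \<in> J"
  then obtain c U \<beta> where c: "c \<in> \<A>" "open U" "t \<in> U" and sm: "smooth_on (I \<inter> U) \<beta>"
      and \<beta>: "\<forall>s\<in>I \<inter> U. \<beta> s \<in> chart_map c ` chart_dom c \<and> \<gamma> s = chart_inv c (\<beta> s)"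
      and nz: "vector_derivative \<beta> (at t within I) \<noteq> 0"
    using assms regular_curve_iff[OF assms(2)] unfolding regular_at_def by blast
  have "smooth_on (J \<inter> U) \<beta>"
    by (rule smooth_on_subset[OF sm thick_Int_open[OF assms(3) c(2)]]) (use assms(4) in auto)
  moreover have "(\<beta> has_vector_derivative vector_derivative \<beta> (at t within I)) (at t within I)"
    using smooth_on_vector_derivative(2)[OF sm thick_Int_open[OF assms(2) c(2)], of t] t c(3) assms(4)
    by (auto simp: at_within_Int_open[OF c(2,3), of I])
  then have "(\<beta> has_vector_derivative vector_derivative \<beta> (at t within I)) (at t within J)"
    by (rule has_vector_derivative_within_subset) (rule assms(4))
  then have "vector_derivative \<beta> (at t within J) \<noteq> 0"
    using vector_derivative_within[OF thick_not_bot[OF assms(3) t]] nz by metis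
  ultimately show "regular_at J \<gamma> t" using c \<beta> assms(4) unfolding regular_at_def by blast
qed

lemma regular_curve_cong:
  assumes "regular_curve \<A> I \<gamma>" "thick I" "\<And>t. t \<in> I \<Longrightarrow> \<gamma> t = \<delta> t"
  shows "regular_curve \<A> I \<delta>"
proof -
  have "regular_at I \<delta> t" if "regular_at I \<gamma> t" for t
    using that assms(3) unfolding regular_at_def by (metis IntD1)
  then show ?thesis using assms(1) unfolding regular_curve_iff[OF assms(2)] by blast
qed

lemma regular_curve_affine:
  assumes "regular_curve \<A> I \<gamma>" "thick I" "thick J" "\<And>t. t \<in> J \<Longrightarrow> m * t + k \<in> I" "m \<noteq> 0"
  shows "regular_curve \<A> J (\<lambda>t. \<gamma> (m * t + k))"
  unfolding regular_curve_iff[OF assms(3)]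
proof
  fix t assume t: "t \<in> J"
  let ?s = "m * t + k"
  obtain c U \<beta> where c: "c \<in> \<A>" "open U" "?s \<in> U" and sm: "smooth_on (I \<inter> U) \<beta>"
      and \<beta>: "\<forall>s\<in>I \<inter> U. \<beta> s \<in> chart_map c ` chart_dom c \<and> \<gamma> s = chart_inv c (\<beta> s)"
      and nz: "vector_derivative \<beta> (at ?s within I) \<noteq> 0"
    using assms t regular_curve_iff[OF assms(2)] unfolding regular_at_def by blast
  let ?V = "(\<lambda>t. m * t + k) -` U"
  have V: "open ?V" by (rule open_vimage[OF c(2)]) (intro continuous_intros)
  have "smooth_on (J \<inter> ?V) (\<lambda>t. m * t + k)"
    by (intro smooth_on_add smooth_on_mult smooth_on_const smooth_on_ident thick_Int_open assms(3) V)
  then have "smooth_on (J \<inter> ?V) (\<lambda>t. \<beta> (m * t + k))"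
    by (rule smooth_on_compose[OF sm]) (use assms thick_Int_open V c in auto)
  moreover have "vector_derivative (\<lambda>t. \<beta> (m * t + k)) (at t within J) = m *\<^sub>R vector_derivative \<beta> (at ?s within I)"
  proof (rule vector_derivative_within[OF thick_not_bot[OF assms(3) t]])
    have 1: "(\<beta> has_vector_derivative vector_derivative \<beta> (at ?s within I)) (at ?s within I)"
      using smooth_on_vector_derivative(2)[OF sm thick_Int_open[OF assms(2) c(2)], of ?s] t c(3) assms(4)
      by (auto simp: at_within_Int_open[OF c(2,3), of I])
    then have 1: "(\<beta> has_vector_derivative vector_derivative \<beta> (at ?s within I)) (at ?s within (\<lambda>t. m * t + k) ` J)"
      by (rule has_vector_derivative_within_subset) (use assms(4) in auto)
    have 2: "((\<lambda>t. m * t + k) has_vector_derivative m) (at t within J)"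
      by (auto intro!: derivative_eq_intros simp flip: has_real_derivative_iff_has_vector_derivative)
    show "((\<lambda>t. \<beta> (m * t + k)) has_vector_derivative m *\<^sub>R vector_derivative \<beta> (at ?s within I)) (at t within J)"
      using vector_diff_chain_within[OF 2 1] by (simp add: o_def)
  qed
  then have "vector_derivative (\<lambda>t. \<beta> (m * t + k)) (at t within J) \<noteq> 0" using nz assms(5) by simp
  ultimately show "regular_at J (\<lambda>t. \<gamma> (m * t + k)) t"
    unfolding regular_at_def using c V \<beta> assms(4)
    by (intro bexI[OF _ c(1)] exI[of _ ?V] exI[of _ "\<lambda>t. \<beta> (m * t + k)"]) auto
qed

section \<open>Piecewise regular curves: induction over the pieces, splitting,
  reparametrization\<close>

abbreviation "pw \<equiv> piecewise_regular_curve \<A>"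

lemma pw_refl: "pw a a \<gamma>"
  unfolding piecewise_regular_curve_def by (rule exI[of _ 0]) auto

lemma pw_append:
  assumes "pw a m \<gamma>" "m < b" "regular_curve \<A> {m..b} \<gamma>"
  shows "pw a b \<gamma>"
proof -
  obtain k s where s: "s 0 = a" "s k = m" "\<forall>i<k. s i < s (Suc i) \<and> regular_curve \<A> {s i..s (Suc i)} \<gamma>"
    using assms(1) unfolding piecewise_regular_curve_def by blast
  show ?thesis
    unfolding piecewise_regular_curve_def
    by (rule exI[of _ "Suc k"], rule exI[of _ "s(Suc k := b)"]) (use s assms in \<open>auto simp: less_Suc_eq\<close>)
qed

text \<open>A curve grows by regular pieces on the right; with this rule no later proof handles the
  partition itself.\<close>

lemma pw_induct [consumes 1, case_names refl append]:
  assumes "pw a b \<gamma>" "P a"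
    and "\<And>m b. pw a m \<gamma> \<Longrightarrow> P m \<Longrightarrow> m < b \<Longrightarrow> regular_curve \<A> {m..b} \<gamma> \<Longrightarrow> P b"
  shows "P b"
proof -
  obtain k s where s: "s 0 = a" "s k = b" "\<forall>i<k. s i < s (Suc i) \<and> regular_curve \<A> {s i..s (Suc i)} \<gamma>"
    using assms(1) unfolding piecewise_regular_curve_def by blast
  have "j \<le> k \<Longrightarrow> pw a (s j) \<gamma> \<and> P (s j)" for j
  proof (induction j)
    case 0 then show ?case using s(1) assms(2) pw_refl by simp
  next
    case (Suc j)
    then show ?case using s(3) assms(3)[of "s j" "s (Suc j)"] pw_append[of a "s j" \<gamma> "s (Suc j)"] by auto
  qed
  then show ?thesis using s(2) by blast
qed

lemma pw_le: "pw a b \<gamma> \<Longrightarrow> a \<le> b"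
  by (induction rule: pw_induct) auto

lemma pw_regular: "a < b \<Longrightarrow> regular_curve \<A> {a..b} \<gamma> \<Longrightarrow> pw a b \<gamma>"
  using pw_append[OF pw_refl] .

lemma pw_concat: "pw b c \<gamma> \<Longrightarrow> pw a b \<gamma> \<Longrightarrow> pw a c \<gamma>"
  by (induction rule: pw_induct) (auto intro: pw_append)

lemma pw_split: "pw a b \<gamma> \<Longrightarrow> a \<le> s \<Longrightarrow> s \<le> b \<Longrightarrow> pw a s \<gamma> \<and> pw s b \<gamma>"
proof (induction arbitrary: s rule: pw_induct)
  case refl
  then show ?case by (simp add: pw_refl)
next
  case (append m b)
  show ?case
  proof (cases "s \<le> m")
    case True
    then show ?thesis using append pw_append by blast
  next
    case False
    then have "regular_curve \<A> {m..s} \<gamma>"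
      using regular_curve_subset[OF append.hyps(3) thick_Icc thick_Icc] append by simp
    then have "pw a s \<gamma>" using pw_append append False by simp
    moreover have "pw s b \<gamma>"
    proof (cases "s = b")
      case True
      then show ?thesis by (simp add: pw_refl)
    next
      case False
      then have "s < b" using append by simp
      then have "regular_curve \<A> {s..b} \<gamma>"
        using regular_curve_subset[OF append.hyps(3) thick_Icc thick_Icc] append \<open>\<not> s \<le> m\<close> by simp
      then show ?thesis using pw_regular \<open>s < b\<close> by blast
    qed
    ultimately show ?thesis ..
  qed
qed

lemma pw_cong:
  assumes "pw a b \<gamma>" "\<And>t. a \<le> t \<Longrightarrow> t \<le> b \<Longrightarrow> \<gamma> t = \<delta> t"
  shows "pw a b \<delta>"
  using assms
proof (induction rule: pw_induct)
  case refl
  then show ?case by (simp add: pw_refl)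
next
  case (append m b)
  have "regular_curve \<A> {m..b} \<delta>"
    by (rule regular_curve_cong[OF append.hyps(3) thick_Icc]) (use append pw_le[OF append.hyps(1)] in auto)
  then show ?case using append by (auto intro!: pw_append[of a m \<delta> b])
qed

lemma pw_shift:
  assumes "pw a b \<gamma>"
  shows "pw (a - k) (b - k) (\<lambda>t. \<gamma> (t + k))"
  using assms
proof (induction rule: pw_induct)
  case refl
  then show ?case by (rule pw_refl)
next
  case (append m b)
  have "regular_curve \<A> {m - k..b - k} (\<lambda>t. \<gamma> (1 * t + k))"
    by (rule regular_curve_affine[OF append.hyps(3) thick_Icc thick_Icc]) (use append in auto)
  then show ?case using append by (auto intro!: pw_append[of "a - k" "m - k"])
qed

lemma pw_reverse:
  assumes "pw a b \<gamma>"
  shows "pw (- b) (- a) (\<lambda>t. \<gamma> (- t))"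
  using assms
proof (induction rule: pw_induct)
  case refl
  then show ?case by (rule pw_refl)
next
  case (append m b)
  have "regular_curve \<A> {- b..- m} (\<lambda>t. \<gamma> ((- 1) * t + 0))"
    by (rule regular_curve_affine[OF append.hyps(3) thick_Icc thick_Icc]) (use append in auto)
  then show ?case using append pw_regular[of "- b" "- m"] by (auto intro: pw_concat)
qed

end

section \<open>Speed and length\<close>

context cont_metric
begin

text \<open>Two-sided speed; it differs from the speed on an interval at the end points only,
  which makes lengths of concatenated curves additive without further ado.\<close>

definition sp :: "(real \<Rightarrow> 'a) \<Rightarrow> real \<Rightarrow> real" where "sp \<gamma> t = speed \<A> g UNIV \<gamma> t"

text \<open>What survives of a regular curve off the break points (\<open>pw_nice\<close>); it
  suffices to compute \<open>sp\<close> in any chart around the point.\<close>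

definition nice_at :: "(real \<Rightarrow> 'a) \<Rightarrow> real \<Rightarrow> bool" where
  "nice_at \<gamma> t \<longleftrightarrow> isCont \<gamma> t \<and> isCont (sp \<gamma>) t \<and>
     (\<forall>c\<in>\<A>. \<gamma> t \<in> chart_dom c \<longrightarrow> (\<exists>h'. ((chart_map c \<circ> \<gamma>) has_vector_derivative h') (at t)))"

lemma sp_eq:
  assumes "c \<in> \<A>" "\<gamma> t \<in> chart_dom c" "isCont \<gamma> t" "((chart_map c \<circ> \<gamma>) has_vector_derivative h') (at t)"
  shows "sp \<gamma> t = form_norm (G c (chart_map c (\<gamma> t))) h'"
  unfolding sp_def by (rule speed_eq) (use assms in auto)

lemma nice_at_cong:
  assumes "nice_at \<gamma> t" "open U" "t \<in> U" "\<And>s. s \<in> U \<Longrightarrow> \<gamma> s = \<delta> s"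
  shows "nice_at \<delta> t" "sp \<delta> t = sp \<gamma> t"
proof -
  have e: "eventually (\<lambda>s. \<gamma> s = \<delta> s) (nhds t)"
    unfolding eventually_nhds using assms(2-4) by blast
  have vd: "((chart_map c \<circ> \<gamma>) has_vector_derivative h') (at s) \<longleftrightarrow> ((chart_map c \<circ> \<delta>) has_vector_derivative h') (at s)" 
    if "s \<in> U" for c :: "('a, 'e) chart" and h' s
    using has_vector_derivative_transform_within_open[OF _ assms(2) that, of "chart_map c \<circ> \<gamma>" h' "chart_map c \<circ> \<delta>"]
      has_vector_derivative_transform_within_open[OF _ assms(2) that, of "chart_map c \<circ> \<delta>" h' "chart_map c \<circ> \<gamma>"]
      assms(4) by auto
  have sp: "sp \<delta> s = sp \<gamma> s" if "s \<in> U" for s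
  proof -
    have "vector_derivative (chart_map c \<circ> \<gamma>) (at s) = vector_derivative (chart_map c \<circ> \<delta>) (at s)" for c :: "('a, 'e) chart"
      unfolding vector_derivative_def using vd[OF that] by simp
    then have "velocity \<A> UNIV \<gamma> s = velocity \<A> UNIV \<delta> s"
      unfolding velocity_def assms(4)[OF that] by presburger
    then show ?thesis unfolding sp_def speed_def using assms(4)[OF that] by simp
  qed
  then show "sp \<delta> t = sp \<gamma> t" using assms(3) .
  have e': "eventually (\<lambda>s. sp \<gamma> s = sp \<delta> s) (nhds t)"
    unfolding eventually_nhds using assms(2,3) sp by metis
  have "isCont \<delta> t" "isCont (sp \<delta>) t"
    using assms(1) isCont_cong[OF e] isCont_cong[OF e'] unfolding nice_at_def by blast+
  moreover have "\<exists>h'. ((chart_map c \<circ> \<delta>) has_vector_derivative h') (at t)"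
    if "c \<in> \<A>" "\<delta> t \<in> chart_dom c" for c
  proof -
    have "\<gamma> t \<in> chart_dom c" using that assms(3,4) by simp
    then show ?thesis using assms(1) that(1) vd[OF assms(3)] unfolding nice_at_def by blast
  qed
  ultimately show "nice_at \<delta> t" unfolding nice_at_def by blast
qed

lemma sp_nonneg: "nice_at \<gamma> t \<Longrightarrow> sp \<gamma> t \<ge> 0"
proof -
  assume n: "nice_at \<gamma> t"
  obtain c where c: "c \<in> \<A>" "\<gamma> t \<in> chart_dom c" using chart_cover .
  then obtain h' where "((chart_map c \<circ> \<gamma>) has_vector_derivative h') (at t)" using n unfolding nice_at_def by blast
  then have "sp \<gamma> t = form_norm (G c (chart_map c (\<gamma> t))) h'"
    using sp_eq c n unfolding nice_at_def by blast
  then show ?thesis using form_norm_nonneg[OF G_form[OF c(1)]] c(2) by auto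
qed

lemma regular_speed_continuous:
  assumes "regular_curve \<A> I \<gamma>" "thick I"
  shows "continuous_on I (speed \<A> g I \<gamma>)"
  unfolding continuous_on_eq_continuous_within
proof
  fix t assume t: "t \<in> I"
  have cont: "continuous_on I \<gamma>" using assms(1) unfolding regular_curve_def by blast
  obtain c where c: "c \<in> \<A>" "\<gamma> t \<in> chart_dom c" using chart_cover .
  obtain U where U: "open U" "I \<inter> \<gamma> -` chart_dom c = I \<inter> U"
    using continuous_preimage_relatively_open[OF cont open_dom[OF c(1)]] .
  let ?h = "\<lambda>t. vector_derivative (chart_map c \<circ> \<gamma>) (at t within I)"
  have sub: "s \<in> I" "\<gamma> s \<in> chart_dom c" if "s \<in> I \<inter> U" for s using that U(2) by auto
  have "continuous_on (I \<inter> U) (\<lambda>s. form_norm (G c (chart_map c (\<gamma> s))) (?h s))"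
    unfolding form_norm_def
  proof (intro continuous_on_real_sqrt G_continuous[OF c(1)])
    show "continuous_on (I \<inter> U) (\<lambda>s. chart_map c (\<gamma> s))"
      by (rule continuous_on_compose2[OF continuous_chart[OF c(1)] continuous_on_subset[OF cont]]) (use sub in auto)
    show h: "continuous_on (I \<inter> U) ?h"
      using smooth_on_imp_continuous_on[OF regular_curve_chart(1)[OF assms c(1)]] U(2) by simp
    show "continuous_on (I \<inter> U) ?h" by (rule h)
    show "(\<lambda>s. chart_map c (\<gamma> s)) ` (I \<inter> U) \<subseteq> chart_map c ` chart_dom c" using sub by auto
  qed
  moreover have "form_norm (G c (chart_map c (\<gamma> s))) (?h s) = speed \<A> g I \<gamma> s" if s: "s \<in> I \<inter> U" for s
    using speed_eq[OF c(1) sub(2)[OF s] sub(1)[OF s] thick_not_bot[OF assms(2) sub(1)[OF s]] _ 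
        regular_curve_chart(2)[OF assms c(1) sub[OF s]]] cont sub(1)[OF s]
    by (simp add: continuous_on_eq_continuous_within)
  ultimately have "continuous_on (I \<inter> U) (speed \<A> g I \<gamma>)" by (rule continuous_on_eq)
  moreover have tU: "t \<in> U" using U(2) t c(2) by auto
  ultimately have "(speed \<A> g I \<gamma> \<longlongrightarrow> speed \<A> g I \<gamma> t) (at t within I \<inter> U)"
    using t unfolding continuous_on_def by blast
  then show "continuous (at t within I) (speed \<A> g I \<gamma>)"
    by (simp add: continuous_within at_within_Int_open[OF U(1) tU])
qed

lemma speed_interior:
  assumes "t \<in> interior I"
  shows "speed \<A> g I \<gamma> t = sp \<gamma> t"
  unfolding speed_def sp_def velocity_def at_within_interior[OF assms] ..

lemma regular_nice_at:
  assumes "regular_curve \<A> I \<gamma>" "thick I" "t \<in> interior I"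
  shows "nice_at \<gamma> t"
proof -
  have t: "t \<in> I" using assms(3) interior_subset by blast
  have w: "at t within I = at t" using at_within_interior[OF assms(3)] .
  have "isCont \<gamma> t"
    using assms(1) t w unfolding regular_curve_def continuous_on_eq_continuous_within by metis
  moreover have "continuous_on (interior I) (sp \<gamma>)"
    by (rule continuous_on_eq[OF continuous_on_subset[OF regular_speed_continuous[OF assms(1,2)] interior_subset]])
       (rule speed_interior)
  then have "isCont (sp \<gamma>) t" using assms(3) by (simp add: continuous_on_eq_continuous_at)
  ultimately show ?thesis
    using regular_curve_chart(2)[OF assms(1,2) _ t] w unfolding nice_at_def by metis
qed

lemma speed_integrable_eq:
  assumes "a < b" "regular_curve \<A> {a..b} \<gamma>"
  shows "sp \<gamma> integrable_on {a..b}"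
proof (rule integrable_spike_finite[of "{a, b}"])
  show "speed \<A> g {a..b} \<gamma> integrable_on {a..b}"
    by (rule integrable_continuous_real[OF regular_speed_continuous[OF assms(2) thick_Icc[OF assms(1)]]])
qed (use speed_interior[of _ "{a..b}"] in auto)

lemma pw_nice:
  assumes "pw a b \<gamma>"
  shows "continuous_on {a..b} \<gamma>" "sp \<gamma> integrable_on {a..b}"
    "\<exists>F. finite F \<and> (\<forall>t\<in>{a<..<b} - F. nice_at \<gamma> t)"
proof -
  have "continuous_on {a..b} \<gamma> \<and> sp \<gamma> integrable_on {a..b} \<and> (\<exists>F. finite F \<and> (\<forall>t\<in>{a<..<b} - F. nice_at \<gamma> t))"
    using assms
  proof (induction rule: pw_induct)
    case (append m b)
    have ab: "a \<le> m" "m < b" using append pw_le by auto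
    then have u: "{a..m} \<union> {m..b} = {a..b}" by auto
    have "continuous_on ({a..m} \<union> {m..b}) \<gamma>"
      using append by (intro continuous_on_closed_Un) (auto simp: regular_curve_def)
    moreover have "sp \<gamma> integrable_on {a..b}"
      using append ab speed_integrable_eq by (auto intro: Henstock_Kurzweil_Integration.integrable_combine[of a m b])
    moreover obtain F where F: "finite F" "\<forall>t\<in>{a<..<m} - F. nice_at \<gamma> t" using append by blast
    have "\<forall>t\<in>{a<..<b} - insert m F. nice_at \<gamma> t"
    proof
      fix t assume t: "t \<in> {a<..<b} - insert m F"
      then consider "t \<in> {a<..<m} - F" | "t \<in> {m<..<b}" by force
      then show "nice_at \<gamma> t"
        using F regular_nice_at[OF append.hyps(3) thick_Icc[OF ab(2)], of t] by cases auto
    qed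
    then have "\<exists>F. finite F \<and> (\<forall>t\<in>{a<..<b} - F. nice_at \<gamma> t)" using F(1) by blast
    ultimately show ?case using u by simp
  next
    case refl
    then show ?case using integrable_on_refl[of "sp \<gamma>" a] by (auto intro: exI[of _ "{}"])
  qed
  then show "continuous_on {a..b} \<gamma>" "sp \<gamma> integrable_on {a..b}"
    "\<exists>F. finite F \<and> (\<forall>t\<in>{a<..<b} - F. nice_at \<gamma> t)" by auto
qed

lemma curve_length_eq: "curve_length \<A> g a b \<gamma> = integral {a..b} (sp \<gamma>)"
  unfolding curve_length_def
  by (rule integral_spike[of "{a, b}"]) (use speed_interior[of _ "{a..b}"] in auto)

lemma pw_integral_nonneg:
  assumes "pw a b \<gamma>"
  shows "integral {a..b} (sp \<gamma>) \<ge> 0"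
proof -
  obtain F where F: "finite F" "\<forall>t\<in>{a<..<b} - F. nice_at \<gamma> t" using pw_nice(3)[OF assms] by blast
  \<comment> \<open>At break points \<open>sp\<close> is an unspecified value, possibly negative;
    replacing it there by 0 does not affect the integral.\<close>
  define f where "f t = (if t \<in> {a, b} \<union> F then 0 else sp \<gamma> t)" for t
  have "integral {a..b} f = integral {a..b} (sp \<gamma>)"
    by (rule integral_spike[of "{a, b} \<union> F"]) (use F(1) in \<open>auto simp: f_def intro: negligible_finite\<close>)
  moreover have "f integrable_on {a..b}"
    by (rule integrable_spike_finite[of "{a, b} \<union> F" _ _ "sp \<gamma>"]) (use F(1) pw_nice(2)[OF assms] in \<open>auto simp: f_def\<close>)
  moreover have "f t \<ge> 0" if "t \<in> {a..b}" for t using that F sp_nonneg by (auto simp: f_def)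
  ultimately show ?thesis using integral_nonneg by metis
qed

lemma pw_integral_combine:
  assumes "pw a b \<gamma>" "a \<le> s" "s \<le> b"
  shows "integral {a..s} (sp \<gamma>) + integral {s..b} (sp \<gamma>) = integral {a..b} (sp \<gamma>)"
  using Henstock_Kurzweil_Integration.integral_combine[OF assms(2,3) pw_nice(2)[OF assms(1)]] .

end

section \<open>The Riemannian distance\<close>

context cont_metric
begin

lemma chart_curve:
  assumes "c \<in> \<A>" "thick I" "smooth_on I \<beta>" "\<And>t. t \<in> I \<Longrightarrow> \<beta> t \<in> chart_map c ` chart_dom c"
    and "\<And>t. t \<in> I \<Longrightarrow> (\<beta> has_vector_derivative \<beta>' t) (at t within I)" "\<And>t. t \<in> I \<Longrightarrow> \<beta>' t \<noteq> 0"
  shows "regular_curve \<A> I (\<lambda>t. chart_inv c (\<beta> t))"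
    and "\<And>t. t \<in> I \<Longrightarrow> speed \<A> g I (\<lambda>t. chart_inv c (\<beta> t)) t = form_norm (G c (\<beta> t)) (\<beta>' t)"
proof -
  have "vector_derivative \<beta> (at t within I) = \<beta>' t" if "t \<in> I" for t
    using vector_derivative_within[OF thick_not_bot[OF assms(2) that] assms(5)[OF that]] .
  then show r: "regular_curve \<A> I (\<lambda>t. chart_inv c (\<beta> t))"
    unfolding regular_curve_iff[OF assms(2)] regular_at_def
    by (intro ballI bexI[OF _ assms(1)] exI[of _ UNIV] exI[of _ \<beta>]) (use assms in auto)
  fix t assume t: "t \<in> I"
  have "continuous (at t within I) (\<lambda>t. chart_inv c (\<beta> t))"
    using r t unfolding regular_curve_def by (simp add: continuous_on_eq_continuous_within)
  moreover have "((chart_map c \<circ> (\<lambda>t. chart_inv c (\<beta> t))) has_vector_derivative \<beta>' t) (at t within I)"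
    by (rule has_vector_derivative_transform[OF t _ assms(5)[OF t]]) (use assms(4) chart_map_inv[OF assms(1)] in auto)
  ultimately show "speed \<A> g I (\<lambda>t. chart_inv c (\<beta> t)) t = form_norm (G c (\<beta> t)) (\<beta>' t)"
    using speed_eq[OF assms(1) _ t thick_not_bot[OF assms(2) t], of "\<lambda>t. chart_inv c (\<beta> t)" "\<beta>' t"]
      chart_inv_dom[OF assms(1) assms(4)[OF t]] chart_map_inv[OF assms(1) assms(4)[OF t]] by simp
qed

lemma length_cong:
  assumes "pw a b \<gamma>" "\<And>t. a \<le> t \<Longrightarrow> t \<le> b \<Longrightarrow> \<gamma> t = \<delta> t"
  shows "integral {a..b} (sp \<delta>) = integral {a..b} (sp \<gamma>)"
proof -
  obtain F where F: "finite F" "\<forall>t\<in>{a<..<b} - F. nice_at \<gamma> t" using pw_nice(3)[OF assms(1)] by blast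
  show ?thesis
  proof (rule integral_spike[of "{a, b} \<union> F"])
    fix t assume t: "t \<in> {a..b} - ({a, b} \<union> F)"
    then have n: "nice_at \<gamma> t" using F(2) by auto
    show "sp \<gamma> t = sp \<delta> t"
      by (rule nice_at_cong(2)[OF n, where U = "{a<..<b}" and \<delta> = \<delta>, symmetric]) (use t assms(2) in auto)
  qed (use F(1) in \<open>auto intro: negligible_finite\<close>)
qed

lemma sp_affine:
  assumes n: "nice_at \<gamma> (m * t + k)"
  shows "sp (\<lambda>t. \<gamma> (m * t + k)) t = \<bar>m\<bar> * sp \<gamma> (m * t + k)"
proof -
  let ?s = "m * t + k"
  obtain c where c: "c \<in> \<A>" "\<gamma> ?s \<in> chart_dom c" using chart_cover .
  obtain h' where h: "((chart_map c \<circ> \<gamma>) has_vector_derivative h') (at ?s)"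
    using n c unfolding nice_at_def by blast
  have cont: "isCont \<gamma> ?s" using n unfolding nice_at_def by blast
  have "((\<lambda>t. m * t + k) has_vector_derivative m) (at t)"
    by (auto intro!: derivative_eq_intros simp flip: has_real_derivative_iff_has_vector_derivative)
  then have "((chart_map c \<circ> \<gamma>) \<circ> (\<lambda>t. m * t + k) has_vector_derivative m *\<^sub>R h') (at t)"
    by (rule vector_diff_chain_at[where f = "\<lambda>t. m * t + k"]) (rule h)
  then have "((chart_map c \<circ> (\<lambda>t. \<gamma> (m * t + k))) has_vector_derivative m *\<^sub>R h') (at t)"
    by (simp add: o_def)
  moreover have "isCont (\<lambda>t. \<gamma> (m * t + k)) t"
    by (rule isCont_o2[where g = \<gamma>]) (use cont in \<open>auto intro: continuous_intros\<close>)
  ultimately have "sp (\<lambda>t. \<gamma> (m * t + k)) t = form_norm (G c (chart_map c (\<gamma> ?s))) (m *\<^sub>R h')"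
    using sp_eq[OF c(1), of "\<lambda>t. \<gamma> (m * t + k)"] c(2) by blast
  also have "\<dots> = \<bar>m\<bar> * sp \<gamma> ?s"
    using form_norm_scale[OF G_form[OF c(1)]] c(2) sp_eq[OF c cont h] by simp
  finally show ?thesis .
qed

lemma length_shift:
  assumes "pw a b \<gamma>"
  shows "integral {a - k..b - k} (sp (\<lambda>t. \<gamma> (t + k))) = integral {a..b} (sp \<gamma>)"
proof -
  obtain F where F: "finite F" "\<forall>t\<in>{a<..<b} - F. nice_at \<gamma> t" using pw_nice(3)[OF assms(1)] by blast
  have "integral {a - k..b - k} (sp (\<lambda>t. \<gamma> (t + k))) = integral {a - k..b - k} (\<lambda>t. sp \<gamma> (t + k))"
  proof (rule integral_spike[of "{a - k, b - k} \<union> (\<lambda>t. t - k) ` F"])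
    fix t assume t: "t \<in> {a - k..b - k} - ({a - k, b - k} \<union> (\<lambda>t. t - k) ` F)"
    then have "t + k \<in> {a<..<b} - F" by force
    then show "sp \<gamma> (t + k) = sp (\<lambda>t. \<gamma> (t + k)) t"
      using sp_affine[of \<gamma> 1 t k] F(2) by simp
  qed (use F(1) in \<open>auto intro: negligible_finite\<close>)
  also have "\<dots> = integral {a..b} (sp \<gamma>)"
    using has_integral_shift_real_ivl[OF integrable_integral[OF pw_nice(2)[OF assms]], of k] by (rule integral_unique)
  finally show ?thesis .
qed

lemma length_reverse:
  assumes "pw a b \<gamma>"
  shows "integral {- b..- a} (sp (\<lambda>t. \<gamma> (- t))) = integral {a..b} (sp \<gamma>)"
proof -
  obtain F where F: "finite F" "\<forall>t\<in>{a<..<b} - F. nice_at \<gamma> t" using pw_nice(3)[OF assms(1)] by blast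
  have "integral {- b..- a} (sp (\<lambda>t. \<gamma> (- t))) = integral {- b..- a} (\<lambda>t. sp \<gamma> (- t))"
  proof (rule integral_spike[of "{- b, - a} \<union> uminus ` F"])
    fix t assume t: "t \<in> {- b..- a} - ({- b, - a} \<union> uminus ` F)"
    then have "- t \<in> {a<..<b} - F" by force
    then show "sp \<gamma> (- t) = sp (\<lambda>t. \<gamma> (- t)) t"
      using sp_affine[of \<gamma> "-1" t 0] F(2) by simp
  qed (use F(1) in \<open>auto intro: negligible_finite\<close>)
  also have "\<dots> = integral {a..b} (sp \<gamma>)"
    using has_integral_reflect_lemma_real[OF integrable_integral[OF pw_nice(2)[OF assms]]] by (rule integral_unique)
  finally show ?thesis .
qed

lemma curve_concat:
  assumes "pw a b \<gamma>" "pw a' b' \<gamma>'" "\<gamma> b = \<gamma>' a'"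
  obtains e \<delta> where "pw a e \<delta>" "\<delta> a = \<gamma> a" "\<delta> e = \<gamma>' b'"
    "integral {a..e} (sp \<delta>) = integral {a..b} (sp \<gamma>) + integral {a'..b'} (sp \<gamma>')"
proof -
  define k where "k = a' - b"
  define \<delta> where "\<delta> t = (if t \<le> b then \<gamma> t else \<gamma>' (t + k))" for t
  have sh: "pw b (b' - k) (\<lambda>t. \<gamma>' (t + k))" using pw_shift[OF assms(2), of k] by (simp add: k_def)
  have e1: "\<gamma> t = \<delta> t" if "t \<le> b" for t using that by (simp add: \<delta>_def)
  have e2: "\<gamma>' (t + k) = \<delta> t" if "b \<le> t" for t using that assms(3) by (auto simp: \<delta>_def k_def)
  have p1: "pw a b \<delta>" by (rule pw_cong[OF assms(1)]) (simp add: e1)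
  have p2: "pw b (b' - k) \<delta>" by (rule pw_cong[OF sh]) (simp add: e2)
  have p: "pw a (b' - k) \<delta>" using pw_concat[OF p2 p1] .
  have "integral {a..b' - k} (sp \<delta>) = integral {a..b} (sp \<delta>) + integral {b..b' - k} (sp \<delta>)"
    using pw_integral_combine[OF p pw_le[OF p1] pw_le[OF p2]] by simp
  also have "integral {a..b} (sp \<delta>) = integral {a..b} (sp \<gamma>)"
    by (rule length_cong[OF assms(1)]) (simp add: e1)
  also have "integral {b..b' - k} (sp \<delta>) = integral {b..b' - k} (sp (\<lambda>t. \<gamma>' (t + k)))"
    by (rule length_cong[OF sh]) (simp add: e2)
  also have "\<dots> = integral {a'..b'} (sp \<gamma>')"
    using length_shift[OF assms(2), of k] by (simp add: k_def)
  finally show ?thesis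
    using that[OF p] pw_le[OF assms(1)] pw_le[OF p2] e1 e2 by (metis diff_add_cancel)
qed

section \<open>Lengths of connecting curves and their comparison with constant metrics\<close>

definition joined :: "'a \<Rightarrow> 'a \<Rightarrow> real \<Rightarrow> bool" where
  "joined x y l \<longleftrightarrow> (\<exists>a b \<gamma>. pw a b \<gamma> \<and> \<gamma> a = x \<and> \<gamma> b = y \<and> integral {a..b} (sp \<gamma>) = l)"

abbreviation d where "d \<equiv> riemannian_dist \<A> g"

lemma d_Inf: "d x y = Inf {l. joined x y l}"
  unfolding riemannian_dist_def joined_def curve_length_eq by (rule arg_cong[where f = Inf]) blast

lemma joined_refl: "joined x x 0"
  unfolding joined_def by (intro exI[of _ 0] exI[of _ "\<lambda>_. x"]) (simp add: pw_refl)

lemma joined_nonneg: "joined x y l \<Longrightarrow> l \<ge> 0"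
  unfolding joined_def using pw_integral_nonneg by blast

lemma joined_sym: "joined x y l \<Longrightarrow> joined y x l"
  unfolding joined_def using pw_reverse length_reverse by (metis minus_minus)

lemma joined_trans: "joined x y l \<Longrightarrow> joined y z l' \<Longrightarrow> joined x z (l + l')"
  unfolding joined_def using curve_concat by (smt (verit))

text \<open>The straight segment in the chart stays in the convex set \<open>V\<close>, where the
  metric exceeds the constant form \<open>B\<close> by at most the factor \<open>K\<close>.\<close>

lemma joined_segment:
  assumes c: "c \<in> \<A>" and V: "convex V" "V \<subseteq> chart_map c ` chart_dom c" "x \<in> V" "y \<in> V"
    and "inner_form B" "\<And>z u. z \<in> V \<Longrightarrow> form_norm (G c z) u \<le> K * form_norm B u"
  shows "\<exists>l\<le>K * form_norm B (y - x). joined (chart_inv c x) (chart_inv c y) l"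
\<comment> \<open>A segment between equal points has zero velocity and is not regular; the trivial
  curve takes its place.\<close>
proof (cases "x = y")
  case True
  then show ?thesis using joined_refl assms(6) by (auto simp: form_norm_def form_zero)
next
  case False
  define \<beta> where "\<beta> t = x + t *\<^sub>R (y - x)" for t :: real
  have th: "thick {0..1::real}" by (simp add: thick_Icc)
  have \<beta>V: "\<beta> t \<in> V" if "t \<in> {0..1}" for t
  proof -
    have "\<beta> t = (1 - t) *\<^sub>R x + t *\<^sub>R y" by (simp add: \<beta>_def algebra_simps)
    then show ?thesis using convexD_alt[OF V(1,3,4)] that by simp
  qed
  have sm: "smooth_on {0..1} \<beta>"
    unfolding \<beta>_def by (intro smooth_on_add smooth_on_scaleR smooth_on_const smooth_on_ident th)
  have der: "(\<beta> has_vector_derivative y - x) (at t within S)" for t S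
    unfolding \<beta>_def by (auto intro!: derivative_eq_intros)
  let ?\<gamma> = "\<lambda>t. chart_inv c (\<beta> t)"
  have cc: "regular_curve \<A> {0..1} ?\<gamma>" "\<And>t. t \<in> {0..1} \<Longrightarrow> speed \<A> g {0..1} ?\<gamma> t = form_norm (G c (\<beta> t)) (y - x)"
    using chart_curve[OF c th sm subsetD[OF V(2) \<beta>V] der] False by simp_all
  have p: "pw 0 1 ?\<gamma>" by (rule pw_regular[OF _ cc(1)]) simp
  have "curve_length \<A> g 0 1 ?\<gamma> \<le> integral {0..1::real} (\<lambda>t. K * form_norm B (y - x))"
    unfolding curve_length_def
    by (rule integral_le) 
       (use assms(7) \<beta>V cc(2) integrable_continuous_real[OF regular_speed_continuous[OF cc(1) th]] in auto)
  then have "integral {0..1} (sp ?\<gamma>) \<le> K * form_norm B (y - x)" by (simp add: curve_length_eq)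
  then show ?thesis
    using p unfolding joined_def by (intro exI[of _ "integral {0..1} (sp ?\<gamma>)"]) (auto simp: \<beta>_def intro!: exI)
qed

text \<open>By Cauchy-Schwarz the product of the curve with its chord w changes at a rate of at most
  \<open>K\<close> times the speed times |w|. Integration gives |w|^2 \<le> K |w| times the length,
  and one factor |w| cancels.\<close>

lemma curve_lower_bound:
  assumes c: "c \<in> \<A>" and p: "pw a b \<gamma>" and V: "\<And>t. t \<in> {a..b} \<Longrightarrow> \<gamma> t \<in> chart_dom c \<and> chart_map c (\<gamma> t) \<in> V"
    and B: "inner_form B" and K: "\<And>z u. z \<in> V \<Longrightarrow> form_norm B u \<le> K * form_norm (G c z) u" "K \<ge> 0"
  shows "form_norm B (chart_map c (\<gamma> b) - chart_map c (\<gamma> a)) \<le> K * integral {a..b} (sp \<gamma>)"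
proof -
  define w where "w = chart_map c (\<gamma> b) - chart_map c (\<gamma> a)"
  define N where "N = form_norm B w"
  have N: "N \<ge> 0" unfolding N_def by (rule form_norm_nonneg[OF B])
  obtain F where F: "finite F" "\<forall>t\<in>{a<..<b} - F. nice_at \<gamma> t" using pw_nice(3)[OF p] by blast
  have "\<exists>h'. ((chart_map c \<circ> \<gamma>) has_vector_derivative h') (at t)" if "t \<in> {a<..<b} - F" for t
    using that F(2) V[of t] c unfolding nice_at_def by auto
  then obtain h' where h': "\<And>t. t \<in> {a<..<b} - F \<Longrightarrow> ((chart_map c \<circ> \<gamma>) has_vector_derivative h' t) (at t)" by metis
  have lin: "bounded_linear (\<lambda>u. B u w)"
    using form_linear_left[OF B] linear_conv_bounded_linear by blast
  \<comment> \<open>At the exceptional times \<open>f\<close> is given the value of the upper bound,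
    so that the comparison of the integrands holds everywhere.\<close>
  define f where "f t = (if t \<in> {a<..<b} - F then B (h' t) w else K * sp \<gamma> t * N)" for t
  have "(f has_integral B (chart_map c (\<gamma> b)) w - B (chart_map c (\<gamma> a)) w) {a..b}"
  proof (rule fundamental_theorem_of_calculus_interior_strong[OF F(1) pw_le[OF p]])
    show "((\<lambda>t. B (chart_map c (\<gamma> t)) w) has_vector_derivative f t) (at t)" if "t \<in> {a<..<b} - F" for t
      using bounded_linear.has_vector_derivative[OF lin h'[OF that]] that by (simp add: f_def o_def)
    show "continuous_on {a..b} (\<lambda>t. B (chart_map c (\<gamma> t)) w)"
      by (intro form_continuous[OF B] continuous_on_const continuous_on_compose2[OF continuous_chart[OF c] pw_nice(1)[OF p]])
         (use V in auto)
  qed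
  moreover have "B (chart_map c (\<gamma> b)) w - B (chart_map c (\<gamma> a)) w = N\<^sup>2"
    using form_norm_square[OF B, of w] by (simp add: N_def w_def form_diff_left[OF B])
  ultimately have "(f has_integral N\<^sup>2) {a..b}" by simp
  moreover have "((\<lambda>t. (K * N) * sp \<gamma> t) has_integral (K * N) * integral {a..b} (sp \<gamma>)) {a..b}"
    using integrable_integral[OF pw_nice(2)[OF p]] by (rule has_integral_mult_right)
  moreover have "f t \<le> (K * N) * sp \<gamma> t" if "t \<in> {a..b}" for t
  proof (cases "t \<in> {a<..<b} - F")
    case True
    have "B (h' t) w \<le> form_norm B (h' t) * N" using form_Cauchy_Schwarz[OF B, of "h' t" w] by (simp add: N_def)
    also have "\<dots> \<le> K * form_norm (G c (chart_map c (\<gamma> t))) (h' t) * N"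
      by (intro mult_right_mono K N) (use V that in auto)
    also have "form_norm (G c (chart_map c (\<gamma> t))) (h' t) = sp \<gamma> t"
      using sp_eq[OF c _ _ h'[OF True]] V[OF that] F(2) True unfolding nice_at_def by auto
    finally show ?thesis using True by (simp add: f_def mult_ac)
  next
    case False
    then show ?thesis unfolding f_def if_not_P[OF False] by (simp add: mult_ac)
  qed
  ultimately have "N\<^sup>2 \<le> (K * N) * integral {a..b} (sp \<gamma>)" by (rule has_integral_le)
  then have "N * N \<le> N * (K * integral {a..b} (sp \<gamma>))" by (simp add: power2_eq_square mult_ac)
  then have "N \<le> K * integral {a..b} (sp \<gamma>)"
    using N K(2) pw_integral_nonneg[OF p] by (cases "N = 0") auto
  then show ?thesis by (simp add: N_def w_def)
qed

lemma nearly_constant_metric: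
  assumes c: "c \<in> \<A>" "p \<in> chart_dom c" and K: "K > 1" and U: "open U" "p \<in> U"
  obtains r where "r > 0" "ball (chart_map c p) r \<subseteq> chart_map c ` (chart_dom c \<inter> U)"
    "\<And>z u. z \<in> ball (chart_map c p) r \<Longrightarrow> form_norm (G c z) u \<le> K * form_norm (G c (chart_map c p)) u"
    "\<And>z u. z \<in> ball (chart_map c p) r \<Longrightarrow> form_norm (G c (chart_map c p)) u \<le> K * form_norm (G c z) u"
proof -
  let ?x = "chart_map c p" and ?S = "chart_map c ` (chart_dom c \<inter> U)"
  define B where "B = G c ?x"
  have x: "?x \<in> chart_map c ` chart_dom c" using c(2) by auto
  have B: "inner_form B" unfolding B_def by (rule G_form[OF c(1) x])
  obtain m M where m: "m > 0" "\<And>u. m * norm u \<le> form_norm B u" using form_norm_equiv[OF B] by metis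
  \<comment> \<open>Chosen with 1 - \<delta> = 1 / K^2; then 1 + \<delta> \<le> K^2 because K^2 + 1
    / K^2 \<ge> 2.\<close>
  define \<delta> where "\<delta> = 1 - 1 / K\<^sup>2"
  have K2: "K\<^sup>2 > 1" using K by simp
  have \<delta>: "\<delta> > 0" "1 + \<delta> \<le> K\<^sup>2" 
  proof -
    show "\<delta> > 0" using K2 unfolding \<delta>_def by (simp add: divide_less_eq)
    define k where "k = K\<^sup>2"
    have k: "k > 1" using K2 by (simp add: k_def)
    have "0 \<le> (k - 1) * (k - 1)" by simp
    then have "2 - 1 / k \<le> k" using k by (simp add: field_simps)
    then show "1 + \<delta> \<le> K\<^sup>2" by (simp add: \<delta>_def k_def)
  qed
  \<comment> \<open>There is one coefficient error for each pair of basis vectors, each at most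
    \<eta> |u|^2; they add up to \<delta> m^2 |u|^2, which is at most
    \<open>\<delta> * B u u\<close>.\<close>
  define \<eta> where "\<eta> = \<delta> * m\<^sup>2 / (real DIM('e))\<^sup>2"
  have \<eta>: "\<eta> > 0" using \<delta>(1) m(1) by (simp add: \<eta>_def)
  have "eventually (\<lambda>z. \<forall>i\<in>Basis. \<forall>j\<in>Basis. \<bar>G c z i j - B i j\<bar> < \<eta>) (at ?x)"
  proof (intro eventually_ball_finite finite_Basis ballI)
    fix i j :: 'e
    have "continuous_on (chart_map c ` chart_dom c) (\<lambda>z. G c z i j)"
      using g_cont[OF c(1)] unfolding G_def .
    then have "((\<lambda>z. G c z i j) \<longlongrightarrow> G c ?x i j) (at ?x)"
      using x open_range[OF c(1)] by (metis continuous_on_eq_continuous_at isCont_def)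
    then show "eventually (\<lambda>z. \<bar>G c z i j - B i j\<bar> < \<eta>) (at ?x)"
      using \<eta> unfolding tendsto_iff dist_real_def B_def by blast
  qed
  then obtain r1 where r1: "r1 > 0" "\<And>z i j. z \<in> ball ?x r1 \<Longrightarrow> i \<in> Basis \<Longrightarrow> j \<in> Basis \<Longrightarrow> \<bar>G c z i j - B i j\<bar> < \<eta>"
    unfolding eventually_at using \<eta> by (auto simp: B_def dist_commute) (metis abs_zero diff_self)
  obtain r2 where r2: "r2 > 0" "ball ?x r2 \<subseteq> ?S"
    using openE[OF open_overlap[OF c(1) U(1)], of ?x] c(2) U(2) by blast
  define r where "r = min r1 r2"
  have r: "r > 0" "ball ?x r \<subseteq> ?S" using r1 r2 unfolding r_def by auto
  have est: "\<bar>G c z u u - B u u\<bar> \<le> \<delta> * B u u" and form: "inner_form (G c z)" if z: "z \<in> ball ?x r" for z u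
  proof -
    have zz: "z \<in> chart_map c ` chart_dom c" using r(2) z by blast
    show fz: "inner_form (G c z)" by (rule G_form[OF c(1) zz])
    have "\<bar>G c z u u - B u u\<bar> = \<bar>\<Sum>i\<in>Basis. \<Sum>j\<in>Basis. (u \<bullet> i) * (u \<bullet> j) * (G c z i j - B i j)\<bar>"
      by (subst form_expand[OF fz], subst form_expand[OF B]) (simp add: sum_subtractf right_diff_distrib)
    also have "\<dots> \<le> (\<Sum>i\<in>Basis. \<Sum>j\<in>Basis. \<bar>(u \<bullet> i) * (u \<bullet> j) * (G c z i j - B i j)\<bar>)"
      by (intro order_trans[OF sum_abs] sum_mono sum_abs)
    also have "\<dots> \<le> (\<Sum>i\<in>(Basis::'e set). \<Sum>j\<in>(Basis::'e set). norm u * norm u * \<eta>)"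
    proof (intro sum_mono)
      fix i j :: 'e assume ij: "i \<in> Basis" "j \<in> Basis"
      then have "\<bar>G c z i j - B i j\<bar> \<le> \<eta>" using r1(2)[of z i j] z unfolding r_def by auto
      then show "\<bar>(u \<bullet> i) * (u \<bullet> j) * (G c z i j - B i j)\<bar> \<le> norm u * norm u * \<eta>"
        unfolding abs_mult using ij by (intro mult_mono Basis_le_norm) auto
    qed
    also have "\<dots> = \<delta> * (m * norm u)\<^sup>2"
      by (simp add: \<eta>_def power2_eq_square)
    also have "\<dots> \<le> \<delta> * (form_norm B u)\<^sup>2"
      using \<delta>(1) m by (intro mult_left_mono power_mono) auto
    finally show "\<bar>G c z u u - B u u\<bar> \<le> \<delta> * B u u" by (simp add: form_norm_square[OF B])
  qed
  show ?thesis
  proof (rule that[OF r])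
    fix z u assume z: "z \<in> ball ?x r"
    have n: "B u u \<ge> 0" "G c z u u \<ge> 0" using form_nonneg B form[OF z] by auto
    have "G c z u u \<le> (1 + \<delta>) * B u u" using est[OF z, of u] by (simp add: algebra_simps)
    also have "\<dots> \<le> K\<^sup>2 * B u u" using \<delta>(2) n by (intro mult_right_mono)
    finally have "form_norm (G c z) u \<le> sqrt (K\<^sup>2 * B u u)" unfolding form_norm_def by simp
    then show "form_norm (G c z) u \<le> K * form_norm (G c ?x) u"
      using K by (simp add: real_sqrt_mult form_norm_def B_def)
    have "(1 - \<delta>) * B u u \<le> G c z u u" using est[OF z, of u] by (simp add: algebra_simps)
    then have "B u u \<le> K\<^sup>2 * G c z u u" using K by (simp add: \<delta>_def field_simps)
    then have "form_norm B u \<le> sqrt (K\<^sup>2 * G c z u u)" unfolding form_norm_def by simp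
    then show "form_norm (G c ?x) u \<le> K * form_norm (G c z) u"
      using K by (simp add: real_sqrt_mult form_norm_def B_def)
  qed
qed

lemma locally_joined:
  assumes "r > 0"
  obtains U where "open U" "p \<in> U" "\<And>q. q \<in> U \<Longrightarrow> \<exists>l<r. joined p q l"
proof -
  obtain c where c: "c \<in> \<A>" "p \<in> chart_dom c" using chart_cover .
  let ?x = "chart_map c p"
  obtain r0 where r0: "r0 > 0" "ball ?x r0 \<subseteq> chart_map c ` (chart_dom c \<inter> UNIV)"
    "\<And>z u. z \<in> ball ?x r0 \<Longrightarrow> form_norm (G c z) u \<le> 2 * form_norm (G c ?x) u"
    by (rule nearly_constant_metric[OF c _ open_UNIV UNIV_I, where K = 2]) (simp, blast)
  have B: "inner_form (G c ?x)" using G_form c by auto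
  obtain M where M: "M > 0" "\<And>u. form_norm (G c ?x) u \<le> M * norm u" using form_norm_equiv[OF B] by metis
  define r1 where "r1 = min r0 (r / (2 * M))"
  have r1: "r1 > 0" "r1 \<le> r0" "r1 \<le> r / (2 * M)" using assms r0 M by (auto simp: r1_def)
  let ?U = "chart_dom c \<inter> chart_map c -` ball ?x r1"
  show ?thesis
  proof (rule that)
    show "open ?U" by (rule open_chart_preimage[OF c(1) open_ball])
    show "p \<in> ?U" using c r1 by auto
    fix q assume q: "q \<in> ?U"
    obtain l where l: "l \<le> 2 * form_norm (G c ?x) (chart_map c q - ?x)" "joined (chart_inv c ?x) (chart_inv c (chart_map c q)) l"
      using joined_segment[OF c(1) convex_ball[of ?x r0] _ _ _ B r0(3), of ?x "chart_map c q"] q r0 r1(2) by fastforce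
    have "l \<le> 2 * (M * norm (chart_map c q - ?x))" using l(1) M(2)[of "chart_map c q - ?x"] by linarith
    also have "\<dots> < 2 * (M * r1)" using q M(1) by (simp add: dist_norm norm_minus_commute)
    also have "\<dots> \<le> r" using r1(3) M(1) by (simp add: field_simps)
    finally show "\<exists>l<r. joined p q l" using l(2) chart_inv_map[OF c(1)] c q by auto
  qed
qed

text \<open>Being joined is an equivalence relation with open classes by
  \<open>locally_joined\<close>, and the manifold is connected. The infimum in the distance thus
  runs over a nonempty set.\<close>

lemma ex_joined: "\<exists>l. joined x y l"
proof -
  let ?S = "{y. \<exists>l. joined x y l}"
  have "open ?S"
    unfolding open_subopen[of ?S]
  proof
    fix y assume "y \<in> ?S"
    then obtain l where l: "joined x y l" by blast
    obtain U where U: "open U" "y \<in> U" "\<And>q. q \<in> U \<Longrightarrow> \<exists>l<1. joined y q l"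
      using locally_joined[OF zero_less_one, of y] by metis
    have "U \<subseteq> ?S"
    proof
      fix q assume "q \<in> U"
      then obtain l' where "joined y q l'" using U(3) by blast
      from joined_trans[OF l this] show "q \<in> ?S" by blast
    qed
    then show "\<exists>T. open T \<and> y \<in> T \<and> T \<subseteq> ?S" using U(1,2) by blast
  qed
  moreover have "open (- ?S)"
    unfolding open_subopen[of "- ?S"]
  proof
    fix y assume y: "y \<in> - ?S"
    obtain U where U: "open U" "y \<in> U" "\<And>q. q \<in> U \<Longrightarrow> \<exists>l<1. joined y q l"
      using locally_joined[OF zero_less_one, of y] by metis
    have "U \<subseteq> - ?S"
    proof
      fix q assume "q \<in> U"
      then obtain l' where l': "joined y q l'" using U(3) by blast
      show "q \<in> - ?S"
      proof
        assume "q \<in> ?S"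
        then obtain l where "joined x q l" by blast
        from joined_trans[OF this joined_sym[OF l']] show False using y by blast
      qed
    qed
    then show "\<exists>T. open T \<and> y \<in> T \<and> T \<subseteq> - ?S" using U(1,2) by blast
  qed
  ultimately have "?S = {} \<or> - ?S = {}"
    using connectedD[OF connected, of ?S "- ?S"] by auto
  then show ?thesis using joined_refl[of x] by blast
qed

section \<open>The distance as a metric that induces the topology\<close>

lemma d_le: "joined x y l \<Longrightarrow> d x y \<le> l"
  unfolding d_Inf by (rule cInf_lower) (auto intro!: bdd_belowI[of _ 0] dest: joined_nonneg)

lemma d_less: "d x y < r \<Longrightarrow> \<exists>l<r. joined x y l"
  unfolding d_Inf using cInf_lessD[of "{l. joined x y l}" r] ex_joined[of x y] by auto

lemma d_nonneg: "d x y \<ge> 0"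
  unfolding d_Inf by (rule cInf_greatest) (use ex_joined joined_nonneg in auto)

lemma d_refl: "d x x = 0"
  using d_le[OF joined_refl] d_nonneg by (meson antisym)

lemma d_sym: "d x y = d y x"
  unfolding d_Inf by (rule arg_cong[where f = Inf]) (use joined_sym in blast)

lemma d_triangle: "d x z \<le> d x y + d y z"
proof (rule field_le_epsilon)
  fix e :: real assume "e > 0"
  then obtain l l' where "l < d x y + e / 2" "joined x y l" "l' < d y z + e / 2" "joined y z l'"
    using d_less[of x y "d x y + e / 2"] d_less[of y z "d y z + e / 2"] by auto
  then show "d x z \<le> d x y + d y z + e" using d_le[OF joined_trans] by fastforce
qed

lemma d_curve: 
  assumes "pw a b \<gamma>" "a \<le> s" "s \<le> t" "t \<le> b"
  shows "d (\<gamma> s) (\<gamma> t) \<le> integral {s..t} (sp \<gamma>)"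
proof -
  have "pw s t \<gamma>" using pw_split[OF assms(1), of s] pw_split[of s b \<gamma> t] assms by auto
  then show ?thesis using d_le unfolding joined_def by blast
qed

lemma d_less_curve:
  assumes "d x y < r"
  obtains a b \<gamma> where "pw a b \<gamma>" "\<gamma> a = x" "\<gamma> b = y" "integral {a..b} (sp \<gamma>) < r"
  using d_less[OF assms] unfolding joined_def by blast

lemma d_ball_nhd:
  assumes "r > 0" obtains U where "open U" "p \<in> U" "\<And>q. q \<in> U \<Longrightarrow> d p q < r"
proof -
  obtain U where "open U" "p \<in> U" "\<And>q. q \<in> U \<Longrightarrow> \<exists>l<r. joined p q l" using locally_joined[OF assms, of p] by blast
  then show ?thesis using that[of U] d_le by fastforce
qed

text \<open>A curve that leaves a coordinate ball has to cross the ball, and by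
  the comparison with the constant metric at the centre this has a cost.\<close>

lemma open_contains_d_ball:
  assumes U: "open U" "p \<in> U"
  obtains r where "r > 0" "\<And>y. d p y < r \<Longrightarrow> y \<in> U"
proof -
  obtain c where c: "c \<in> \<A>" "p \<in> chart_dom c" using chart_cover .
  let ?x = "chart_map c p"
  obtain r0 where r0: "r0 > 0" "ball ?x r0 \<subseteq> chart_map c ` (chart_dom c \<inter> U)"
    "\<And>z u. z \<in> ball ?x r0 \<Longrightarrow> form_norm (G c ?x) u \<le> 2 * form_norm (G c z) u"
    by (rule nearly_constant_metric[OF c _ U, where K = 2]) (simp, blast)
  have B: "inner_form (G c ?x)" using G_form c by auto
  obtain m where m: "m > 0" "\<And>u. m * norm u \<le> form_norm (G c ?x) u" using form_norm_equiv[OF B] by metis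
  define R where "R = r0 / 2"
  have R: "R > 0" "cball ?x R \<subseteq> ball ?x r0" using r0(1) by (auto simp: R_def)
  let ?W = "chart_dom c \<inter> chart_map c -` ball ?x R"
  let ?C = "chart_inv c ` cball ?x R"
  have dom: "ball ?x r0 \<subseteq> chart_map c ` chart_dom c" using r0(2) by blast
  have W: "open ?W" by (rule open_chart_preimage[OF c(1) open_ball])
  \<comment> \<open>Compact, hence closed since the manifold is Hausdorff: at its first exit time
    from \<open>?W\<close> the curve is still in \<open>?C\<close>.\<close>
  have C: "closed ?C"
    by (intro compact_imp_closed compact_continuous_image continuous_on_subset[OF continuous_chart_inv[OF c(1)]] compact_cball)
       (use R dom in auto)
  have WC: "?W \<subseteq> ?C"
  proof
    fix q assume q: "q \<in> ?W"
    then have "q = chart_inv c (chart_map c q)" using chart_inv_map[OF c(1)] by simp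
    then show "q \<in> ?C" using q by (intro image_eqI[of _ _ "chart_map c q"]) auto
  qed
  have CU: "?C \<subseteq> U"
  proof
    fix q assume "q \<in> ?C"
    then obtain z where z: "z \<in> ball ?x r0" "q = chart_inv c z" using R(2) by blast
    then obtain q' where "q' \<in> chart_dom c \<inter> U" "z = chart_map c q'" using r0(2) by blast
    then show "q \<in> U" using z chart_inv_map[OF c(1)] by auto
  qed
  show ?thesis
  proof (rule that[of "m * R / 2"])
    show "m * R / 2 > 0" using m R by simp
    fix y assume "d p y < m * R / 2"
    then obtain a b \<gamma> where \<gamma>: "pw a b \<gamma>" "\<gamma> a = p" "\<gamma> b = y" "integral {a..b} (sp \<gamma>) < m * R / 2"
      by (rule d_less_curve)
    show "y \<in> U"
    proof (rule ccontr)
      assume y: "y \<notin> U"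
      have cont: "continuous_on {a..b} \<gamma>" using pw_nice(1)[OF \<gamma>(1)] .
      let ?S = "{a..b} \<inter> \<gamma> -` (- ?W)"
      have "closed ?S" by (rule continuous_closed_preimage[OF cont closed_atLeastAtMost closed_Compl[OF W]])
      then have "compact ({a..b} \<inter> ?S)" by (rule compact_Int_closed[OF compact_Icc])
      moreover have "{a..b} \<inter> ?S = ?S" by blast
      ultimately have "compact ?S" by simp
      moreover have "\<gamma> b \<notin> ?W" using \<gamma>(3) y subsetD[OF WC] subsetD[OF CU] by blast
      then have "b \<in> ?S" using pw_le[OF \<gamma>(1)] by simp
      \<comment> \<open>The first time outside the coordinate ball. Up to it the chart comparison
        applies, and at it the coordinate distance from the centre is at least
        \<open>R\<close>.\<close>
      ultimately obtain \<tau> where \<tau>: "\<tau> \<in> ?S" "\<And>t. t \<in> ?S \<Longrightarrow> \<tau> \<le> t"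
        using compact_attains_inf[of ?S] by blast
      have "\<gamma> a \<in> ?W" using \<gamma>(2) c R by simp
      then have a\<tau>: "a < \<tau>" using \<tau>(1) by (cases "a = \<tau>") auto
      have before: "\<gamma> t \<in> ?W" if "t \<in> {a..<\<tau>}" for t using \<tau>(2)[of t] that \<tau>(1) by fastforce
      have "\<gamma> ` closure {a..<\<tau>} \<subseteq> ?C"
        by (rule image_closure_subset[OF _ C]) 
           (use before WC a\<tau> \<tau>(1) continuous_on_subset[OF cont, of "{a..\<tau>}"] in auto)
      then have "\<gamma> \<tau> \<in> ?C" using a\<tau> by auto
      then obtain z where z: "z \<in> cball ?x R" "\<gamma> \<tau> = chart_inv c z" by blast
      have zr: "z \<in> chart_map c ` chart_dom c" using z(1) R(2) dom by blast
      have z\<tau>: "chart_map c (\<gamma> \<tau>) = z" "\<gamma> \<tau> \<in> chart_dom c"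
        using z(2) chart_map_inv[OF c(1) zr] chart_inv_dom[OF c(1) zr] by auto
      have "norm (z - ?x) \<ge> R" using \<tau>(1) z\<tau> by (auto simp: dist_norm norm_minus_commute)
      then have "m * R \<le> form_norm (G c ?x) (z - ?x)" 
        using order_trans[OF mult_left_mono[of R "norm (z - ?x)" m] m(2)[of "z - ?x"]] m(1) by simp
      also have "\<dots> = form_norm (G c ?x) (chart_map c (\<gamma> \<tau>) - chart_map c (\<gamma> a))" using \<gamma>(2) z\<tau> by simp
      also have "\<dots> \<le> 2 * integral {a..\<tau>} (sp \<gamma>)"
      proof (rule curve_lower_bound[OF c(1) _ _ B r0(3)])
        show "pw a \<tau> \<gamma>" using pw_split[OF \<gamma>(1)] \<tau>(1) by auto
        show "\<gamma> t \<in> chart_dom c \<and> chart_map c (\<gamma> t) \<in> ball ?x r0" if "t \<in> {a..\<tau>}" for t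
          using before[of t] z z\<tau> that r0(1) by (cases "t = \<tau>") (auto simp: R_def)
      qed auto
      also have "integral {a..\<tau>} (sp \<gamma>) \<le> integral {a..b} (sp \<gamma>)"
        using pw_integral_combine[OF \<gamma>(1), of \<tau>] pw_integral_nonneg[of \<tau> b \<gamma>] pw_split[OF \<gamma>(1), of \<tau>] \<tau>(1) by auto
      finally show False using \<gamma>(4) by simp
    qed
  qed
qed

lemma d_eq_0: "d x y = 0 \<longleftrightarrow> x = y"
proof
  assume d0: "d x y = 0"
  show "x = y"
  proof (rule ccontr)
    assume "x \<noteq> y"
    then obtain U where "open U" "x \<in> U" "y \<notin> U" using t2_space_class.hausdorff[of x y] by blast
    then show False using open_contains_d_ball[of U x] d0 by metis
  qed
qed (simp add: d_refl)

lemma open_iff_d: "open U \<longleftrightarrow> (\<forall>x\<in>U. \<exists>r>0. \<forall>y. d x y < r \<longrightarrow> y \<in> U)"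
proof
  assume "\<forall>x\<in>U. \<exists>r>0. \<forall>y. d x y < r \<longrightarrow> y \<in> U"
  then show "open U" unfolding open_subopen[of U] by (metis d_ball_nhd subsetI)
qed (metis open_contains_d_ball)

text \<open>The point is taken at arc length \<open>s\<close> on an almost shortest curve. It is the
  substitute for a point on a minimal geodesic, which need not exist.\<close>

lemma d_split:
  assumes "0 \<le> s" "s \<le> d x y" "d x y < r"
  shows "\<exists>z. d x z \<le> s \<and> d z y < r - s"
proof -
  obtain a b \<gamma> where \<gamma>: "pw a b \<gamma>" "\<gamma> a = x" "\<gamma> b = y" "integral {a..b} (sp \<gamma>) < r"
    using d_less_curve[OF assms(3)] .
  have "s \<le> integral {a..b} (sp \<gamma>)"
    using assms(2) d_curve[OF \<gamma>(1), of a b] pw_le[OF \<gamma>(1)] \<gamma> by simp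
  moreover have "continuous_on {a..b} (\<lambda>t. integral {a..t} (sp \<gamma>))"
    by (rule indefinite_integral_continuous_1[OF pw_nice(2)[OF \<gamma>(1)]])
  ultimately obtain t where t: "a \<le> t" "t \<le> b" "integral {a..t} (sp \<gamma>) = s"
    using IVT'[of "\<lambda>t. integral {a..t} (sp \<gamma>)" a s b] pw_le[OF \<gamma>(1)] assms(1) by auto
  then show ?thesis
    using d_curve[OF \<gamma>(1), of a t] d_curve[OF \<gamma>(1), of t b] pw_integral_combine[OF \<gamma>(1) t(1,2)] \<gamma>
    by (intro exI[of _ "\<gamma> t"]) auto
qed

lemma metric_space: "Metric_space UNIV d"
  by unfold_locales (auto simp: d_nonneg d_eq_0 d_triangle intro: d_sym)

lemma complete_metric_iff:
  "complete_metric \<A> g \<longleftrightarrow>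
     (\<forall>\<sigma> :: nat \<Rightarrow> 'a. (\<forall>\<epsilon>>0. \<exists>N. \<forall>m\<ge>N. \<forall>n\<ge>N. d (\<sigma> m) (\<sigma> n) < \<epsilon>) \<longrightarrow> (\<exists>x. \<forall>\<epsilon>>0. \<exists>N. \<forall>n\<ge>N. d (\<sigma> n) x < \<epsilon>))"
  unfolding complete_metric_def Metric_space.mcomplete_def[OF metric_space] Metric_space.MCauchy_def[OF metric_space]
    Metric_space.limit_metric_sequentially[OF metric_space]
  by simp

end

section \<open>Length metrics, escaping chains and the Hopf--Rinow theorem\<close>

text \<open>What the Hopf-Rinow argument uses of a manifold: a locally compact metric with almost
  intermediate points (\<open>split\<close>). No curve appears any more.\<close>

locale length_metric =
  fixes d :: "'a::{t2_space,second_countable_topology} \<Rightarrow> 'a \<Rightarrow> real"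
  assumes nonneg: "d x y \<ge> 0" and eq_0: "d x y = 0 \<longleftrightarrow> x = y" and sym: "d x y = d y x"
    and triangle: "d x z \<le> d x y + d y z"
    and open_iff: "open U \<longleftrightarrow> (\<forall>x\<in>U. \<exists>r>0. \<forall>y. d x y < r \<longrightarrow> y \<in> U)"
    and split: "0 \<le> s \<Longrightarrow> s \<le> d x y \<Longrightarrow> d x y < r \<Longrightarrow> \<exists>z. d x z \<le> s \<and> d z y < r - s"
    and locally_compact: "\<exists>r>0. compact {y. d x y \<le> r}"
begin

definition cb :: "'a \<Rightarrow> real \<Rightarrow> 'a set" where "cb p r = {y. d p y \<le> r}"

lemma in_cb: "y \<in> cb p r \<longleftrightarrow> d p y \<le> r" by (simp add: cb_def)

lemma d_same: "d x x = 0" using eq_0 by simp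

lemma open_d_ball: "open {y. d p y < r}"
  unfolding open_iff
proof
  fix x assume "x \<in> {y. d p y < r}"
  then show "\<exists>e>0. \<forall>y. d x y < e \<longrightarrow> y \<in> {y. d p y < r}"
    using triangle[of p _ x] by (intro exI[of _ "r - d p x"]) (smt (verit) mem_Collect_eq)
qed

lemma closed_cb: "closed (cb p r)"
  unfolding closed_def open_iff
proof
  fix x assume "x \<in> - cb p r"
  then show "\<exists>e>0. \<forall>y. d x y < e \<longrightarrow> y \<in> - cb p r"
    using triangle[of p x] sym by (intro exI[of _ "d p x - r"]) (smt (verit) ComplD ComplI in_cb)
qed

lemma compact_cb_subset: "compact (cb p r) \<Longrightarrow> d p q + s \<le> r \<Longrightarrow> compact (cb q s)"
proof -
  assume c: "compact (cb p r)" and s: "d p q + s \<le> r"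
  have "cb q s \<subseteq> cb p r" using triangle[of p _ q] s by (auto simp: in_cb) (smt (verit))
  then have "cb q s = cb p r \<inter> cb q s" by blast
  then show ?thesis using compact_Int_closed[OF c closed_cb[of q s]] by simp
qed

lemma lipschitz_continuous:
  assumes "\<And>x y. f x \<le> f y + d x y"
  shows "continuous_on S (f :: 'a \<Rightarrow> real)"
proof (rule continuous_at_imp_continuous_on, rule ballI)
  fix x
  have "eventually (\<lambda>y. \<bar>f y - f x\<bar> < e) (at x)" if "e > 0" for e
  proof -
    have "eventually (\<lambda>y. y \<in> {y. d x y < e}) (at x)"
      by (rule eventually_at_in_open'[OF open_d_ball]) (use that d_same in auto)
    then show ?thesis
    proof eventually_elim
      case (elim y)
      then show ?case using assms[of x y] assms[of y x] sym[of x y] by auto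
    qed
  qed
  then show "isCont f x" unfolding isCont_def tendsto_iff dist_real_def by blast
qed

end

section \<open>The escape radius and chains along which it decreases\<close>

locale improper_length_metric = length_metric +
  assumes improper: "\<exists>p r. \<not> compact (cb p r)"
begin

definition \<rho> :: "'a \<Rightarrow> real" where "\<rho> p = Sup {r. compact (cb p r)}"

text \<open>A larger compact ball around \<open>p\<close> would contain the non-compact ball around
  \<open>p0\<close> as a closed subset.\<close>

lemma compact_cb_bdd: "bdd_above {r. compact (cb p r)}"
proof -
  obtain p0 r0 where "\<not> compact (cb p0 r0)" using improper by blast
  then have "r \<le> d p p0 + r0" if "compact (cb p r)" for r
    using compact_cb_subset[OF that, of p0 r0] by linarith
  then show ?thesis by (auto intro!: bdd_aboveI)
qed

lemma le_\<rho>: "compact (cb p r) \<Longrightarrow> r \<le> \<rho> p"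
  unfolding \<rho>_def by (rule cSup_upper[OF _ compact_cb_bdd]) simp

lemma \<rho>_pos: "\<rho> p > 0"
  using locally_compact[of p] le_\<rho> unfolding cb_def by force

lemma less_\<rho>: "r < \<rho> p \<Longrightarrow> compact (cb p r)"
proof -
  assume "r < \<rho> p"
  moreover have "{r. compact (cb p r)} \<noteq> {}" using locally_compact[of p] unfolding cb_def by blast
  ultimately obtain r' where "compact (cb p r')" "r < r'"
    unfolding \<rho>_def using less_cSup_iff[OF _ compact_cb_bdd, of p r] by blast
  then show ?thesis using compact_cb_subset[of p r' p r] d_same by simp
qed

lemma \<rho>_lipschitz: "\<rho> p \<le> \<rho> q + d p q"
proof (rule dense_le)
  fix r assume "r < \<rho> p"
  then have "compact (cb q (r - d p q))" using compact_cb_subset[OF less_\<rho>, of r p q] by simp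
  then show "r \<le> \<rho> q + d p q" using le_\<rho> by fastforce
qed

text \<open>Otherwise finitely many compact balls centred in the ball of radius \<open>s\<close> would cover
  a ball around \<open>p\<close> that is larger than the escape radius.\<close>

lemma escape_step:
  assumes s: "0 \<le> s" "s < \<rho> p"
  shows "\<exists>q. d p q = s \<and> \<rho> q = \<rho> p - s"
proof -
  have "\<exists>q\<in>cb p s. \<rho> q \<le> \<rho> p - s"
  proof (rule ccontr)
    assume "\<not> ?thesis"
    then have far: "\<rho> q > \<rho> p - s" if "q \<in> cb p s" for q using that by force
    have cpt: "compact (cb p s)" by (rule less_\<rho>[OF s(2)])
    have "p \<in> cb p s" using s(1) d_same by (simp add: in_cb)
    then have ne: "cb p s \<noteq> {}" by blast
    obtain q0 where q0: "q0 \<in> cb p s" "\<And>q. q \<in> cb p s \<Longrightarrow> \<rho> q0 \<le> \<rho> q"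
      using continuous_attains_inf[OF cpt ne lipschitz_continuous[of \<rho>]] \<rho>_lipschitz by blast
    \<comment> \<open>The minimum over the compact ball is attained, so the excess over
      \<open>\<rho> p - s\<close> is uniformly positive.\<close>
    define \<eta> where "\<eta> = \<rho> q0 - (\<rho> p - s)"
    have \<eta>: "\<eta> > 0" using far[OF q0(1)] by (simp add: \<eta>_def)
    have "cb p s \<subseteq> (\<Union>q\<in>cb p s. {y. d q y < \<eta> / 8})" using \<eta> d_same by auto
    then obtain Q where Q: "Q \<subseteq> cb p s" "finite Q" "cb p s \<subseteq> (\<Union>q\<in>Q. {y. d q y < \<eta> / 8})"
      using compactE_image[OF cpt, of "cb p s" "\<lambda>q. {y. d q y < \<eta> / 8}"] open_d_ball by metis
    \<comment> \<open>Splitting costs 3/4 of \<eta> and the cover another 1/8; with 7/8 the radius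
      is still below the escape radius of every centre.\<close>
    let ?R = "\<rho> p - s + 7 * \<eta> / 8"
    have "compact (cb q ?R)" if "q \<in> Q" for q
      by (rule less_\<rho>) (use q0(2)[of q] that Q(1) \<eta> in \<open>auto simp: \<eta>_def field_simps\<close>)
    then have cU: "compact ((\<Union>q\<in>Q. cb q ?R))" using Q(2) by (intro compact_UN) auto
    have "cb p (\<rho> p + \<eta> / 2) \<subseteq> (\<Union>q\<in>Q. cb q ?R)"
    proof
      fix y assume y: "y \<in> cb p (\<rho> p + \<eta> / 2)"
      have "\<exists>z. d p z \<le> s \<and> d z y < \<rho> p - s + 3 * \<eta> / 4"
      proof (cases "d p y \<le> s")
        case True
        then show ?thesis using s \<eta> d_same by (intro exI[of _ y]) auto
      next
        case False
        moreover have "d p y < \<rho> p + 3 * \<eta> / 4" using y \<eta> by (simp add: in_cb)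
        ultimately show ?thesis using split[of s p y "\<rho> p + 3 * \<eta> / 4"] s(1) by (auto simp: algebra_simps)
      qed
      then obtain z where z: "z \<in> cb p s" "d z y < \<rho> p - s + 3 * \<eta> / 4" by (auto simp: in_cb)
      then obtain q where q: "q \<in> Q" "d q z < \<eta> / 8" using Q(3) by blast
      have "d q y \<le> ?R" using triangle[of q y z] z(2) q(2) by linarith
      then show "y \<in> (\<Union>q\<in>Q. cb q ?R)" using q(1) in_cb by blast
    qed
    then have "cb p (\<rho> p + \<eta> / 2) = (\<Union>q\<in>Q. cb q ?R) \<inter> cb p (\<rho> p + \<eta> / 2)" by blast
    then have "compact (cb p (\<rho> p + \<eta> / 2))" using compact_Int_closed[OF cU closed_cb] by metis
    then show False using le_\<rho> \<eta> by fastforce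
  qed
  then obtain q where "d p q \<le> s" "\<rho> q \<le> \<rho> p - s" by (auto simp: in_cb)
  \<comment> \<open>\<open>\<rho>\<close> is Lipschitz with constant 1, so both inequalities are
    equalities.\<close>
  then show ?thesis using \<rho>_lipschitz[of p q] by (intro exI[of _ q]) auto
qed

text \<open>Steps proportional to a positive Lipschitz function cannot accumulate, because the function
  would vanish at a limit point; and since every step decreases the escape radius by exactly its
  length, the chain is geodesic.\<close>

theorem escaping_chain:
  assumes Q_shift: "\<And>p q r r'. Q p r \<Longrightarrow> d p q + r' \<le> r \<Longrightarrow> Q q r'" and Q_pos: "\<And>p. \<exists>r>0. Q p r"
  obtains P r where "\<And>n::nat. r n > 0" "\<And>n. Q (P n) (r n)"
    "\<And>n. d (P n) (P (Suc n)) = r n / 8"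
    "\<And>n. d (P n) (P (Suc (Suc n))) = r n / 8 + r (Suc n) / 8"
    "\<And>n. \<bar>r (Suc n) - r n\<bar> \<le> r n / 16"
    "summable r" "\<And>C. compact C \<Longrightarrow> \<exists>N. \<forall>n\<ge>N. P n \<notin> C"
    "\<And>e. e > 0 \<Longrightarrow> \<exists>N. \<forall>m\<ge>N. \<forall>n\<ge>N. d (P m) (P n) < e"
proof -
  \<comment> \<open>Compactness is built in so that h \<le> \<rho>, and steps of length
    \<open>h p / 16\<close> are admissible in \<open>escape_step\<close>.\<close>
  define S where "S p = {r. Q p r \<and> compact (cb p r)}" for p
  define h where "h p = Sup (S p)" for p
  have bdd: "bdd_above (S p)" for p
    by (rule bdd_above_mono[OF compact_cb_bdd]) (auto simp: S_def)
  have pos: "\<exists>r>0. r \<in> S p" for p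
  proof -
    obtain a where a: "a > 0" "Q p a" using Q_pos by blast
    obtain b where b: "b > 0" "compact (cb p b)" using locally_compact[of p] unfolding cb_def by blast
    have "min a b \<in> S p"
      using Q_shift[OF a(2), of p "min a b"] compact_cb_subset[OF b(2), of p "min a b"] d_same
      by (simp add: S_def)
    then show ?thesis using a b by (intro exI[of _ "min a b"]) auto
  qed
  have ne: "S p \<noteq> {}" for p using pos by blast
  have shift: "r' \<in> S q" if "r \<in> S p" "d p q + r' \<le> r" for p q r r'
    using that Q_shift compact_cb_subset unfolding S_def by blast
  have h_pos: "h p > 0" for p
  proof -
    obtain a where "a > 0" "a \<in> S p" using pos by blast
    then show ?thesis unfolding h_def using cSup_upper[OF _ bdd, of a p] by linarith
  qed
  have h_le: "h p \<le> \<rho> p" for p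
    unfolding h_def by (rule cSup_least[OF ne]) (simp add: S_def le_\<rho>)
  have less_h: "r \<in> S p" if lt: "r < h p" for p r
  proof -
    obtain r' where "r' \<in> S p" "r < r'"
      using lt less_cSup_iff[OF ne bdd, of r p] unfolding h_def by blast
    then show ?thesis using shift[of r' p p r] d_same by simp
  qed
  have h_lip: "h p \<le> h q + d p q" for p q
  proof (rule dense_le)
    fix r assume "r < h p"
    then have "r - d p q \<in> S q" using shift[OF less_h, of r p q "r - d p q"] by simp
    then show "r \<le> h q + d p q" unfolding h_def using cSup_upper[OF _ bdd] by fastforce
  qed
  \<comment> \<open>The radius \<open>r n\<close> below is half of \<open>h\<close>, strictly under
    the supremum, so that \<open>Q\<close> holds for it. The step is then \<open>r n / 8\<close>,
    and the Lipschitz bound of \<open>h\<close> lets \<open>r\<close> change by at most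
    \<open>r n / 16\<close>.\<close>
  have "\<exists>q. d p q = h p / 16 \<and> \<rho> q = \<rho> p - h p / 16" for p
    by (rule escape_step) (use h_pos[of p] h_le[of p] in linarith)+
  then obtain nxt where nxt: "\<And>p. d p (nxt p) = h p / 16" "\<And>p. \<rho> (nxt p) = \<rho> p - h p / 16" by metis
  define P where "P n = (nxt ^^ n) undefined" for n
  define r where "r n = h (P n) / 2" for n
  have P_Suc: "P (Suc n) = nxt (P n)" for n by (simp add: P_def)
  have step: "d (P n) (P (Suc n)) = r n / 8" "\<rho> (P (Suc n)) = \<rho> (P n) - r n / 8" for n
    by (simp_all add: P_Suc nxt r_def)
  \<comment> \<open>The upper bound sums the steps, the lower bound is the Lipschitz property of
    \<open>\<rho>\<close>: the chain is geodesic between any two of its points.\<close>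
  have dist: "d (P m) (P (m + k)) = \<rho> (P m) - \<rho> (P (m + k))" for m k
  proof (rule antisym)
    show "d (P m) (P (m + k)) \<le> \<rho> (P m) - \<rho> (P (m + k))"
    proof (induction k)
      case (Suc k)
      then show ?case using triangle[of "P m" "P (m + Suc k)" "P (m + k)"] step[of "m + k"] by simp
    qed (simp add: d_same)
    show "\<rho> (P m) - \<rho> (P (m + k)) \<le> d (P m) (P (m + k))" using \<rho>_lipschitz[of "P m" "P (m + k)"] by simp
  qed
  have r_pos: "r n > 0" for n by (simp add: r_def h_pos)
  have sm: "summable r"
  proof (rule summableI_nonneg_bounded)
    fix n
    \<comment> \<open>Telescoping: \<open>r i\<close> is eight times the loss of escape radius in
      one step, and the escape radius stays positive.\<close>
    have "(\<Sum>i<n. r i) = 8 * (\<rho> (P 0) - \<rho> (P n))" by (induction n) (simp_all add: step)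
    then show "(\<Sum>i<n. r i) \<le> 8 * \<rho> (P 0)" using \<rho>_pos[of "P n"] by simp
  qed (simp add: r_pos less_imp_le)
  show ?thesis
  proof (rule that[of r P])
    show "Q (P n) (r n)" for n
      using less_h[of "r n" "P n"] h_pos[of "P n"] by (auto simp: S_def r_def)
    show "d (P n) (P (Suc n)) = r n / 8" for n by (rule step(1))
    show "d (P n) (P (Suc (Suc n))) = r n / 8 + r (Suc n) / 8" for n
      using dist[of n 2] step(2)[of n] step(2)[of "Suc n"] by simp
    show "\<bar>r (Suc n) - r n\<bar> \<le> r n / 16" for n
      using h_lip[of "P n" "P (Suc n)"] h_lip[of "P (Suc n)" "P n"] step(1)[of n, unfolded r_def] sym[of "P n" "P (Suc n)"]
      unfolding r_def by linarith
    show "\<exists>N. \<forall>n\<ge>N. P n \<notin> C" if C: "compact C" for C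
    proof (cases "C = {}")
      case False
      \<comment> \<open>On a compact set the positive function \<open>h\<close> has a positive
        minimum, while \<open>r n\<close> tends to 0.\<close>
      obtain x where x: "x \<in> C" "\<And>y. y \<in> C \<Longrightarrow> h x \<le> h y"
        using continuous_attains_inf[OF C False lipschitz_continuous[of h]] h_lip by blast
      have "eventually (\<lambda>n. r n < h x / 2) sequentially"
        using summable_LIMSEQ_zero[OF sm] h_pos[of x] by (intro order_tendstoD) auto
      then obtain N where N: "\<And>n. n \<ge> N \<Longrightarrow> r n < h x / 2" unfolding eventually_sequentially by blast
      have "P n \<notin> C" if "n \<ge> N" for n using N[OF that] x(2)[of "P n"] unfolding r_def by force
      then show ?thesis by blast
    qed simp
    show "\<exists>N. \<forall>m\<ge>N. \<forall>n\<ge>N. d (P m) (P n) < e" if e: "e > 0" for e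
    proof -
      have "decseq (\<lambda>n. \<rho> (P n))" using step(2) r_pos by (intro decseq_SucI) (simp add: less_imp_le)
      then obtain L where "(\<lambda>n. \<rho> (P n)) \<longlonglongrightarrow> L"
        using decseq_convergent[of _ 0] \<rho>_pos by (metis less_imp_le)
      then have "Cauchy (\<lambda>n. \<rho> (P n))" by (rule LIMSEQ_imp_Cauchy)
      then obtain N where N: "\<And>m n. m \<ge> N \<Longrightarrow> n \<ge> N \<Longrightarrow> \<bar>\<rho> (P m) - \<rho> (P n)\<bar> < e"
        using e unfolding Cauchy_def dist_real_def by blast
      have le: "d (P m) (P n) \<le> \<bar>\<rho> (P m) - \<rho> (P n)\<bar>" if "m \<le> n" for m n
        using dist[of m "n - m"] that by simp
      have "d (P m) (P n) < e" if "m \<ge> N" "n \<ge> N" for m n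
      proof (cases "m \<le> n")
        case True
        then show ?thesis using le[OF True] N[OF that] by linarith
      next
        case False
        then show ?thesis using le[of n m] N[OF that(2,1)] sym[of "P m" "P n"] by auto
      qed
      then show ?thesis by blast
    qed
  qed (fact r_pos sm)+
qed

end

section \<open>Completeness and compactness of balls\<close>

context length_metric
begin

theorem Hopf_Rinow:
  assumes complete: "\<And>\<sigma> :: nat \<Rightarrow> 'a. \<forall>e>0. \<exists>N. \<forall>m\<ge>N. \<forall>n\<ge>N. d (\<sigma> m) (\<sigma> n) < e \<Longrightarrow>
    \<exists>x. \<forall>e>0. \<exists>N. \<forall>n\<ge>N. d (\<sigma> n) x < e"
  shows "compact (cb p r)"
proof (rule ccontr)
  assume "\<not> compact (cb p r)"
  then interpret improper_length_metric d by unfold_locales blast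
  obtain P :: "nat \<Rightarrow> 'a" where P: "\<And>C. compact C \<Longrightarrow> \<exists>N. \<forall>n\<ge>N. P n \<notin> C"
    "\<And>e. e > 0 \<Longrightarrow> \<exists>N. \<forall>m\<ge>N. \<forall>n\<ge>N. d (P m) (P n) < e"
    \<comment> \<open>Only the metric conclusions matter here, so \<open>Q\<close> imposes no
      condition.\<close>
    by (rule escaping_chain[of "\<lambda>_ _. True"]) (simp, meson zero_less_one, blast)
  obtain x where x: "\<forall>e>0. \<exists>N. \<forall>n\<ge>N. d (P n) x < e" using complete[of P] P(2) by blast
  obtain e where e: "e > 0" "compact (cb x e)" using locally_compact[of x] unfolding cb_def by blast
  obtain N1 where N1: "\<forall>n\<ge>N1. d (P n) x < e" using x e(1) by blast
  obtain N2 where "\<forall>n\<ge>N2. P n \<notin> cb x e" using P(1)[OF e(2)] by blast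
  then have "\<not> d (P (max N1 N2)) x \<le> e" by (simp add: in_cb sym)
  then show False using N1[rule_format, of "max N1 N2"] by simp
qed

lemma Cauchy_in_compact_converges:
  fixes \<sigma> :: "nat \<Rightarrow> 'a"
  assumes "compact C" "\<And>n. \<sigma> n \<in> C" and Cauchy: "\<And>e. e > 0 \<Longrightarrow> \<exists>N. \<forall>m\<ge>N. \<forall>n\<ge>N. d (\<sigma> m) (\<sigma> n) < e"
  shows "\<exists>x. \<forall>e>0. \<exists>N. \<forall>n\<ge>N. d (\<sigma> n) x < e"
proof -
  obtain x s where s: "strict_mono s" "(\<sigma> \<circ> s) \<longlonglongrightarrow> x"
    using compact_imp_seq_compact[OF assms(1)] assms(2) unfolding seq_compact_def by metis
  have "\<exists>N. \<forall>n\<ge>N. d (\<sigma> n) x < e" if e: "e > 0" for e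
  proof -
    obtain N where N: "\<forall>m\<ge>N. \<forall>n\<ge>N. d (\<sigma> m) (\<sigma> n) < e / 2" using Cauchy[of "e / 2"] e by auto
    have "eventually (\<lambda>n. (\<sigma> \<circ> s) n \<in> {y. d x y < e / 2}) sequentially"
      by (rule topological_tendstoD[OF s(2) open_d_ball]) (use e d_same in simp)
    then obtain N' where N': "\<forall>n\<ge>N'. d x (\<sigma> (s n)) < e / 2" unfolding eventually_sequentially by auto
    have "d (\<sigma> n) x < e" if n: "n \<ge> N" for n
    proof -
      let ?k = "max N N'"
      have "s ?k \<ge> N" using seq_suble[OF s(1), of ?k] by linarith
      then have "d (\<sigma> n) (\<sigma> (s ?k)) < e / 2" using N n by blast
      moreover have "d x (\<sigma> (s ?k)) < e / 2" using N' by simp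
      ultimately show ?thesis using triangle[of "\<sigma> n" x "\<sigma> (s ?k)"] sym[of x "\<sigma> (s ?k)"] by linarith
    qed
    then show ?thesis by blast
  qed
  then show ?thesis by blast
qed

end

context cont_metric
begin

text \<open>A small closed metric ball is a closed subset of the image of a compact coordinate
  ball.\<close>

lemma ex_compact_d_ball: "\<exists>r>0. compact {y. d x y \<le> r}"
proof -
  obtain c where c: "c \<in> \<A>" "x \<in> chart_dom c" using chart_cover .
  let ?x = "chart_map c x"
  obtain R where R: "R > 0" "cball ?x R \<subseteq> chart_map c ` chart_dom c"
    using open_contains_cball[THEN iffD1, OF open_range[OF c(1)]] c(2) by blast
  let ?C = "chart_inv c ` cball ?x R" and ?W = "chart_dom c \<inter> chart_map c -` ball ?x R"
  have C: "compact ?C"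
    by (intro compact_continuous_image continuous_on_subset[OF continuous_chart_inv[OF c(1)]] compact_cball R)
  obtain r where r: "r > 0" "\<And>y. d x y < r \<Longrightarrow> y \<in> ?W"
  proof (rule open_contains_d_ball[OF open_chart_preimage[OF c(1) open_ball[of ?x R]]])
    show "x \<in> ?W" using c R(1) by simp
  qed blast
  have "{y. d x y \<le> r / 2} \<subseteq> ?C"
  proof
    fix y assume "y \<in> {y. d x y \<le> r / 2}"
    then have "y \<in> ?W" using r by auto
    then show "y \<in> ?C" using chart_inv_map[OF c(1)] by (intro image_eqI[of _ _ "chart_map c y"]) auto
  qed
  moreover have "closed {y. d x y \<le> r / 2}"
    unfolding closed_def open_iff_d
  proof
    fix z assume "z \<in> - {y. d x y \<le> r / 2}"
    then show "\<exists>e>0. \<forall>y. d z y < e \<longrightarrow> y \<in> - {y. d x y \<le> r / 2}"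
    proof (intro exI[of _ "d x z - r / 2"] conjI allI impI)
      fix y assume "d z y < d x z - r / 2"
      then show "y \<in> - {y. d x y \<le> r / 2}" using d_triangle[of x z y] d_sym[of y z] by simp
    qed auto
  qed
  ultimately have "compact (?C \<inter> {y. d x y \<le> r / 2})" "?C \<inter> {y. d x y \<le> r / 2} = {y. d x y \<le> r / 2}"
    using compact_Int_closed[OF C] by auto
  then have "compact {y. d x y \<le> r / 2}" by simp
  then show ?thesis using r(1) by (intro exI[of _ "r / 2"]) auto
qed

sublocale length_metric d
  by unfold_locales (fact d_nonneg d_eq_0 d_sym d_triangle open_iff_d d_split ex_compact_d_ball)+

lemma complete_imp_compact_cb: "complete_metric \<A> g \<Longrightarrow> compact (cb p r)"
  unfolding complete_metric_iff by (rule Hopf_Rinow) blast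

end

section \<open>Chains of nearly Euclidean charts\<close>

lemma one_dimensional_multiple:
  fixes u v :: "'e::euclidean_space"
  assumes "DIM('e) = 1" "v \<noteq> 0"
  obtains a where "u = a *\<^sub>R v"
proof -
  obtain b :: 'e where b: "Basis = {b}" using assms(1) by (metis card_1_singletonE)
  have e': "(z \<bullet> b) *\<^sub>R b = z" for z :: 'e using euclidean_representation[of z] unfolding b by simp
  note e = e'[symmetric]
  then have "v \<bullet> b \<noteq> 0" using assms(2) by (metis scaleR_zero_left)
  have "((u \<bullet> b) / (v \<bullet> b)) *\<^sub>R v = ((u \<bullet> b) / (v \<bullet> b)) *\<^sub>R ((v \<bullet> b) *\<^sub>R b)" by (simp only: e')
  also have "\<dots> = (u \<bullet> b) *\<^sub>R b" using \<open>v \<bullet> b \<noteq> 0\<close> by simp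
  also have "\<dots> = u" by (rule e')
  finally have "u = ((u \<bullet> b) / (v \<bullet> b)) *\<^sub>R v" ..
  then show ?thesis by (rule that)
qed

text \<open>Squaring and expanding the last hypothesis, with the bounds on the two sides, gives 2.42
  B v w \<ge> (s + t)^2 - 1.1^4 (s^2 + t^2). Here (s + t)^2 = 2 (s^2 + t^2) - (t - s)^2 is nearly
  twice the sum of squares, while 1.1^4 = 1.4641.\<close>

lemma almost_degenerate_triangle:
  assumes B: "inner_form B" and st: "s > 0" "t > 0" "\<bar>t - s\<bar> \<le> s / 16"
    and v: "form_norm B v \<le> 11/10 * s" and w: "form_norm B w \<le> 11/10 * t"
    and vw: "s + t \<le> 11/10 * form_norm B (v + w)"
  shows "B v w > 0"
proof -
  have sq: "(11/10 * x)\<^sup>2 = 121/100 * x\<^sup>2" for x :: real by (simp add: power2_eq_square)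
  have "(s + t)\<^sup>2 \<le> (11/10 * form_norm B (v + w))\<^sup>2" using st vw by (intro power_mono) auto
  also have "\<dots> = 121/100 * B (v + w) (v + w)" by (simp only: sq form_norm_square[OF B])
  also have "B (v + w) (v + w) = B v v + 2 * B v w + B w w"
    by (simp add: form_add_left[OF B] form_add_right[OF B] form_sym[OF B, of w v])
  finally have "(s + t)\<^sup>2 \<le> 121/100 * (B v v + 2 * B v w + B w w)" .
  moreover have "B v v \<le> 121/100 * s\<^sup>2"
    using power_mono[OF v form_norm_nonneg[OF B], of 2] by (simp only: sq form_norm_square[OF B])
  moreover have "B w w \<le> 121/100 * t\<^sup>2"
    using power_mono[OF w form_norm_nonneg[OF B], of 2] by (simp only: sq form_norm_square[OF B])
  moreover have "(s + t)\<^sup>2 > 14641/10000 * (s\<^sup>2 + t\<^sup>2)"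
  proof -
    have "\<bar>t - s\<bar>\<^sup>2 \<le> (s / 16)\<^sup>2" using st by (intro power_mono) auto
    moreover have "(s + t)\<^sup>2 = 2 * (s\<^sup>2 + t\<^sup>2) - \<bar>t - s\<bar>\<^sup>2" by (simp add: power2_eq_square algebra_simps)
    moreover have "(s / 16)\<^sup>2 = s\<^sup>2 / 256" by (simp add: power2_eq_square)
    moreover have "s\<^sup>2 > 0" "t\<^sup>2 > 0" using st by auto
    ultimately show ?thesis by argo
  qed
  ultimately show ?thesis by argo
qed

context cont_metric
begin

text \<open>This is the condition \<open>Q\<close> for \<open>escaping_chain\<close>: it passes to
  balls inside the given one (\<open>good_chart_shift\<close>). \<open>V\<close> is convex so that
  segments are available as curves, and \<open>B\<close> is one constant form for all of
  \<open>V\<close>.\<close>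

definition good_chart where
  "good_chart c B V p r \<longleftrightarrow> c \<in> \<A> \<and> inner_form B \<and> open V \<and> convex V \<and> V \<subseteq> chart_map c ` chart_dom c \<and>
     (\<forall>z\<in>V. \<forall>u. form_norm (G c z) u \<le> 11 / 10 * form_norm B u \<and> form_norm B u \<le> 11 / 10 * form_norm (G c z) u) \<and>
     (\<forall>q. d p q < r \<longrightarrow> q \<in> chart_dom c \<and> chart_map c q \<in> V)"

lemma ex_good_chart: "\<exists>r>0. \<exists>c B V. good_chart c B V p r"
proof -
  obtain c where c: "c \<in> \<A>" "p \<in> chart_dom c" using chart_cover .
  let ?x = "chart_map c p"
  obtain r0 where r0: "r0 > 0" "ball ?x r0 \<subseteq> chart_map c ` (chart_dom c \<inter> UNIV)"
    "\<And>z u. z \<in> ball ?x r0 \<Longrightarrow> form_norm (G c z) u \<le> 11/10 * form_norm (G c ?x) u"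
    "\<And>z u. z \<in> ball ?x r0 \<Longrightarrow> form_norm (G c ?x) u \<le> 11/10 * form_norm (G c z) u"
    by (rule nearly_constant_metric[OF c _ open_UNIV UNIV_I, where K = "11/10"]) (simp, blast)
  let ?W = "chart_dom c \<inter> chart_map c -` ball ?x r0"
  obtain r where r: "r > 0" "\<And>y. d p y < r \<Longrightarrow> y \<in> ?W"
  proof (rule open_contains_d_ball[OF open_chart_preimage[OF c(1) open_ball[of ?x r0]]])
    show "p \<in> ?W" using c r0(1) by simp
  qed blast
  have "inner_form (G c ?x)" using G_form c by auto
  then have "good_chart c (G c ?x) (ball ?x r0) p r"
    unfolding good_chart_def using c r0 r(2) by auto
  then show ?thesis using r(1) by blast
qed

lemma good_chart_shift: "good_chart c B V p r \<Longrightarrow> d p q + r' \<le> r \<Longrightarrow> good_chart c B V q r'"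
  unfolding good_chart_def using d_triangle[of p _ q] by (smt (verit))

context
  fixes c B V p r
  assumes gc: "good_chart c B V p r"
begin

lemma good_chart_in: "c \<in> \<A>" "inner_form B" "open V" "convex V" "V \<subseteq> chart_map c ` chart_dom c"
  using gc unfolding good_chart_def by auto

lemma good_chart_ball: "d p q < r \<Longrightarrow> q \<in> chart_dom c \<and> chart_map c q \<in> V"
  using gc unfolding good_chart_def by auto

lemma good_chart_upper:
  assumes "x \<in> V" "y \<in> V"
  shows "d (chart_inv c x) (chart_inv c y) \<le> 11/10 * form_norm B (y - x)"
proof -
  obtain l where "l \<le> 11/10 * form_norm B (y - x)" "joined (chart_inv c x) (chart_inv c y) l"
    using joined_segment[OF good_chart_in(1,4,5) assms good_chart_in(2), of "11/10"] gc unfolding good_chart_def by blast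
  then show ?thesis using d_le by fastforce
qed

text \<open>Two points within r / 4 of \<open>p\<close> are less than r / 2 apart, so an almost
  shortest curve between them is shorter than 3 r / 4 and stays in the ball of radius
  \<open>r\<close>, where the chart comparison applies.\<close>

lemma good_chart_lower:
  assumes "d p x < r / 4" "d p y < r / 4"
  shows "form_norm B (chart_map c y - chart_map c x) \<le> 11/10 * d x y"
proof (rule field_le_epsilon)
  fix e :: real assume e: "e > 0"
  have r: "r > 0" using assms d_nonneg[of p x] by linarith
  have dxy: "d x y < r / 2" using d_triangle[of x y p] d_sym[of x p] assms by linarith
  define e' where "e' = min (e / 2) (r / 8)"
  have e_le: "11/10 * e' \<le> e" using e by (simp add: e'_def)
  have "d x y < d x y + e'" using e r by (simp add: e'_def)
  then obtain a b \<gamma> where \<gamma>: "pw a b \<gamma>" "\<gamma> a = x" "\<gamma> b = y" "integral {a..b} (sp \<gamma>) < d x y + e'"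
    by (rule d_less_curve)
  have "d x y + e' < 3 * r / 4" using dxy unfolding e'_def min_def using r by (auto simp: field_simps)
  have "form_norm B (chart_map c (\<gamma> b) - chart_map c (\<gamma> a)) \<le> 11/10 * integral {a..b} (sp \<gamma>)"
  proof (rule curve_lower_bound[OF good_chart_in(1) \<gamma>(1) _ good_chart_in(2)])
    fix t assume t: "t \<in> {a..b}"
    have "d x (\<gamma> t) \<le> integral {a..t} (sp \<gamma>)" using d_curve[OF \<gamma>(1), of a t] t \<gamma>(2) by auto
    also have "\<dots> \<le> integral {a..b} (sp \<gamma>)"
      using pw_integral_combine[OF \<gamma>(1), of t] pw_integral_nonneg[of t b \<gamma>] pw_split[OF \<gamma>(1), of t] t by auto
    finally have "d p (\<gamma> t) < r"
      using d_triangle[of p "\<gamma> t" x] \<gamma>(4) assms(1) \<open>d x y + e' < 3 * r / 4\<close> by linarith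
    then show "\<gamma> t \<in> chart_dom c \<and> chart_map c (\<gamma> t) \<in> V" by (rule good_chart_ball)
  qed (use gc in \<open>auto simp: good_chart_def\<close>)
  then show "form_norm B (chart_map c y - chart_map c x) \<le> 11/10 * d x y + e"
    using \<gamma> e_le by simp
qed

end

text \<open>The uniform radius is what matters: a Cauchy sequence eventually stays in one unit ball,
  hence in a compact set.\<close>

lemma complete_if_unit_balls_precompact:
  assumes "\<And>p. \<exists>C. compact C \<and> (\<forall>q. d p q < 1 \<longrightarrow> q \<in> C)"
  shows "complete_metric \<A> g"
  unfolding complete_metric_iff
proof (intro allI impI)
  fix \<sigma> :: "nat \<Rightarrow> 'a"
  assume Cauchy: "\<forall>e>0. \<exists>N. \<forall>m\<ge>N. \<forall>n\<ge>N. d (\<sigma> m) (\<sigma> n) < e"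
  then obtain N where N: "\<forall>m\<ge>N. \<forall>n\<ge>N. d (\<sigma> m) (\<sigma> n) < 1" using zero_less_one by blast
  obtain C where C: "compact C" "\<forall>q. d (\<sigma> N) q < 1 \<longrightarrow> q \<in> C" using assms by blast
  have "\<exists>x. \<forall>e>0. \<exists>M. \<forall>n\<ge>M. d (\<sigma> (n + N)) x < e"
  proof (rule Cauchy_in_compact_converges[OF C(1)])
    show "\<sigma> (n + N) \<in> C" for n using N C(2) by simp
    fix e :: real assume "e > 0"
    then obtain M where "\<forall>m\<ge>M. \<forall>n\<ge>M. d (\<sigma> m) (\<sigma> n) < e" using Cauchy by blast
    then show "\<exists>M. \<forall>m\<ge>M. \<forall>n\<ge>M. d (\<sigma> (m + N)) (\<sigma> (n + N)) < e"
      by (intro exI[of _ M]) (meson trans_le_add1)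
  qed
  then obtain x where x: "\<And>e. e > 0 \<Longrightarrow> \<exists>M. \<forall>n\<ge>M. d (\<sigma> (n + N)) x < e" by blast
  have "\<exists>M. \<forall>n\<ge>M. d (\<sigma> n) x < e" if "e > 0" for e
  proof -
    obtain M where M: "\<forall>n\<ge>M. d (\<sigma> (n + N)) x < e" using x[OF \<open>e > 0\<close>] by blast
    have "d (\<sigma> n) x < e" if "n \<ge> M + N" for n
      using M[rule_format, of "n - N"] that by simp
    then show ?thesis by blast
  qed
  then show "\<exists>x. \<forall>e>0. \<exists>M. \<forall>n\<ge>M. d (\<sigma> n) x < e" by blast
qed

text \<open>Since the chain is geodesic and the charts are almost isometric, it does not turn back
  in the chart. In dimension one this fixes the direction in which it is traversed.\<close>

theorem incomplete_imp_chain: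
  assumes "\<not> complete_metric \<A> g"
  obtains P r c B V where "\<And>n::nat. good_chart (c n) (B n) (V n) (P n) (r n)" "\<And>n. r n > 0"
    "\<And>n. d (P n) (P (Suc n)) = r n / 8" "\<And>n. \<bar>r (Suc n) - r n\<bar> \<le> r n / 16"
    "summable r" "\<And>C. compact C \<Longrightarrow> \<exists>N. \<forall>n\<ge>N. P n \<notin> C"
    "\<And>n. B (Suc n) (chart_map (c (Suc n)) (P (Suc n)) - chart_map (c (Suc n)) (P n))
       (chart_map (c (Suc n)) (P (Suc (Suc n))) - chart_map (c (Suc n)) (P (Suc n))) > 0"
proof -
  have "\<exists>p r. \<not> compact (cb p r)"
    using assms complete_if_unit_balls_precompact in_cb by (meson less_imp_le)
  then interpret improper_length_metric d by unfold_locales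
  obtain P r where P: "\<And>n::nat. r n > 0" "\<And>n. \<exists>c B V. good_chart c B V (P n) (r n)"
    "\<And>n. d (P n) (P (Suc n)) = r n / 8"
    "\<And>n. d (P n) (P (Suc (Suc n))) = r n / 8 + r (Suc n) / 8"
    "\<And>n. \<bar>r (Suc n) - r n\<bar> \<le> r n / 16"
    "summable r" "\<And>C. compact C \<Longrightarrow> \<exists>N. \<forall>n\<ge>N. P n \<notin> C"
  proof (rule escaping_chain[of "\<lambda>p r. \<exists>c B V. good_chart c B V p r"])
    show "\<exists>c B V. good_chart c B V q r'" if "\<exists>c B V. good_chart c B V p r" "d p q + r' \<le> r" for p q r r'
      using that good_chart_shift by blast
    show "\<exists>r>0. \<exists>c B V. good_chart c B V p r" for p by (rule ex_good_chart)
  qed blast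
  obtain c B V where gc: "\<And>n. good_chart (c n) (B n) (V n) (P n) (r n)" using P(2) by metis
  have "B (Suc n) (chart_map (c (Suc n)) (P (Suc n)) - chart_map (c (Suc n)) (P n))
       (chart_map (c (Suc n)) (P (Suc (Suc n))) - chart_map (c (Suc n)) (P (Suc n))) > 0" for n
  proof -
    let ?c = "chart_map (c (Suc n))" and ?B = "B (Suc n)"
    let ?v = "?c (P (Suc n)) - ?c (P n)" and ?w = "?c (P (Suc (Suc n))) - ?c (P (Suc n))"
    have B: "inner_form ?B" using good_chart_in[OF gc] by blast
    define s t where "s = r n / 8" and "t = r (Suc n) / 8"
    have st: "s > 0" "t > 0" "\<bar>t - s\<bar> \<le> s / 16" 
      using P(1)[of n] P(1)[of "Suc n"] P(5)[of n] unfolding s_def t_def by linarith+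
    have near: "d (P (Suc n)) (P n) < r (Suc n) / 4" "d (P (Suc n)) (P (Suc n)) < r (Suc n) / 4"
        "d (P (Suc n)) (P (Suc (Suc n))) < r (Suc n) / 4"
      using P(3)[of n] P(3)[of "Suc n"] d_sym[of "P (Suc n)" "P n"] d_refl[of "P (Suc n)"] st
      unfolding s_def t_def by linarith+
    have v: "form_norm ?B ?v \<le> 11/10 * s"
      using good_chart_lower[OF gc near(1,2)] P(3)[of n] by (simp add: s_def)
    have w: "form_norm ?B ?w \<le> 11/10 * t"
      using good_chart_lower[OF gc near(2,3)] P(3)[of "Suc n"] by (simp add: t_def)
    have in_V: "?c (P n) \<in> V (Suc n)" "?c (P (Suc (Suc n))) \<in> V (Suc n)" "P n \<in> chart_dom (c (Suc n))"
      "P (Suc (Suc n)) \<in> chart_dom (c (Suc n))"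
      using good_chart_ball[OF gc, of "Suc n"] near P(1)[of "Suc n"] by fastforce+
    \<comment> \<open>The chain is geodesic, so the outer points have distance exactly s + t; the
      segment between their coordinates lies in \<open>V\<close> and cannot be much shorter.\<close>
    have "s + t \<le> 11/10 * form_norm ?B (?c (P (Suc (Suc n))) - ?c (P n))"
      using good_chart_upper[OF gc in_V(1,2)] in_V(3,4) P(4)[of n] chart_inv_map[OF good_chart_in(1)[OF gc]]
      by (simp add: s_def t_def)
    also have "?c (P (Suc (Suc n))) - ?c (P n) = ?v + ?w" by simp
    finally show ?thesis by (rule almost_degenerate_triangle[OF B st v w])
  qed
  then show ?thesis using that gc P by blast
qed

text \<open>A coordinate change of a line is monotone, so the sign of its derivative is read off
  from the order of two points.\<close>

lemma one_dimensional_direction: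
  assumes dim: "DIM('e) = 1" and c: "c \<in> \<A>" "c' \<in> \<A>" and B: "inner_form B" "inner_form B'"
    and p: "p \<in> chart_dom c" "p \<in> chart_dom c'" and q: "q \<in> chart_dom c" "q \<in> chart_dom c'" "p \<noteq> q"
    and seg: "\<And>s. 0 \<le> s \<Longrightarrow> s \<le> 1 \<Longrightarrow>
      chart_map c p + s *\<^sub>R (chart_map c q - chart_map c p) \<in> chart_map c ` (chart_dom c \<inter> chart_dom c')"
    and w: "B (chart_map c p - chart_map c q) w > 0"
  shows "B' (transition_deriv c c' p w) (chart_map c' p - chart_map c' q) > 0"
proof -
  let ?O = "chart_map c ` (chart_dom c \<inter> chart_dom c')" and ?\<theta> = "chart_map c' \<circ> chart_inv c"
  define z v W where "z = chart_map c p" and "v = chart_map c q - chart_map c p" and "W = chart_map c' p - chart_map c' q"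
  have v0: "v \<noteq> 0" using chart_inv_map[OF c(1) p(1)] chart_inv_map[OF c(1) q(1)] q(3) by (auto simp: v_def)
  have W0: "W \<noteq> 0" using chart_inv_map[OF c(2) p(2)] chart_inv_map[OF c(2) q(2)] q(3) by (auto simp: W_def)
  have W_inj: "B' u W \<noteq> 0" if "u \<noteq> 0" for u
  proof -
    obtain a where a: "u = a *\<^sub>R W" using one_dimensional_multiple[OF dim W0] .
    then have "a \<noteq> 0" using that by auto
    then show ?thesis using a form_scale_left[OF B(2)] form_pos[OF B(2) W0] by simp
  qed
  \<comment> \<open>The position on the segment from \<open>p\<close> to \<open>q\<close>, seen in
    the second chart and measured against \<open>W\<close>. It is continuous and injective with
    \<open>m 1 < m 0\<close>, so it cannot exceed \<open>m 0\<close>; its derivative at 0 is nonzero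
    because the transition map is regular, hence negative.\<close>
  define m where "m s = B' (?\<theta> (z + s *\<^sub>R v)) W" for s
  have seg': "z + s *\<^sub>R v \<in> ?O" if "0 \<le> s" "s \<le> 1" for s
    using seg[OF that] by (simp add: z_def v_def)
  have m_cont: "continuous_on {0..1} m"
    unfolding m_def
  proof (intro form_continuous[OF B(2)] continuous_on_const)
    show "continuous_on {0..1} (\<lambda>s. ?\<theta> (z + s *\<^sub>R v))"
      by (rule continuous_on_compose2[OF smooth_on_imp_continuous_on[OF smooth_transition[OF c]]])
         (use seg' in \<open>auto intro!: continuous_intros\<close>)
  qed
  have m_inj: "m s \<noteq> m t" if "0 \<le> s" "s < t" "t \<le> 1" for s t
  proof -
    have st: "z + s *\<^sub>R v \<in> ?O" "z + t *\<^sub>R v \<in> ?O" using seg' that by auto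
    obtain a where a: "a \<in> chart_dom c" "a \<in> chart_dom c'" "z + s *\<^sub>R v = chart_map c a" using st(1) by blast
    obtain b where b: "b \<in> chart_dom c" "b \<in> chart_dom c'" "z + t *\<^sub>R v = chart_map c b" using st(2) by blast
    have "z + s *\<^sub>R v \<noteq> z + t *\<^sub>R v" using v0 that by simp
    then have "a \<noteq> b" using a(3) b(3) by auto
    then have "chart_map c' a \<noteq> chart_map c' b"
      using chart_inv_map[OF c(2) a(2)] chart_inv_map[OF c(2) b(2)] by auto
    then have "?\<theta> (z + s *\<^sub>R v) \<noteq> ?\<theta> (z + t *\<^sub>R v)"
      by (simp add: a(3) b(3) chart_inv_map[OF c(1) a(1)] chart_inv_map[OF c(1) b(1)])
    then have "B' (?\<theta> (z + s *\<^sub>R v) - ?\<theta> (z + t *\<^sub>R v)) W \<noteq> 0" by (intro W_inj) simp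
    then show ?thesis by (simp add: m_def form_diff_left[OF B(2)])
  qed
  have "m 0 - m 1 = B' W W"
    using chart_inv_map[OF c(1)] p q by (simp add: m_def z_def v_def W_def form_diff_left[OF B(2)])
  then have m01: "m 1 < m 0" using form_pos[OF B(2) W0] by simp
  have m_less: "m s \<le> m 0" if s: "0 < s" "s < 1" for s
  proof (rule ccontr)
    assume "\<not> m s \<le> m 0"
    then obtain t where "s \<le> t" "t \<le> 1" "m t = m 0"
      using IVT2'[of m 1 "m 0" s] m01 continuous_on_subset[OF m_cont, of "{s..1}"] s by auto
    then show False using m_inj[of 0 t] s by auto
  qed
  have lin: "bounded_linear (\<lambda>u. B' u W)"
    using form_linear_left[OF B(2)] linear_conv_bounded_linear by blast
  have "((\<lambda>s. z + s *\<^sub>R v) has_derivative (\<lambda>s. s *\<^sub>R v)) (at 0)"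
    by (auto intro!: derivative_eq_intros)
  moreover have "(?\<theta> has_derivative transition_deriv c c' p) (at (z + 0 *\<^sub>R v))"
    using transition_derivative[OF c p] by (simp add: z_def)
  ultimately have "(?\<theta> \<circ> (\<lambda>s. z + s *\<^sub>R v) has_derivative transition_deriv c c' p \<circ> (\<lambda>s. s *\<^sub>R v)) (at 0)"
    by (rule diff_chain_at)
  from bounded_linear.has_derivative[OF lin this]
  have "(m has_derivative (\<lambda>s. B' (transition_deriv c c' p (s *\<^sub>R v)) W)) (at 0)"
    by (simp add: m_def[abs_def] o_def)
  moreover have trl: "linear (transition_deriv c c' p)"
    using transition_derivative[OF c p] has_derivative_linear by blast
  ultimately have "(m has_real_derivative B' (transition_deriv c c' p v) W) (at 0)"
    unfolding has_field_derivative_def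
    by (simp add: linear_scale[OF trl] form_scale_left[OF B(2)] mult.commute[of _ "B' _ W"])
  note der = this
  have "\<not> B' (transition_deriv c c' p v) W > 0"
  proof
    assume "B' (transition_deriv c c' p v) W > 0"
    then obtain e where e: "e > 0" "\<forall>h>0. h < e \<longrightarrow> m 0 < m (0 + h)"
      using DERIV_pos_inc_right[OF der] by blast
    define h where "h = min (e / 2) (1 / 2)"
    have "0 < h" "h < e" "h < 1" using e(1) by (auto simp: h_def)
    then show False using e(2) m_less[of h] by force
  qed
  moreover have "B' (transition_deriv c c' p v) W \<noteq> 0"
    by (rule W_inj[OF transition_deriv_nonzero[OF c p v0]])
  ultimately have neg: "B' (transition_deriv c c' p v) W < 0" by simp
  \<comment> \<open>On a line \<open>w\<close> is a multiple of \<open>v\<close>, and the hypothesis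
    on \<open>w\<close> makes the factor negative; the two signs cancel.\<close>
  obtain a where a: "w = a *\<^sub>R v" using one_dimensional_multiple[OF dim v0] .
  have "B (- v) w = - a * B v v"
    by (simp add: a form_minus_left[OF B(1)] form_scale_right[OF B(1)])
  then have "- a * B v v > 0" using w by (simp add: v_def)
  then have "a < 0" using form_pos[OF B(1) v0] by (simp add: mult_less_0_iff zero_less_mult_iff)
  then show ?thesis using neg
    by (simp add: a linear_scale[OF trl] form_scale_left[OF B(2)] W_def[symmetric] mult_neg_neg)
qed

end

section \<open>Blending two curves in a chart\<close>

lemma bump'_half: "bump' (1/2) = 0"
  by (simp add: bump'_def)

text \<open>In dimension at least two the image of a subset of the line under a differentiable map
  is a null set and cannot cover a ball.\<close>

lemma ex_small_avoiding:
  fixes f :: "real \<Rightarrow> 'e::euclidean_space"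
  assumes "DIM('e) \<noteq> 1" "f differentiable_on T" "\<rho> > 0"
  obtains u where "norm u < \<rho>" "u \<notin> f ` T"
proof -
  have "DIM('e) > 1" using assms(1) DIM_positive[where 'a = 'e] by linarith
  then have "negligible (f ` T)"
    using negligible_differentiable_image_lowdim[OF _ assms(2)] by simp
  moreover have "\<not> negligible (ball (0::'e) \<rho>)" using assms(3) by (intro open_not_negligible) auto
  ultimately have "\<not> ball 0 \<rho> \<subseteq> f ` T" using negligible_subset by blast
  then obtain u where "u \<in> ball 0 \<rho>" "u \<notin> f ` T" by blast
  then show ?thesis using that[of u] by (simp add: dist_norm)
qed

text \<open>The blend \<open>(1 - step) a + step b\<close> of two curves may stop in between. In dimension one the common
  direction prevents this. Otherwise a generic multiple of the bump is added: where its derivative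
  vanishes the blend is one of the given curves, and elsewhere the forbidden
  vectors form a curve, hence a null set.\<close>

lemma smooth_blend:
  fixes b :: "real \<Rightarrow> 'e::euclidean_space" and J :: "real set"
  assumes B: "inner_form B" and V: "convex V" and w: "w \<noteq> 0"
    and J: "open J" "{0..1} \<subseteq> J"
    and b: "smooth_on J b" "\<And>\<tau>. \<tau> \<in> J \<Longrightarrow> (b has_vector_derivative b' \<tau>) (at \<tau>)" "\<And>\<tau>. \<tau> \<in> J \<Longrightarrow> b' \<tau> \<noteq> 0"
    and \<delta>: "\<delta> > 0" "\<delta> \<le> form_norm B w / 4"
    and Vx: "\<And>z. form_norm B (z - x) < \<delta> \<Longrightarrow> z \<in> V" "\<And>z. form_norm B (z - (x + w)) < \<delta> \<Longrightarrow> z \<in> V"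
    and \<epsilon>: "\<epsilon> > 0" "\<epsilon> \<le> 1" "\<epsilon> * form_norm B w < \<delta> / 2"
    and close: "\<And>\<tau>. \<tau> \<in> J \<Longrightarrow> form_norm B (b \<tau> - (x + w)) < \<delta> / 2"
    and slow: "\<And>\<tau>. \<tau> \<in> J \<Longrightarrow> form_norm B (b' \<tau>) \<le> form_norm B w"
    and dir: "\<And>\<tau>. DIM('e) = 1 \<Longrightarrow> \<tau> \<in> J \<Longrightarrow> B (b' \<tau>) w > 0"
    and C: "C \<ge> 1" "\<And>x. 0 \<le> x \<Longrightarrow> x \<le> 1 \<Longrightarrow> \<bar>step' x\<bar> \<le> C"
      "\<And>x. 0 \<le> x \<Longrightarrow> x \<le> 1 \<Longrightarrow> \<bar>bump x\<bar> \<le> C" "\<And>x. 0 \<le> x \<Longrightarrow> x \<le> 1 \<Longrightarrow> \<bar>bump' x\<bar> \<le> C"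
  shows "\<exists>\<beta> \<beta>'. smooth_on J \<beta> \<and> (\<forall>\<tau>\<in>J. (\<beta> has_vector_derivative \<beta>' \<tau>) (at \<tau>) \<and> \<beta>' \<tau> \<noteq> 0) \<and>
    (\<forall>\<tau>. \<tau> \<le> 1/4 \<longrightarrow> \<beta> \<tau> = x + (\<epsilon> * \<tau>) *\<^sub>R w) \<and> (\<forall>\<tau>. \<tau> \<ge> 3/4 \<longrightarrow> \<beta> \<tau> = b \<tau>) \<and>
    (\<forall>\<tau>\<in>{0..1}. \<beta> \<tau> \<in> V \<and> form_norm B (\<beta>' \<tau>) \<le> (2 * C + 4) * form_norm B w)"
proof -
  let ?N = "form_norm B"
  have th: "thick J" using J(1) by (rule thick_open)
  have Nw: "?N w > 0" using form_norm_pos[OF B w] .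
  \<comment> \<open>The outgoing germ: the point \<open>x\<close> is left with velocity \<epsilon>
    w, slowly enough to stay within \<delta> / 2 of \<open>x\<close> on the unit interval.\<close>
  define a where "a \<tau> = x + (\<epsilon> * \<tau>) *\<^sub>R w" for \<tau>
  define \<beta>0 where "\<beta>0 \<tau> = a \<tau> + step \<tau> *\<^sub>R (b \<tau> - a \<tau>)" for \<tau>
  \<comment> \<open>The velocity of the blend before a multiple of the bump is added.\<close>
  define S where "S \<tau> = \<epsilon> *\<^sub>R w + (step' \<tau> *\<^sub>R (b \<tau> - a \<tau>) + step \<tau> *\<^sub>R (b' \<tau> - \<epsilon> *\<^sub>R w))" for \<tau>
  have sa: "smooth_on J a"
    unfolding a_def by (intro smooth_on_add smooth_on_scaleR smooth_on_mult smooth_on_const smooth_on_ident th)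
  have sstep: "smooth_on J step" "smooth_on J bump"
    using smooth_on_subset[OF smooth_step th] smooth_on_subset[OF smooth_bump th] by auto
  have s\<beta>0: "smooth_on J \<beta>0"
    unfolding \<beta>0_def by (intro smooth_on_add smooth_on_scaleR smooth_on_diff sa sstep b(1) th)
  have da: "(a has_vector_derivative \<epsilon> *\<^sub>R w) (at \<tau>)" for \<tau>
    unfolding a_def by (auto intro!: derivative_eq_intros simp flip: has_real_derivative_iff_has_vector_derivative)
  have dS: "(\<beta>0 has_vector_derivative S \<tau>) (at \<tau>)" if "\<tau> \<in> J" for \<tau>
  proof -
    have "((\<lambda>\<tau>. step \<tau> *\<^sub>R (b \<tau> - a \<tau>)) has_vector_derivative step \<tau> *\<^sub>R (b' \<tau> - \<epsilon> *\<^sub>R w) + step' \<tau> *\<^sub>R (b \<tau> - a \<tau>)) (at \<tau>)"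
      by (rule has_vector_derivative_scaleR[OF step_derivative has_vector_derivative_diff[OF b(2)[OF that] da]])
    from has_vector_derivative_add[OF da this] show ?thesis unfolding \<beta>0_def S_def by (simp add: add.commute)
  qed
  have smooth_S: "smooth_on J S"
  proof (rule smooth_on_cong[OF smooth_on_vector_derivative(1)[OF s\<beta>0 th]])
    fix \<tau> assume "\<tau> \<in> J"
    then show "vector_derivative \<beta>0 (at \<tau> within J) = S \<tau>"
      using vector_derivative_at[OF dS] at_within_open[OF _ J(1)] by metis
  qed
  have db: "(bump has_vector_derivative bump' \<tau>) (at \<tau>)" for \<tau>
    using bump_derivative by (simp add: has_real_derivative_iff_has_vector_derivative)
  have smooth_bump': "smooth_on UNIV bump'"
    by (rule smooth_on_cong[OF smooth_on_vector_derivative(1)[OF smooth_bump thick_UNIV]])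
       (simp add: vector_derivative_at[OF db])
  have S_early: "S \<tau> = \<epsilon> *\<^sub>R w" if "\<tau> \<le> 1/4" for \<tau> using that by (simp add: S_def step_eq step'_eq_0)
  have S_late: "S \<tau> = b' \<tau>" if "\<tau> \<ge> 1/2" for \<tau> using that by (simp add: S_def step_eq step'_eq_0)
  have Na: "?N (a \<tau> - x) < \<delta> / 2" if "\<tau> \<in> {0..1}" for \<tau>
  proof -
    have "?N (a \<tau> - x) = \<tau> * (\<epsilon> * ?N w)" using that \<epsilon>(1) by (simp add: a_def form_norm_scale[OF B] abs_mult)
    also have "\<dots> \<le> 1 * (\<epsilon> * ?N w)" using that \<epsilon>(1) Nw by (intro mult_right_mono) auto
    finally show ?thesis using \<epsilon>(3) by simp
  qed
  obtain u where u: "C * ?N u < \<delta> / 2" "\<And>\<tau>. \<tau> \<in> J \<Longrightarrow> S \<tau> + bump' \<tau> *\<^sub>R u \<noteq> 0"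
  proof (cases "DIM('e) = 1")
    case True
    have "S \<tau> \<noteq> 0" if \<tau>: "\<tau> \<in> J" for \<tau>
    proof -
      \<comment> \<open>While \<open>step'\<close> is nonzero, \<open>b \<tau> - a \<tau>\<close> is
        within \<delta> \<le> |w| / 4 of w, so its component along w is nonnegative. The rest of
        \<open>S \<tau>\<close> is a convex combination of two velocities in the direction of
        w.\<close>
      have "step' \<tau> * B (b \<tau> - a \<tau>) w \<ge> 0"
      proof (cases "\<tau> \<in> {0..1}")
        case True
        have "\<bar>B (b \<tau> - (x + w)) w\<bar> \<le> \<delta> / 2 * ?N w" "\<bar>B (a \<tau> - x) w\<bar> \<le> \<delta> / 2 * ?N w"
          using form_Cauchy_Schwarz[OF B, of "b \<tau> - (x + w)" w] form_Cauchy_Schwarz[OF B, of "a \<tau> - x" w]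
            mult_right_mono[OF less_imp_le[OF close[OF \<tau>]], of "?N w"] mult_right_mono[OF less_imp_le[OF Na[OF True]], of "?N w"] Nw
          by linarith+
        moreover have "\<delta> * ?N w \<le> ?N w / 4 * ?N w" using \<delta>(2) Nw by (intro mult_right_mono) auto
        moreover have "?N w * ?N w = B w w" using form_norm_square[OF B, of w] by (simp add: power2_eq_square)
        moreover have "B (b \<tau> - a \<tau>) w = B w w + B (b \<tau> - (x + w)) w - B (a \<tau> - x) w"
          by (simp add: form_diff_left[OF B] form_add_left[OF B])
        moreover have "B w w > 0" by (rule form_pos[OF B w])
        ultimately have "B (b \<tau> - a \<tau>) w \<ge> 0" by (simp add: field_simps)
        then show ?thesis by (simp add: step'_nonneg)
      next
        case False
        then show ?thesis using step'_eq_0[of \<tau>] by fastforce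
      qed
      moreover have "(1 - step \<tau>) * (\<epsilon> * B w w) + step \<tau> * B (b' \<tau>) w > 0"
      proof (cases "step \<tau> = 1")
        case False
        then have "(1 - step \<tau>) * (\<epsilon> * B w w) > 0" using step_range[of \<tau>] \<epsilon>(1) form_pos[OF B w] by simp
        then show ?thesis using step_range(1)[of \<tau>] dir[OF \<open>DIM('e) = 1\<close> \<tau>] by (simp add: add_pos_nonneg)
      qed (simp add: dir[OF \<open>DIM('e) = 1\<close> \<tau>])
      moreover have "B (S \<tau>) w = (1 - step \<tau>) * (\<epsilon> * B w w) + step \<tau> * B (b' \<tau>) w + step' \<tau> * B (b \<tau> - a \<tau>) w"
        by (simp add: S_def form_add_left[OF B] form_diff_left[OF B] form_scale_left[OF B] algebra_simps)
      ultimately have "B (S \<tau>) w > 0" by linarith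
      then show ?thesis using form_zero[OF B] by auto
    qed
    then show ?thesis using that[of 0] \<delta>(1) by (simp add: form_norm_def form_zero[OF B])
  next
    case False
    \<comment> \<open>Off this set \<open>bump'\<close> vanishes, and there the blend has the
      velocity of one of the two given curves.\<close>
    define T where "T = {1/4<..<3/4::real} - {1/2}"
    \<comment> \<open>The one vector that must be avoided at time \<tau>: where \<open>bump'\<close>
      is nonzero, \<open>S \<tau> + bump' \<tau> *\<^sub>R u = 0\<close> means
      \<open>u = f \<tau>\<close>.\<close>
    define f where "f \<tau> = - (inverse (bump' \<tau>) *\<^sub>R S \<tau>)" for \<tau>
    have "f differentiable_on T"
      unfolding differentiable_on_def
    proof
      fix \<tau> assume \<tau>: "\<tau> \<in> T"
      then have J\<tau>: "\<tau> \<in> J" using J(2) by (auto simp: T_def)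
      have nz: "bump' \<tau> \<noteq> 0" using bump'_neq_0[of \<tau>] \<tau> by (auto simp: T_def)
      have "S differentiable (at \<tau>)"
        using smooth_on_imp_has_derivative_open[OF smooth_S J\<tau> J(1)] by (rule differentiableI)
      moreover have "bump' differentiable (at \<tau>)"
        using smooth_on_imp_has_derivative_open[OF smooth_bump' UNIV_I open_UNIV] by (rule differentiableI)
      then have "(\<lambda>\<tau>. inverse (bump' \<tau>)) differentiable (at \<tau>)" using nz by simp
      ultimately have "(\<lambda>\<tau>. - (inverse (bump' \<tau>) *\<^sub>R S \<tau>)) differentiable (at \<tau>)" by (intro differentiable_minus differentiable_scaleR)
      then show "f differentiable (at \<tau> within T)"
        unfolding f_def[abs_def] by (rule differentiable_at_withinI)
    qed
    obtain m M where M: "M > 0" "\<And>u. ?N u \<le> M * norm u" using form_norm_equiv[OF B] by metis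
    \<comment> \<open>A bound on |u| that turns into \<open>C * ?N u < \<delta> / 2\<close>, the
      margin that keeps both perturbed curves in \<open>V\<close>.\<close>
    have "\<delta> / (2 * C * M) > 0" using \<delta>(1) C(1) M(1) by simp
    then obtain u where u: "norm u < \<delta> / (2 * C * M)" "u \<notin> f ` T"
      using ex_small_avoiding[OF False \<open>f differentiable_on T\<close>] by blast
    show ?thesis
    proof (rule that[of u])
      have "C * ?N u \<le> C * (M * norm u)" using M(2) C(1) by (intro mult_left_mono) auto
      also have "\<dots> < \<delta> / 2" using u(1) C(1) M(1) by (simp add: field_simps)
      finally show "C * ?N u < \<delta> / 2" .
      fix \<tau> assume \<tau>: "\<tau> \<in> J"
      show "S \<tau> + bump' \<tau> *\<^sub>R u \<noteq> 0"
      proof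
        assume 0: "S \<tau> + bump' \<tau> *\<^sub>R u = 0"
        consider "\<tau> \<le> 1/4" | "\<tau> = 1/2 \<or> \<tau> \<ge> 3/4" | "\<tau> \<in> T" unfolding T_def by force
        then show False
        proof cases
          case 1
          then show False using 0 S_early \<epsilon>(1) w by (simp add: bump'_eq_0)
        next
          case 2
          then have "bump' \<tau> = 0" using bump'_half bump'_eq_0(2) by blast
          moreover have "\<tau> \<ge> 1/2" using 2 by linarith
          ultimately show False using 0 S_late b(3)[OF \<tau>] by simp
        next
          case 3
          then have nz: "bump' \<tau> \<noteq> 0" using bump'_neq_0[of \<tau>] by (auto simp: T_def)
          have "bump' \<tau> *\<^sub>R u = - S \<tau>" using 0 by (simp add: eq_neg_iff_add_eq_0 add.commute)
          then have "inverse (bump' \<tau>) *\<^sub>R (bump' \<tau> *\<^sub>R u) = f \<tau>" by (simp add: f_def)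
          then have "u = f \<tau>" using nz by simp
          then show False using u(2) 3 by blast
        qed
      qed
    qed
  qed
  define \<beta> where "\<beta> \<tau> = \<beta>0 \<tau> + bump \<tau> *\<^sub>R u" for \<tau>
  define \<beta>' where "\<beta>' \<tau> = S \<tau> + bump' \<tau> *\<^sub>R u" for \<tau>
  have Nu: "\<bar>k\<bar> * ?N u < \<delta> / 2" if "\<bar>k\<bar> \<le> C" for k
    using mult_right_mono[OF that form_norm_nonneg[OF B, of u]] u(1) by linarith
  have "smooth_on J \<beta>"
    unfolding \<beta>_def by (intro smooth_on_add smooth_on_scaleR s\<beta>0 sstep smooth_on_const th)
  moreover have "(\<beta> has_vector_derivative \<beta>' \<tau>) (at \<tau>)" if "\<tau> \<in> J" for \<tau>
    unfolding \<beta>_def \<beta>'_def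
    using has_vector_derivative_add[OF dS[OF that] has_vector_derivative_scaleR[OF bump_derivative has_vector_derivative_const]] 
    by simp
  moreover have "\<beta> \<tau> = x + (\<epsilon> * \<tau>) *\<^sub>R w" if "\<tau> \<le> 1/4" for \<tau>
    using that by (simp add: \<beta>_def \<beta>0_def a_def step_eq bump_eq_0)
  moreover have "\<beta> \<tau> = b \<tau>" if "\<tau> \<ge> 3/4" for \<tau>
    using that by (simp add: \<beta>_def \<beta>0_def step_eq bump_eq_0)
  moreover have "\<beta> \<tau> \<in> V" if \<tau>: "\<tau> \<in> {0..1}" for \<tau>
  proof -
    have bu: "?N (bump \<tau> *\<^sub>R u) < \<delta> / 2" using Nu[OF C(3)[of \<tau>]] \<tau> by (simp add: form_norm_scale[OF B])
    have "a \<tau> + bump \<tau> *\<^sub>R u \<in> V"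
    proof (rule Vx(1))
      have "?N ((a \<tau> - x) + bump \<tau> *\<^sub>R u) < \<delta>" 
        using form_norm_triangle[OF B, of "a \<tau> - x" "bump \<tau> *\<^sub>R u"] Na[OF \<tau>] bu by linarith
      then show "?N (a \<tau> + bump \<tau> *\<^sub>R u - x) < \<delta>" by (simp add: algebra_simps)
    qed
    moreover have "b \<tau> + bump \<tau> *\<^sub>R u \<in> V"
    proof (rule Vx(2))
      have "?N ((b \<tau> - (x + w)) + bump \<tau> *\<^sub>R u) < \<delta>" 
        using form_norm_triangle[OF B, of "b \<tau> - (x + w)" "bump \<tau> *\<^sub>R u"] close[of \<tau>] J(2) \<tau> bu by force
      then show "?N (b \<tau> + bump \<tau> *\<^sub>R u - (x + w)) < \<delta>" by (simp add: algebra_simps)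
    qed
    \<comment> \<open>Adding the bump to both curves before blending gives the same curve, now as a
      convex combination of points of \<open>V\<close>.\<close>
    moreover have "\<beta> \<tau> = (1 - step \<tau>) *\<^sub>R (a \<tau> + bump \<tau> *\<^sub>R u) + step \<tau> *\<^sub>R (b \<tau> + bump \<tau> *\<^sub>R u)"
      by (simp add: \<beta>_def \<beta>0_def algebra_simps)
    ultimately show ?thesis using convexD_alt[OF V, of "a \<tau> + bump \<tau> *\<^sub>R u" "b \<tau> + bump \<tau> *\<^sub>R u" "step \<tau>"] step_range by simp
  qed
  moreover have "?N (\<beta>' \<tau>) \<le> (2 * C + 4) * ?N w" if \<tau>: "\<tau> \<in> {0..1}" for \<tau>
  proof -
    have \<tau>J: "\<tau> \<in> J" using \<tau> J(2) by blast
    have "b \<tau> - a \<tau> = (b \<tau> - (x + w)) + (w + - (a \<tau> - x))" by simp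
    then have "?N (b \<tau> - a \<tau>) = ?N ((b \<tau> - (x + w)) + (w + - (a \<tau> - x)))" by (rule arg_cong)
    then have "?N (b \<tau> - a \<tau>) \<le> ?N (b \<tau> - (x + w)) + (?N w + ?N (a \<tau> - x))"
      using form_norm_triangle[OF B, of "b \<tau> - (x + w)" "w + - (a \<tau> - x)"] form_norm_triangle[OF B, of w "- (a \<tau> - x)"]
        form_norm_minus[OF B, of "a \<tau> - x"] by linarith
    then have ba: "?N (b \<tau> - a \<tau>) \<le> 5/4 * ?N w" using close[OF \<tau>J] Na[OF \<tau>] \<delta>(2) by linarith
    have 1: "?N (((1 - step \<tau>) * \<epsilon>) *\<^sub>R w) \<le> ?N w"
      using step_range[of \<tau>] \<epsilon> Nw by (simp add: form_norm_scale[OF B] abs_mult mult_le_one)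
    have 2: "?N (step \<tau> *\<^sub>R b' \<tau>) \<le> 1 * ?N w"
      using step_range[of \<tau>] slow[OF \<tau>J] form_norm_nonneg[OF B, of "b' \<tau>"] 
      unfolding form_norm_scale[OF B] by (intro mult_mono) auto
    have 3: "?N (step' \<tau> *\<^sub>R (b \<tau> - a \<tau>)) \<le> C * (5/4 * ?N w)"
      unfolding form_norm_scale[OF B] using C(1) C(2)[of \<tau>] \<tau> ba form_norm_nonneg[OF B] by (intro mult_mono) auto
    have 4: "?N (bump' \<tau> *\<^sub>R u) \<le> ?N w"
      unfolding form_norm_scale[OF B] using Nu[OF C(4)[of \<tau>]] \<tau> \<delta>(2) Nw by auto
    have "\<beta>' \<tau> = (((1 - step \<tau>) * \<epsilon>) *\<^sub>R w + step \<tau> *\<^sub>R b' \<tau>) + (step' \<tau> *\<^sub>R (b \<tau> - a \<tau>) + bump' \<tau> *\<^sub>R u)"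
      by (simp add: \<beta>'_def S_def algebra_simps)
    then have "?N (\<beta>' \<tau>) = ?N ((((1 - step \<tau>) * \<epsilon>) *\<^sub>R w + step \<tau> *\<^sub>R b' \<tau>) + (step' \<tau> *\<^sub>R (b \<tau> - a \<tau>) + bump' \<tau> *\<^sub>R u))"
      by (rule arg_cong)
    also have "\<dots> \<le> (?N (((1 - step \<tau>) * \<epsilon>) *\<^sub>R w) + ?N (step \<tau> *\<^sub>R b' \<tau>)) + (?N (step' \<tau> *\<^sub>R (b \<tau> - a \<tau>)) + ?N (bump' \<tau> *\<^sub>R u))"
      by (rule order_trans[OF form_norm_triangle[OF B] add_mono[OF form_norm_triangle[OF B] form_norm_triangle[OF B]]])
    \<comment> \<open>The four summands of the velocity contribute 3 + 5/4 C in units of |w|,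
      rounded up to 2 C + 4.\<close>
    also have "\<dots> \<le> (?N w + 1 * ?N w) + (C * (5/4 * ?N w) + ?N w)" using 1 2 3 4 by linarith
    also have "\<dots> \<le> (2 * C + 4) * ?N w" using C(1) Nw by (simp add: field_simps)
    finally show ?thesis .
  qed
  ultimately show ?thesis using u(2) unfolding \<beta>'_def by (intro exI[of _ \<beta>] exI[of _ \<beta>']) (auto simp: \<beta>'_def)
qed

context cont_metric
begin

text \<open>A straight germ of one chart, run through slowly, seen in another chart.\<close>

lemma incoming_germ:
  assumes c: "c \<in> \<A>" "c' \<in> \<A>" "p \<in> chart_dom c" "p \<in> chart_dom c'" and w: "w \<noteq> 0" and B: "inner_form B"
    and \<delta>: "\<delta> > 0" "L > 0" and dir: "DIM('e) = 1 \<Longrightarrow> B (transition_deriv c c' p w) W > 0"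
  shows "\<exists>e0>0. \<forall>\<epsilon>. 0 < \<epsilon> \<longrightarrow> \<epsilon> \<le> e0 \<longrightarrow> (\<exists>b'.
     smooth_on {-1<..<2} (\<lambda>\<tau>. chart_map c' (chart_inv c (chart_map c p + (\<epsilon> * (\<tau> - 1)) *\<^sub>R w))) \<and>
     (\<forall>\<tau>\<in>{-1<..<2}. chart_map c p + (\<epsilon> * (\<tau> - 1)) *\<^sub>R w \<in> chart_map c ` (chart_dom c \<inter> chart_dom c') \<and>
       ((\<lambda>\<tau>. chart_map c' (chart_inv c (chart_map c p + (\<epsilon> * (\<tau> - 1)) *\<^sub>R w))) has_vector_derivative b' \<tau>) (at \<tau>) \<and>
       b' \<tau> \<noteq> 0 \<and> form_norm B (chart_map c' (chart_inv c (chart_map c p + (\<epsilon> * (\<tau> - 1)) *\<^sub>R w)) - chart_map c' p) < \<delta> \<and>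
       form_norm B (b' \<tau>) \<le> L \<and> (DIM('e) = 1 \<longrightarrow> B (b' \<tau>) W > 0)))"
proof -
  let ?O = "chart_map c ` (chart_dom c \<inter> chart_dom c')" and ?\<theta> = "chart_map c' \<circ> chart_inv c"
  let ?x = "chart_map c p"
  have O: "open ?O" by (rule open_overlap[OF c(1) open_dom[OF c(2)]])
  have xO: "?x \<in> ?O" using c by blast
  define l where "l s = ?x + s *\<^sub>R w" for s
  \<comment> \<open>The derivative of the transformed line in \<open>s\<close>; the velocity in
    \<tau> is \<epsilon> times this and can be made as small as desired.\<close>
  define D where "D s = frechet_derivative ?\<theta> (at (l s)) w" for s
  have l0: "l 0 = ?x" by (simp add: l_def)
  have contl: "isCont l s" for s unfolding l_def by (intro continuous_intros)
  have evO: "eventually (\<lambda>s. l s \<in> ?O) (nhds 0)"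
    using contl[of 0] O xO l0 by (metis continuous_within eventually_at_topological eventually_nhds tendsto_at_iff_tendsto_nhds topological_tendstoD isCont_def)
  have tr: "transition_deriv c c' (chart_inv c y) = frechet_derivative ?\<theta> (at y)" "frechet_derivative ?\<theta> (at y) w \<noteq> 0"
    if y: "y \<in> ?O" for y
  proof -
    obtain q where q: "q \<in> chart_dom c" "q \<in> chart_dom c'" "y = chart_map c q" using y by blast
    show 1: "transition_deriv c c' (chart_inv c y) = frechet_derivative ?\<theta> (at y)"
      using chart_map_inv[OF c(1), of y] q by (simp add: transition_deriv_def)
    show "frechet_derivative ?\<theta> (at y) w \<noteq> 0"
      using transition_deriv_nonzero[OF c(1,2) q(1,2) w] 1 chart_inv_map[OF c(1) q(1)] q(3) by simp
  qed
  have "continuous_on ?O (\<lambda>y. frechet_derivative ?\<theta> (at y within ?O) w)"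
    by (intro smooth_on_imp_continuous_on smooth_on_derivative smooth_transition c)
  then have "continuous_on ?O (\<lambda>y. frechet_derivative ?\<theta> (at y) w)"
    by (rule continuous_on_eq) (simp only: at_within_open[OF _ O])
  then have "isCont (\<lambda>y. frechet_derivative ?\<theta> (at y) w) (l 0)"
    unfolding l0 using continuous_on_eq_continuous_at[OF O] xO by blast
  then have contD: "isCont D 0" unfolding D_def[abs_def] by (rule isCont_o2[OF contl])
  have "isCont ?\<theta> (l 0)"
    unfolding l0 using smooth_on_imp_continuous_on[OF smooth_transition[OF c(1,2)]] continuous_on_eq_continuous_at[OF O] xO by blast
  then have cont\<theta>: "isCont (\<lambda>s. ?\<theta> (l s)) 0" by (rule isCont_o2[OF contl])
  have formcont: "((\<lambda>s. B (f s) (h s)) \<longlongrightarrow> B y z) (nhds (0::real))"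
    if "(f \<longlongrightarrow> y) (nhds 0)" "(h \<longlongrightarrow> z) (nhds 0)" for f h y z
    by (subst form_expand[OF B], subst form_expand[OF B]) (intro tendsto_intros that)
  have tD: "(D \<longlongrightarrow> D 0) (nhds 0)" and t\<theta>: "((\<lambda>s. ?\<theta> (l s)) \<longlongrightarrow> ?\<theta> (l 0)) (nhds 0)"
    using contD cont\<theta> tendsto_at_iff_tendsto_nhds[of D 0] tendsto_at_iff_tendsto_nhds[of "\<lambda>s. ?\<theta> (l s)" 0]
    unfolding isCont_def by blast+
  have t\<theta>': "((\<lambda>s. ?\<theta> (l s) - ?\<theta> (l 0)) \<longlongrightarrow> ?\<theta> (l 0) - ?\<theta> (l 0)) (nhds 0)"
    by (intro tendsto_diff t\<theta> tendsto_const)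
  have "((\<lambda>s. form_norm B (?\<theta> (l s) - ?\<theta> (l 0))) \<longlongrightarrow> form_norm B (?\<theta> (l 0) - ?\<theta> (l 0))) (nhds 0)"
    unfolding form_norm_def by (intro tendsto_real_sqrt formcont t\<theta>')
  then have ev1: "eventually (\<lambda>s. form_norm B (?\<theta> (l s) - ?\<theta> (l 0)) < \<delta>) (nhds 0)"
    by (rule order_tendstoD) (simp add: \<delta> form_norm_def form_zero[OF B])
  have "((\<lambda>s. form_norm B (D s)) \<longlongrightarrow> form_norm B (D 0)) (nhds 0)"
    unfolding form_norm_def by (intro tendsto_real_sqrt formcont tD)
  then have ev2: "eventually (\<lambda>s. form_norm B (D s) < form_norm B (D 0) + 1) (nhds 0)"
    by (rule order_tendstoD) simp
  have ev3: "eventually (\<lambda>s. DIM('e) = 1 \<longrightarrow> B (D s) W > 0) (nhds 0)"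
  proof (cases "DIM('e) = 1")
    case True
    have "B (D 0) W > 0" using dir[OF True] tr(1)[OF xO] chart_inv_map[OF c(1,3)] l0 by (simp add: D_def)
    then have "eventually (\<lambda>s. B (D s) W > 0) (nhds 0)"
      by (rule order_tendstoD(1)[OF formcont[OF tD tendsto_const]])
    then show ?thesis by eventually_elim simp
  qed simp
  obtain s1 where s1: "s1 > 0" "\<And>s. \<bar>s\<bar> < s1 \<Longrightarrow> l s \<in> ?O \<and> form_norm B (?\<theta> (l s) - ?\<theta> (l 0)) < \<delta> \<and>
      form_norm B (D s) < form_norm B (D 0) + 1 \<and> (DIM('e) = 1 \<longrightarrow> B (D s) W > 0)"
    using eventually_conj[OF evO eventually_conj[OF ev1 eventually_conj[OF ev2 ev3]]]
    unfolding eventually_nhds_metric dist_real_def by auto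
  define M where "M = form_norm B (D 0) + 1"
  have M: "M > 0" using form_norm_nonneg[OF B, of "D 0"] by (simp add: M_def)
  \<comment> \<open>For \<tau> in (-1, 2) the parameter \<open>\<epsilon> * (\<tau> - 1)\<close>
    stays between -2 \<epsilon> and \<epsilon>, hence the bound s1 / 2; L / M limits the speed. The
    germ passes \<open>p\<close> at \<tau> = 1, where the link of the ray will end.\<close>
  have "\<exists>b'. smooth_on {-1<..<2} (\<lambda>\<tau>. ?\<theta> (l (\<epsilon> * (\<tau> - 1)))) \<and>
     (\<forall>\<tau>\<in>{-1<..<2}. l (\<epsilon> * (\<tau> - 1)) \<in> ?O \<and>
       ((\<lambda>\<tau>. ?\<theta> (l (\<epsilon> * (\<tau> - 1)))) has_vector_derivative b' \<tau>) (at \<tau>) \<and>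
       b' \<tau> \<noteq> 0 \<and> form_norm B (?\<theta> (l (\<epsilon> * (\<tau> - 1))) - chart_map c' p) < \<delta> \<and>
       form_norm B (b' \<tau>) \<le> L \<and> (DIM('e) = 1 \<longrightarrow> B (b' \<tau>) W > 0))"
    if \<epsilon>: "0 < \<epsilon>" "\<epsilon> \<le> min (s1 / 2) (L / M)" for \<epsilon>
  proof -
    have small: "\<bar>\<epsilon> * (\<tau> - 1)\<bar> < s1" if "\<tau> \<in> {-1<..<2}" for \<tau>
    proof -
      have "\<epsilon> * \<bar>\<tau> - 1\<bar> < \<epsilon> * 2" using that \<epsilon>(1) by (intro mult_strict_left_mono) auto
      also have "\<epsilon> * 2 \<le> s1" using \<epsilon>(2) by simp
      finally show ?thesis using \<epsilon>(1) by (simp add: abs_mult)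
    qed
    note s = s1(2)[OF small]
    have th: "thick {-1<..<2::real}" by (simp add: thick_open)
    have "smooth_on {-1<..<2} (\<lambda>\<tau>. l (\<epsilon> * (\<tau> - 1)))"
      unfolding l_def
      by (intro smooth_on_add smooth_on_scaleR smooth_on_mult smooth_on_diff smooth_on_const smooth_on_ident th)
    then have "smooth_on {-1<..<2} (\<lambda>\<tau>. ?\<theta> (l (\<epsilon> * (\<tau> - 1))))"
      by (rule smooth_on_compose[OF smooth_transition[OF c(1,2)]]) (use s th thick_open[OF O] in auto)
    moreover have "((\<lambda>\<tau>. ?\<theta> (l (\<epsilon> * (\<tau> - 1)))) has_vector_derivative \<epsilon> *\<^sub>R D (\<epsilon> * (\<tau> - 1))) (at \<tau>)" if \<tau>: "\<tau> \<in> {-1<..<2}" for \<tau>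
    proof -
      let ?s = "\<epsilon> * (\<tau> - 1)"
      have \<theta>: "(?\<theta> has_derivative frechet_derivative ?\<theta> (at (l ?s))) (at (l ?s))"
        by (rule smooth_on_imp_has_derivative_open[OF smooth_transition[OF c(1,2)] _ O]) (use s[OF \<tau>] in blast)
      have "((\<lambda>\<tau>. l (\<epsilon> * (\<tau> - 1))) has_vector_derivative \<epsilon> *\<^sub>R w) (at \<tau>)"
        unfolding l_def by (auto intro!: derivative_eq_intros simp flip: has_real_derivative_iff_has_vector_derivative)
      then have "(?\<theta> \<circ> (\<lambda>\<tau>. l (\<epsilon> * (\<tau> - 1))) has_derivative
           frechet_derivative ?\<theta> (at (l ?s)) \<circ> (\<lambda>h. h *\<^sub>R (\<epsilon> *\<^sub>R w))) (at \<tau>)"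
        unfolding has_vector_derivative_def by (rule diff_chain_at) (rule \<theta>)
      moreover have "frechet_derivative ?\<theta> (at (l ?s)) \<circ> (\<lambda>h. h *\<^sub>R (\<epsilon> *\<^sub>R w)) = (\<lambda>h. h *\<^sub>R (\<epsilon> *\<^sub>R D ?s))"
        using linear_scale[OF has_derivative_linear[OF \<theta>]] by (auto simp: D_def)
      ultimately show ?thesis by (simp add: has_vector_derivative_def o_def)
    qed
    moreover have "\<epsilon> *\<^sub>R D (\<epsilon> * (\<tau> - 1)) \<noteq> 0" if \<tau>: "\<tau> \<in> {-1<..<2}" for \<tau>
      using tr(2) s[OF \<tau>] \<epsilon>(1) by (simp add: D_def)
    moreover have "form_norm B (?\<theta> (l (\<epsilon> * (\<tau> - 1))) - chart_map c' p) < \<delta>" if \<tau>: "\<tau> \<in> {-1<..<2}" for \<tau>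
      using s[OF \<tau>] l0 chart_inv_map[OF c(1,3)] by simp
    moreover have "form_norm B (\<epsilon> *\<^sub>R D (\<epsilon> * (\<tau> - 1))) \<le> L" if \<tau>: "\<tau> \<in> {-1<..<2}" for \<tau>
    proof -
      have "\<epsilon> * form_norm B (D (\<epsilon> * (\<tau> - 1))) \<le> L / M * M"
        using s[OF \<tau>] \<epsilon> \<delta>(2) M form_norm_nonneg[OF B] by (intro mult_mono) (auto simp: M_def)
      then show ?thesis using \<epsilon>(1) M by (simp add: form_norm_scale[OF B])
    qed
    moreover have "DIM('e) = 1 \<longrightarrow> B (\<epsilon> *\<^sub>R D (\<epsilon> * (\<tau> - 1))) W > 0" if \<tau>: "\<tau> \<in> {-1<..<2}" for \<tau>
      using s[OF \<tau>] \<epsilon>(1) by (simp add: form_scale_left[OF B])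
    ultimately show ?thesis using s by (intro exI[of _ "\<lambda>\<tau>. \<epsilon> *\<^sub>R D (\<epsilon> * (\<tau> - 1))"]) blast
  qed
  moreover have "min (s1 / 2) (L / M) > 0" using s1(1) \<delta>(2) M by simp
  ultimately show ?thesis unfolding l_def o_def by blast
qed

end

section \<open>Incompleteness yields a regular escaping ray of finite length\<close>

context cont_metric
begin

lemma regular_atI:
  assumes "thick I" "t \<in> I" "c \<in> \<A>" "open U" "t \<in> U" "smooth_on (I \<inter> U) \<beta>"
    "\<And>s. s \<in> I \<Longrightarrow> s \<in> U \<Longrightarrow> \<beta> s \<in> chart_map c ` chart_dom c \<and> \<gamma> s = chart_inv c (\<beta> s)"
    "(\<beta> has_vector_derivative h) (at t within I)" "h \<noteq> 0"
  shows "regular_at I \<gamma> t"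
proof -
  have "vector_derivative \<beta> (at t within I) = h"
    using vector_derivative_within[OF thick_not_bot[OF assms(1,2)] assms(8)] .
  then show ?thesis
    unfolding regular_at_def using assms by (intro bexI[of _ c] exI[of _ U] exI[of _ \<beta>]) auto
qed

lemma regular_curve_speed:
  assumes "regular_curve \<A> I \<gamma>" "thick I" "t \<in> I" "c \<in> \<A>" "open U" "t \<in> U"
    "\<And>s. s \<in> I \<Longrightarrow> s \<in> U \<Longrightarrow> \<beta> s \<in> chart_map c ` chart_dom c \<and> \<gamma> s = chart_inv c (\<beta> s)"
    "(\<beta> has_vector_derivative h) (at t within I)"
  shows "speed \<A> g I \<gamma> t = form_norm (G c (\<beta> t)) h"
proof -
  have t: "\<beta> t \<in> chart_map c ` chart_dom c" "\<gamma> t = chart_inv c (\<beta> t)" using assms(3,6,7) by auto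
  have "(\<beta> has_vector_derivative h) (at t within I \<inter> U)"
    using assms(8) at_within_Int_open[OF assms(5,6), of I] by simp
  then have "((chart_map c \<circ> \<gamma>) has_vector_derivative h) (at t within I \<inter> U)"
    by (rule has_vector_derivative_transform[rotated 2]) (use assms chart_map_inv[OF assms(4)] in auto)
  then have "((chart_map c \<circ> \<gamma>) has_vector_derivative h) (at t within I)"
    using at_within_Int_open[OF assms(5,6), of I] by simp
  moreover have "continuous (at t within I) \<gamma>"
    using assms(1,3) unfolding regular_curve_def by (simp add: continuous_on_eq_continuous_within)
  ultimately show ?thesis
    using speed_eq[OF assms(4) _ assms(3) thick_not_bot[OF assms(2,3)]] t chart_map_inv[OF assms(4)] chart_inv_dom[OF assms(4)]
    by simp
qed

text \<open>Finite length is expressed by a speed bound on each unit interval with summable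
  constants; in this form it can be inserted directly into the integral of
  \<open>L1_on_escaping_curve\<close>.\<close>

theorem incomplete_imp_ray:
  assumes "\<not> complete_metric \<A> g"
  obtains \<gamma> P r M where "regular_curve \<A> {0..} \<gamma>" "\<And>n::nat. \<gamma> (real n) = P n"
    "\<And>C. compact C \<Longrightarrow> \<exists>N. \<forall>n\<ge>N. P n \<notin> C" "summable r" "\<And>n. r n > 0" "M > 0"
    "\<And>n t. real n \<le> t \<Longrightarrow> t < real n + 1 \<Longrightarrow> speed \<A> g {0..} \<gamma> t \<le> M * r n"
proof -
  obtain P r c B V where gc: "\<And>n::nat. good_chart (c n) (B n) (V n) (P n) (r n)" and r: "\<And>n. r n > 0"
    and dP: "\<And>n. d (P n) (P (Suc n)) = r n / 8" and r_Suc: "\<And>n. \<bar>r (Suc n) - r n\<bar> \<le> r n / 16"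
    and sm_r: "summable r" and escape: "\<And>C. compact C \<Longrightarrow> \<exists>N. \<forall>n\<ge>N. P n \<notin> C"
    and turn: "\<And>n. B (Suc n) (chart_map (c (Suc n)) (P (Suc n)) - chart_map (c (Suc n)) (P n))
       (chart_map (c (Suc n)) (P (Suc (Suc n))) - chart_map (c (Suc n)) (P (Suc n))) > 0"
    using incomplete_imp_chain[OF assms] by metis
  obtain C where C: "C \<ge> 1" "\<And>x. 0 \<le> x \<Longrightarrow> x \<le> 1 \<Longrightarrow> \<bar>step' x\<bar> \<le> C"
      "\<And>x. 0 \<le> x \<Longrightarrow> x \<le> 1 \<Longrightarrow> \<bar>bump x\<bar> \<le> C" "\<And>x. 0 \<le> x \<Longrightarrow> x \<le> 1 \<Longrightarrow> \<bar>bump' x\<bar> \<le> C"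
    using step_bump_bounded by blast
  note gc_in = good_chart_in[OF gc]
  define x where "x n = chart_map (c n) (P n)" for n
  define w where "w n = chart_map (c n) (P (Suc n)) - x n" for n
  let ?N = "\<lambda>n. form_norm (B n)"
  have near: "d (P n) (P n) < r n / 4" "d (P n) (P (Suc n)) < r n / 4" "d (P (Suc n)) (P n) < r (Suc n) / 4" for n
    using r[of n] d_refl[of "P n"] dP[of n] r_Suc[of n] d_sym[of "P (Suc n)" "P n"] by linarith+
  have "r n / 4 < r n" for n using r[of n] by simp
  then have in_ball: "d (P n) (P n) < r n" "d (P n) (P (Suc n)) < r n" "d (P (Suc n)) (P n) < r (Suc n)" for n
    using near less_trans by blast+
  have PD: "P n \<in> chart_dom (c n)" "P (Suc n) \<in> chart_dom (c n)" "P n \<in> chart_dom (c (Suc n))"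
    and PV: "x n \<in> V n" "x n + w n \<in> V n" "chart_map (c (Suc n)) (P n) \<in> V (Suc n)" for n
    using good_chart_ball[OF gc in_ball(1)] good_chart_ball[OF gc in_ball(2)] good_chart_ball[OF gc in_ball(3)]
    by (auto simp: x_def w_def)
  have P_neq: "P n \<noteq> P (Suc n)" for n using dP[of n] r[of n] d_refl[of "P n"] by auto
  have w0: "w n \<noteq> 0" for n
    using chart_inv_map[OF gc_in(1) PD(1), of n] chart_inv_map[OF gc_in(1) PD(2), of n] P_neq[of n] by (auto simp: w_def x_def)
  have Nw: "?N n (w n) > 0" "?N n (w n) \<le> 11/80 * r n" for n
  proof -
    show "?N n (w n) > 0" by (rule form_norm_pos[OF gc_in(2) w0])
    show "?N n (w n) \<le> 11/80 * r n"
      using good_chart_lower[OF gc near(1,2), of n] unfolding dP w_def x_def by simp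
  qed
  \<comment> \<open>A margin that serves both ends of the link and is small against the step; by
    equivalence of norms it can be measured with \<open>B n\<close>.\<close>
  have "\<exists>\<delta>>0. \<delta> \<le> ?N n (w n) / 4 \<and> (\<forall>z. ?N n (z - x n) < \<delta> \<longrightarrow> z \<in> V n) \<and> (\<forall>z. ?N n (z - (x n + w n)) < \<delta> \<longrightarrow> z \<in> V n)" for n
  proof -
    obtain m where m: "m > 0" "\<And>u. m * norm u \<le> ?N n u" using form_norm_equiv[OF gc_in(2)] by metis
    obtain e1 where e1: "e1 > 0" "ball (x n) e1 \<subseteq> V n" using openE[OF gc_in(3) PV(1)] .
    obtain e2 where e2: "e2 > 0" "ball (x n + w n) e2 \<subseteq> V n" using openE[OF gc_in(3) PV(2)] .
    have sub: "z \<in> V n" if "?N n (z - y) < m * e" "ball y e \<subseteq> V n" for y z e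
    proof -
      have "m * norm (z - y) < m * e" using m(2)[of "z - y"] that(1) by linarith
      then have "z \<in> ball y e" using m(1) by (simp add: dist_norm norm_minus_commute)
      then show ?thesis using that(2) by blast
    qed
    show ?thesis
      by (rule exI[of _ "min (min (m * e1) (m * e2)) (?N n (w n) / 4)"])
         (use m(1) e1 e2 Nw(1)[of n] sub in auto)
  qed
  then obtain \<delta> where \<delta>: "\<And>n. \<delta> n > 0" "\<And>n. \<delta> n \<le> ?N n (w n) / 4"
    "\<And>n z. ?N n (z - x n) < \<delta> n \<Longrightarrow> z \<in> V n" "\<And>n z. ?N n (z - (x n + w n)) < \<delta> n \<Longrightarrow> z \<in> V n" by metis
  \<comment> \<open>\<open>z n\<close> is the straight germ at \<open>P n\<close> in its own chart,
    and \<open>b n\<close> the germ at the next point seen in the chart of \<open>P n\<close>,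
    shifted so that the point is reached at \<tau> = 1.\<close>
  define z where "z n \<epsilon> s = x n + (\<epsilon> * s) *\<^sub>R w n" for n and \<epsilon> s :: real
  define b where "b n \<epsilon> \<tau> = chart_map (c n) (chart_inv (c (Suc n)) (z (Suc n) \<epsilon> (\<tau> - 1)))" for n and \<epsilon> \<tau> :: real
  let ?J = "{-1<..<2::real}"
  have "\<exists>e0>0. \<forall>\<epsilon>. 0 < \<epsilon> \<longrightarrow> \<epsilon> \<le> e0 \<longrightarrow> (\<exists>b'. smooth_on ?J (b n \<epsilon>) \<and>
     (\<forall>\<tau>\<in>?J. z (Suc n) \<epsilon> (\<tau> - 1) \<in> chart_map (c (Suc n)) ` (chart_dom (c (Suc n)) \<inter> chart_dom (c n)) \<and>
       (b n \<epsilon> has_vector_derivative b' \<tau>) (at \<tau>) \<and> b' \<tau> \<noteq> 0 \<and> ?N n (b n \<epsilon> \<tau> - (x n + w n)) < \<delta> n / 2 \<and>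
       ?N n (b' \<tau>) \<le> ?N n (w n) \<and> (DIM('e) = 1 \<longrightarrow> B n (b' \<tau>) (w n) > 0)))" for n
  proof -
    have dir: "B n (transition_deriv (c (Suc n)) (c n) (P (Suc n)) (w (Suc n))) (w n) > 0" if "DIM('e) = 1"
    proof -
      have "B n (transition_deriv (c (Suc n)) (c n) (P (Suc n)) (w (Suc n)))
         (chart_map (c n) (P (Suc n)) - chart_map (c n) (P n)) > 0"
      proof (rule one_dimensional_direction[OF that gc_in(1) gc_in(1) gc_in(2) gc_in(2) PD(1) PD(2) PD(3) PD(1)])
        show "P (Suc n) \<noteq> P n" using P_neq[of n] by simp
        show "B (Suc n) (chart_map (c (Suc n)) (P (Suc n)) - chart_map (c (Suc n)) (P n)) (w (Suc n)) > 0"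
          using turn[of n] by (simp add: w_def x_def)
        fix s :: real assume s: "0 \<le> s" "s \<le> 1"
        let ?y = "chart_map (c (Suc n)) (P (Suc n))" and ?v = "chart_map (c (Suc n)) (P n) - chart_map (c (Suc n)) (P (Suc n))"
        have "?y + s *\<^sub>R ?v = (1 - s) *\<^sub>R ?y + s *\<^sub>R chart_map (c (Suc n)) (P n)" by (simp add: algebra_simps)
        then have inV: "?y + s *\<^sub>R ?v \<in> V (Suc n)"
          using convexD_alt[OF gc_in(4) PV(1)[of "Suc n"] PV(3)[of n] s] by (simp add: x_def)
        let ?q = "chart_inv (c (Suc n)) (?y + s *\<^sub>R ?v)"
        \<comment> \<open>Two distortion factors applied to r n / 8 give 121/800 r n, and a further
          r n / 8 leads back to \<open>P n\<close>: the segment stays in the ball belonging to the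
          chart of \<open>P n\<close>.\<close>
        have "d (P (Suc n)) ?q \<le> 11/10 * ?N (Suc n) (s *\<^sub>R ?v)"
          using good_chart_upper[OF gc PV(1)[of "Suc n"] inV] chart_inv_map[OF gc_in(1) PD(1)[of "Suc n"]] by (simp add: x_def)
        also have "\<dots> \<le> 11/10 * (1 * ?N (Suc n) ?v)"
          unfolding form_norm_scale[OF gc_in(2)]
          using s form_norm_nonneg[OF gc_in(2)] by (intro mult_left_mono mult_right_mono) auto
        also have "\<dots> \<le> 11/10 * (11/10 * (r n / 8))"
          using good_chart_lower[OF gc near(1)[of "Suc n"] near(3)[of n]] dP[of n] d_sym[of "P (Suc n)" "P n"] by simp
        finally have "d (P (Suc n)) ?q \<le> 121/800 * r n" by simp
        then have "d (P n) ?q < r n"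
          using d_triangle[of "P n" ?q "P (Suc n)"] dP[of n] r[of n] by linarith
        then have "?q \<in> chart_dom (c n)" using good_chart_ball[OF gc] by blast
        moreover have "?y + s *\<^sub>R ?v \<in> chart_map (c (Suc n)) ` chart_dom (c (Suc n))" using inV gc_in(5) by blast
        ultimately show "?y + s *\<^sub>R ?v \<in> chart_map (c (Suc n)) ` (chart_dom (c (Suc n)) \<inter> chart_dom (c n))"
          using chart_map_inv[OF gc_in(1)] chart_inv_dom[OF gc_in(1)] by (intro image_eqI[of _ _ ?q]) auto
      qed
      then show ?thesis by (simp add: w_def x_def)
    qed
    have y: "chart_map (c n) (P (Suc n)) = x n + w n" by (simp add: w_def)
    show ?thesis
      using incoming_germ[OF gc_in(1) gc_in(1) PD(1) PD(2) w0[of "Suc n"] gc_in(2)[of n] half_gt_zero[OF \<delta>(1)[of n]] Nw(1)[of n] dir]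
      unfolding y z_def b_def[abs_def] x_def[of "Suc n"] .
  qed
  then obtain ei where ei: "\<And>n. ei n > 0" and ei': "\<And>n \<epsilon>. 0 < \<epsilon> \<Longrightarrow> \<epsilon> \<le> ei n \<Longrightarrow> (\<exists>b'. smooth_on ?J (b n \<epsilon>) \<and>
     (\<forall>\<tau>\<in>?J. z (Suc n) \<epsilon> (\<tau> - 1) \<in> chart_map (c (Suc n)) ` (chart_dom (c (Suc n)) \<inter> chart_dom (c n)) \<and>
       (b n \<epsilon> has_vector_derivative b' \<tau>) (at \<tau>) \<and> b' \<tau> \<noteq> 0 \<and> ?N n (b n \<epsilon> \<tau> - (x n + w n)) < \<delta> n / 2 \<and>
       ?N n (b' \<tau>) \<le> ?N n (w n) \<and> (DIM('e) = 1 \<longrightarrow> B n (b' \<tau>) (w n) > 0)))" by metis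
  define eo where "eo n = min 1 (\<delta> n / (4 * ?N n (w n)))" for n
  have eo: "eo n > 0" "eo n \<le> 1" "eo n * ?N n (w n) < \<delta> n / 2" for n
  proof -
    show "eo n > 0" "eo n \<le> 1" using \<delta>(1)[of n] Nw(1)[of n] by (auto simp: eo_def)
    have "eo n * ?N n (w n) \<le> \<delta> n / (4 * ?N n (w n)) * ?N n (w n)"
      using Nw(1)[of n] by (intro mult_right_mono) (auto simp: eo_def)
    also have "\<dots> = \<delta> n / 4" using Nw(1)[of n] by simp
    finally show "eo n * ?N n (w n) < \<delta> n / 2" using \<delta>(1)[of n] by simp
  qed
  \<comment> \<open>Two bounds: \<open>eo\<close> for the germ in its own chart, and
    \<open>ei\<close> of the predecessor for its image in the preceding chart. The first point has
    no predecessor.\<close>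
  define \<epsilon> where "\<epsilon> n = (case n of 0 \<Rightarrow> eo 0 | Suc k \<Rightarrow> min (eo (Suc k)) (ei k))" for n
  have \<epsilon>: "\<epsilon> n > 0" "\<epsilon> n \<le> eo n" "\<epsilon> (Suc n) \<le> ei n" for n
    using eo(1) ei by (auto simp: \<epsilon>_def split: nat.split)
  have \<epsilon>N: "\<epsilon> n \<le> 1" "\<epsilon> n * ?N n (w n) < \<delta> n / 2" for n
    using \<epsilon>(2)[of n] eo(2,3)[of n] mult_right_mono[OF \<epsilon>(2)[of n] less_imp_le[OF Nw(1)[of n]]] by linarith+
  have "\<exists>\<beta> \<beta>'. smooth_on ?J \<beta> \<and> (\<forall>\<tau>\<in>?J. (\<beta> has_vector_derivative \<beta>' \<tau>) (at \<tau>) \<and> \<beta>' \<tau> \<noteq> 0) \<and>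
    (\<forall>\<tau>. \<tau> \<le> 1/4 \<longrightarrow> \<beta> \<tau> = x n + (\<epsilon> n * \<tau>) *\<^sub>R w n) \<and> (\<forall>\<tau>. \<tau> \<ge> 3/4 \<longrightarrow> \<beta> \<tau> = b n (\<epsilon> (Suc n)) \<tau>) \<and>
    (\<forall>\<tau>\<in>{0..1}. \<beta> \<tau> \<in> V n \<and> ?N n (\<beta>' \<tau>) \<le> (2 * C + 4) * ?N n (w n))" for n
  proof -
    obtain b' where b': "smooth_on ?J (b n (\<epsilon> (Suc n)))"
     "\<forall>\<tau>\<in>?J. z (Suc n) (\<epsilon> (Suc n)) (\<tau> - 1) \<in> chart_map (c (Suc n)) ` (chart_dom (c (Suc n)) \<inter> chart_dom (c n)) \<and>
       (b n (\<epsilon> (Suc n)) has_vector_derivative b' \<tau>) (at \<tau>) \<and> b' \<tau> \<noteq> 0 \<and> ?N n (b n (\<epsilon> (Suc n)) \<tau> - (x n + w n)) < \<delta> n / 2 \<and>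
       ?N n (b' \<tau>) \<le> ?N n (w n) \<and> (DIM('e) = 1 \<longrightarrow> B n (b' \<tau>) (w n) > 0)"
      using ei'[OF \<epsilon>(1)[of "Suc n"] \<epsilon>(3)[of n]] by blast
    show ?thesis
      by (rule smooth_blend[where b' = b', OF gc_in(2) gc_in(4) w0 _ _ b'(1) _ _ \<delta>(1) \<delta>(2) \<delta>(3) \<delta>(4) \<epsilon>(1) \<epsilon>N(1) \<epsilon>N(2) _ _ _ C])
         (use b'(2) in auto)
  qed
  then obtain \<beta> \<beta>' where \<beta>_smooth: "\<And>n. smooth_on ?J (\<beta> n)"
    and \<beta>': "\<And>n \<tau>. \<tau> \<in> ?J \<Longrightarrow> (\<beta> n has_vector_derivative \<beta>' n \<tau>) (at \<tau>) \<and> \<beta>' n \<tau> \<noteq> 0"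
    and \<beta>_early: "\<And>n \<tau>. \<tau> \<le> 1/4 \<Longrightarrow> \<beta> n \<tau> = z n (\<epsilon> n) \<tau>"
    and \<beta>_late: "\<And>n \<tau>. \<tau> \<ge> 3/4 \<Longrightarrow> \<beta> n \<tau> = b n (\<epsilon> (Suc n)) \<tau>"
    and \<beta>V: "\<And>n \<tau>. \<tau> \<in> {0..1} \<Longrightarrow> \<beta> n \<tau> \<in> V n"
    and \<beta>'_le: "\<And>n \<tau>. \<tau> \<in> {0..1} \<Longrightarrow> ?N n (\<beta>' n \<tau>) \<le> (2 * C + 4) * ?N n (w n)"
    unfolding z_def by metis
  have z_overlap: "z (Suc n) (\<epsilon> (Suc n)) s \<in> chart_map (c (Suc n)) ` (chart_dom (c (Suc n)) \<inter> chart_dom (c n))"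
    if "-2 < s" "s < 1" for n s
  proof -
    have "s + 1 \<in> ?J" using that by simp
    then have "z (Suc n) (\<epsilon> (Suc n)) ((s + 1) - 1) \<in> chart_map (c (Suc n)) ` (chart_dom (c (Suc n)) \<inter> chart_dom (c n))"
      using ei'[OF \<epsilon>(1)[of "Suc n"] \<epsilon>(3)[of n]] by blast
    then show ?thesis by simp
  qed
  define \<gamma> where "\<gamma> t = chart_inv (c (nat \<lfloor>t\<rfloor>)) (\<beta> (nat \<lfloor>t\<rfloor>) (t - real (nat \<lfloor>t\<rfloor>)))" for t
  have floor: "nat \<lfloor>t\<rfloor> = n" if "real n \<le> t" "t < real n + 1" for n t
    using that by (simp add: floor_eq_iff nat_eq_iff)
  have \<gamma>: "\<gamma> t = chart_inv (c n) (\<beta> n (t - real n))" if "real n \<le> t" "t < real n + 1" for n t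
    by (simp add: \<gamma>_def floor[OF that])
  have inD: "\<beta> n \<tau> \<in> chart_map (c n) ` chart_dom (c n)" if "\<tau> \<in> {0..1}" for n \<tau>
    using \<beta>V[OF that] gc_in(5) by blast
  have th: "thick {0::real..}" by (rule thick_atLeast)
  \<comment> \<open>11/10 from comparing \<open>G\<close> with \<open>B n\<close>, 2 C + 4 from the
    blend, and 11/80 from the norm of \<open>w n\<close>, which is at most 11/10 of r n / 8.\<close>
  define Kc where "Kc = 11/10 * ((2 * C + 4) * (11/80))"
  have Kc: "Kc > 0" using C(1) by (simp add: Kc_def)
  have G_le: "form_norm (G (c n) y) u \<le> Kc * r n" if "y \<in> V n" "?N n u \<le> (2 * C + 4) * ?N n (w n)" for n y u
  proof -
    have "form_norm (G (c n) y) u \<le> 11/10 * ?N n u" using gc[of n] that(1) unfolding good_chart_def by blast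
    also have "\<dots> \<le> 11/10 * ((2 * C + 4) * (11/80 * r n))"
      by (intro mult_left_mono order_trans[OF that(2)] Nw(2)) (use C(1) in auto)
    also have "\<dots> = Kc * r n" by (simp only: Kc_def mult.assoc)
    finally show ?thesis .
  qed
  have local: "\<exists>c\<in>\<A>. \<exists>U \<beta>1 h. open U \<and> t \<in> U \<and> smooth_on ({0..} \<inter> U) \<beta>1 \<and>
      (\<forall>s\<in>{0..} \<inter> U. \<beta>1 s \<in> chart_map c ` chart_dom c \<and> \<gamma> s = chart_inv c (\<beta>1 s)) \<and>
      (\<beta>1 has_vector_derivative h) (at t within {0..}) \<and> h \<noteq> 0 \<and> form_norm (G c (\<beta>1 t)) h \<le> Kc * r n"
    if t: "real n \<le> t" "t < real n + 1" for n t
  proof (cases "t = real n")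
    case False
    then have t': "real n < t" using t(1) by simp
    let ?U = "{real n<..<real n + 1}"
    have thU: "thick ({0..} \<inter> ?U)" by (rule thick_Int_open[OF th]) simp
    have "smooth_on ({0..} \<inter> ?U) (\<lambda>s. \<beta> n (s - real n))"
    proof (rule smooth_on_compose[OF \<beta>_smooth _ thU])
      show "smooth_on ({0..} \<inter> ?U) (\<lambda>s. s - real n)" by (intro smooth_on_diff smooth_on_ident smooth_on_const thU)
    qed (auto simp: thick_open)
    moreover have "((\<lambda>s. \<beta> n (s - real n)) has_vector_derivative \<beta>' n (t - real n)) (at t)"
    proof -
      have 1: "((\<lambda>s. s - real n) has_vector_derivative 1) (at t)"
        by (auto intro!: derivative_eq_intros)
      have 2: "(\<beta> n has_vector_derivative \<beta>' n (t - real n)) (at (t - real n))" using \<beta>' t by simp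
      show ?thesis using vector_diff_chain_at[of "\<lambda>s. s - real n" 1 t "\<beta> n"] 1 2 by (simp add: o_def)
    qed
    then have "((\<lambda>s. \<beta> n (s - real n)) has_vector_derivative \<beta>' n (t - real n)) (at t within {0..})"
      by (rule has_vector_derivative_at_within)
    moreover have "\<beta>' n (t - real n) \<noteq> 0" using \<beta>' t by simp
    moreover have "form_norm (G (c n) (\<beta> n (t - real n))) (\<beta>' n (t - real n)) \<le> Kc * r n"
      using G_le[OF \<beta>V \<beta>'_le] t by simp
    moreover have "\<forall>s\<in>{0..} \<inter> ?U. \<beta> n (s - real n) \<in> chart_map (c n) ` chart_dom (c n) \<and> \<gamma> s = chart_inv (c n) (\<beta> n (s - real n))"
      using inD \<gamma> by simp
    ultimately show ?thesis
      using t t' by (intro bexI[OF _ gc_in(1)[of n]] exI[of _ ?U] exI[of _ "\<lambda>s. \<beta> n (s - real n)"] exI[of _ "\<beta>' n (t - real n)"]) auto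
  next
    case True
    \<comment> \<open>At an integer the representative is the straight germ in the chart of
      \<open>P n\<close>: to the right \<open>\<beta> n\<close> equals it up to 1/4, and to the left
      the preceding link is its image in the preceding chart from 3/4 on.\<close>
    let ?U = "{real n - 1/4<..<real n + 1/4}"
    define l where "l s = z n (\<epsilon> n) (s - real n)" for s
    have thU: "thick ({0..} \<inter> ?U)" by (rule thick_Int_open[OF th]) simp
    have "smooth_on ({0..} \<inter> ?U) l"
      unfolding l_def[abs_def] z_def
      by (intro smooth_on_add smooth_on_scaleR smooth_on_mult smooth_on_diff smooth_on_const smooth_on_ident thU)
    moreover have "(l has_vector_derivative \<epsilon> n *\<^sub>R w n) (at t within {0..})"
      unfolding l_def[abs_def] z_def by (auto intro!: derivative_eq_intros simp flip: has_real_derivative_iff_has_vector_derivative)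
    moreover have "\<epsilon> n *\<^sub>R w n \<noteq> 0" using w0[of n] \<epsilon>(1)[of n] by simp
    moreover have "form_norm (G (c n) (l t)) (\<epsilon> n *\<^sub>R w n) \<le> Kc * r n"
    proof (rule G_le)
      show "l t \<in> V n" using PV(1) by (simp add: l_def z_def True)
      have "?N n (\<epsilon> n *\<^sub>R w n) \<le> 1 * ?N n (w n)"
        unfolding form_norm_scale[OF gc_in(2)] using \<epsilon>(1)[of n] \<epsilon>N(1)[of n] Nw(1)[of n] by (intro mult_right_mono) auto
      also have "\<dots> \<le> (2 * C + 4) * ?N n (w n)" using C(1) Nw(1)[of n] by (intro mult_right_mono) auto
      finally show "?N n (\<epsilon> n *\<^sub>R w n) \<le> (2 * C + 4) * ?N n (w n)" .
    qed
    moreover have "l s \<in> chart_map (c n) ` chart_dom (c n) \<and> \<gamma> s = chart_inv (c n) (l s)" if s: "s \<in> {0..} \<inter> ?U" for s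
    proof (cases "real n \<le> s")
      case True
      have "l s = \<beta> n (s - real n)" unfolding l_def using s by (intro \<beta>_early[symmetric]) auto
      then show ?thesis using inD[of "s - real n" n] \<gamma>[of n s] True s by simp
    next
      case False
      \<comment> \<open>There is no link to the left of 0: membership of \<open>s\<close> in {0..}
        excludes \<open>n = 0\<close>.\<close>
      then obtain k where k: "n = Suc k" using s by (cases n) auto
      have zo: "l s \<in> chart_map (c n) ` (chart_dom (c n) \<inter> chart_dom (c k))"
        unfolding l_def k by (rule z_overlap) (use s False k in auto)
      then have q: "chart_inv (c n) (l s) \<in> chart_dom (c k)"
        using chart_inv_map[OF gc_in(1)] by auto
      have "\<gamma> s = chart_inv (c k) (\<beta> k (s - real k))" by (rule \<gamma>) (use s False k in auto)
      also have "\<beta> k (s - real k) = b k (\<epsilon> n) (s - real k)" unfolding k by (rule \<beta>_late) (use s k in auto)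
      also have "\<dots> = chart_map (c k) (chart_inv (c n) (l s))" by (simp add: b_def l_def k algebra_simps)
      finally have "\<gamma> s = chart_inv (c n) (l s)" using chart_inv_map[OF gc_in(1) q] by simp
      then show ?thesis using zo by blast
    qed
    ultimately show ?thesis
      using True by (intro bexI[OF _ gc_in(1)[of n]] exI[of _ ?U] exI[of _ l] exI[of _ "\<epsilon> n *\<^sub>R w n"]) auto
  qed
  have idx: "\<exists>n. real n \<le> t \<and> t < real n + 1" if "0 \<le> t" for t
    using that by (intro exI[of _ "nat \<lfloor>t\<rfloor>"]) linarith
  have reg: "regular_curve \<A> {0..} \<gamma>"
    unfolding regular_curve_iff[OF th]
  proof
    fix t :: real assume t: "t \<in> {0..}"
    then obtain n where "real n \<le> t" "t < real n + 1" using idx by auto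
    from local[OF this] show "regular_at {0..} \<gamma> t" using regular_atI[OF th t] by (metis Int_iff)
  qed
  show ?thesis
  proof (rule that[OF reg _ escape sm_r r Kc])
    show "\<gamma> (real n) = P n" for n
    proof -
      have "\<gamma> (real n) = chart_inv (c n) (\<beta> n 0)" using \<gamma>[of n "real n"] by simp
      also have "\<beta> n 0 = x n" using \<beta>_early[of 0 n] by (simp add: z_def)
      finally show ?thesis using chart_inv_map[OF gc_in(1) PD(1)] by (simp add: x_def)
    qed
    fix n t assume t: "real n \<le> t" "t < real n + 1"
    then have t0: "t \<in> {0..}" by simp
    obtain c' U \<beta>1 h where c': "c' \<in> \<A>" "open U" "t \<in> U"
      "\<forall>s\<in>{0..} \<inter> U. \<beta>1 s \<in> chart_map c' ` chart_dom c' \<and> \<gamma> s = chart_inv c' (\<beta>1 s)"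
      "(\<beta>1 has_vector_derivative h) (at t within {0..})" "form_norm (G c' (\<beta>1 t)) h \<le> Kc * r n"
      using local[OF t] by blast
    have "speed \<A> g {0..} \<gamma> t = form_norm (G c' (\<beta>1 t)) h"
      by (rule regular_curve_speed[OF reg th t0 c'(1-3) _ c'(5)]) (use c'(4) in blast)
    then show "speed \<A> g {0..} \<gamma> t \<le> Kc * r n" using c'(6) by simp
  qed
qed

end

section \<open>Conformal change of the metric\<close>

context cont_metric
begin

text \<open>Substitution by arc length \<sigma>: the integrand is the derivative of
  \<open>\<Phi> (\<sigma> t)\<close> except at finitely many times, where continuity
  suffices.\<close>

lemma length_FTC:
  assumes p: "pw a b \<gamma>" and \<Phi>: "\<And>s. 0 \<le> s \<Longrightarrow> (\<Phi> has_real_derivative \<Phi>' s) (at s)"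
  shows "((\<lambda>t. \<Phi>' (integral {a..t} (sp \<gamma>)) * sp \<gamma> t) has_integral \<Phi> (integral {a..b} (sp \<gamma>)) - \<Phi> 0) {a..b}"
proof -
  define \<sigma> where "\<sigma> t = integral {a..t} (sp \<gamma>)" for t
  obtain F where F: "finite F" "\<forall>t\<in>{a<..<b} - F. nice_at \<gamma> t" using pw_nice(3)[OF p] by blast
  have \<sigma>_nonneg: "\<sigma> t \<ge> 0" if "t \<in> {a..b}" for t
    unfolding \<sigma>_def using pw_integral_nonneg pw_split[OF p, of t] that by auto
  have int: "sp \<gamma> integrable_on {a..b}" by (rule pw_nice(2)[OF p])
  have cont: "continuous_on {a..b} (\<lambda>t. \<Phi> (\<sigma> t))"
  proof (rule continuous_on_compose2[of "{0..}" \<Phi>])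
    show "continuous_on {0..} \<Phi>"
      using \<Phi> by (intro continuous_at_imp_continuous_on ballI DERIV_isCont) auto
    show "continuous_on {a..b} \<sigma>" unfolding \<sigma>_def by (rule indefinite_integral_continuous_1[OF int])
  qed (use \<sigma>_nonneg in auto)
  have der: "((\<lambda>t. \<Phi> (\<sigma> t)) has_vector_derivative \<Phi>' (\<sigma> t) * sp \<gamma> t) (at t)" if t: "t \<in> {a<..<b} - F" for t
  proof -
    have "isCont (sp \<gamma>) t" using F(2) t unfolding nice_at_def by blast
    then have "((\<lambda>u. integral {a..u} (sp \<gamma>)) has_vector_derivative sp \<gamma> t) (at t within {a..b})"
      using integral_has_vector_derivative_continuous_at[OF int, of t "{}"] t
      by (auto intro: continuous_at_imp_continuous_at_within)
    then have d\<sigma>: "(\<sigma> has_real_derivative sp \<gamma> t) (at t)"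
      using t at_within_Icc_at[of a t b] unfolding \<sigma>_def[abs_def] has_real_derivative_iff_has_vector_derivative by simp
    have d\<Phi>: "(\<Phi> has_real_derivative \<Phi>' (\<sigma> t)) (at (\<sigma> t))" using \<Phi>[OF \<sigma>_nonneg[of t]] t by simp
    show ?thesis
      unfolding has_real_derivative_iff_has_vector_derivative[symmetric]
      by (rule DERIV_chain2[where f = \<Phi> and g = \<sigma>, OF d\<Phi> d\<sigma>])
  qed
  have "((\<lambda>t. \<Phi>' (\<sigma> t) * sp \<gamma> t) has_integral \<Phi> (\<sigma> b) - \<Phi> (\<sigma> a)) {a..b}"
    by (rule fundamental_theorem_of_calculus_interior_strong[OF F(1) pw_le[OF p] der cont])
  then show ?thesis by (simp add: \<sigma>_def)
qed

lemma nice_integral_mono: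
  assumes p: "pw a b \<gamma>" and "(f has_integral I) {a..b}" "(h has_integral J) {a..b}"
    and le: "\<And>t. a < t \<Longrightarrow> t < b \<Longrightarrow> nice_at \<gamma> t \<Longrightarrow> f t \<le> (h t :: real)"
  shows "I \<le> J"
proof -
  obtain F where F: "finite F" "\<forall>t\<in>{a<..<b} - F. nice_at \<gamma> t" using pw_nice(3)[OF p] by blast
  define f' where "f' t = (if t \<in> {a, b} \<union> F then h t else f t)" for t
  have "(f' has_integral I) {a..b}"
    by (rule has_integral_spike_finite[OF _ _ assms(2), of "{a, b} \<union> F"]) (use F(1) in \<open>auto simp: f'_def\<close>)
  moreover have "f' t \<le> h t" if "t \<in> {a..b}" for t
    using that le[of t] F(2) by (auto simp: f'_def)
  ultimately show ?thesis using has_integral_le assms(3) by blast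
qed

end

lemma riemannian_imp_cont_metric:
  assumes "smooth_atlas \<A>" "connected (UNIV :: 'a set)" "riemannian_metric \<A> g"
  shows "cont_metric (\<A> :: ('a::{t2_space,second_countable_topology}, 'e::euclidean_space) chart set) g"
  using assms unfolding riemannian_metric_def
  by unfold_locales (blast intro: smooth_on_imp_continuous_on)+

locale conformal = cont_metric +
  fixes A :: "'a \<Rightarrow> real"
  assumes smooth_A: "smooth_function \<A> A" and A_pos: "\<And>x. A x > 0"
begin

lemma A_neq_0: "A x \<noteq> 0"
  using A_pos[of x] by simp

abbreviation g' where "g' \<equiv> conformal_metric g A"

sublocale conf: cont_metric \<A> g'
proof unfold_locales
  fix c :: "('a, 'b) chart" and u w assume c: "c \<in> \<A>"
  have "continuous_on (chart_map c ` chart_dom c) (A \<circ> chart_inv c)"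
    using smooth_A c unfolding smooth_function_def by (blast intro: smooth_on_imp_continuous_on)
  then have "continuous_on (chart_map c ` chart_dom c) (\<lambda>x. A (chart_inv c x))" by (simp add: o_def)
  then show "continuous_on (chart_map c ` chart_dom c)
    (\<lambda>x. g' (chart_inv c x) (toc c (chart_inv c x) u) (toc c (chart_inv c x) w))"
    unfolding conformal_metric_def using A_pos
    by (intro continuous_on_divide continuous_on_power g_cont[OF c]) (auto simp: A_neq_0)
qed (use connected g_sym g_linear g_pos in
    \<open>auto simp: conformal_metric_def add_divide_distrib A_neq_0 intro!: divide_pos_pos\<close>)

lemma conformal_speed: "speed \<A> g' I \<gamma> t = speed \<A> g I \<gamma> t / A (\<gamma> t)"
  using A_pos[of "\<gamma> t"] by (simp add: speed_def conformal_metric_def real_sqrt_divide)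

lemma conformal_sp: "conf.sp \<gamma> t = sp \<gamma> t / A (\<gamma> t)"
  by (simp add: sp_def conf.sp_def conformal_speed)

lemma conformal_length: "pw a b \<gamma> \<Longrightarrow> ((\<lambda>t. sp \<gamma> t / A (\<gamma> t)) has_integral integral {a..b} (conf.sp \<gamma>)) {a..b}"
  unfolding conformal_sp[symmetric] by (rule integrable_integral[OF conf.pw_nice(2)])

subsection \<open>At most linear growth\<close>

text \<open>A Gronwall estimate: at \<open>g\<close>-length \<sigma> the value of \<open>A\<close>
  is at most \<open>q \<sigma>\<close>, so the derivative c1 / q of ln q is at most c1 / A.
  Integrating bounds the growth of ln q by \<open>c1\<close> times the length with respect to
  \<open>g'\<close>.\<close>

lemma linear_growth_length:
  assumes c: "c1 > 0" "c2 > 0" "\<And>x. A x \<le> c1 * d x0 x + c2" and p: "pw a b \<gamma>"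
  shows "c1 * d x0 (\<gamma> b) + c2 \<le> (c1 * d x0 (\<gamma> a) + c2) * exp (c1 * integral {a..b} (conf.sp \<gamma>))"
proof -
  define D where "D = d x0 (\<gamma> a)"
  define q where "q s = c1 * (D + s) + c2" for s
  have D: "D \<ge> 0" by (simp add: D_def d_nonneg)
  have q: "q s > 0" if "s \<ge> 0" for s using c D that by (simp add: q_def add_nonneg_pos)
  let ?\<sigma> = "\<lambda>t. integral {a..t} (sp \<gamma>)"
  have \<sigma>: "?\<sigma> t \<ge> 0" "d (\<gamma> a) (\<gamma> t) \<le> ?\<sigma> t" if "a \<le> t" "t \<le> b" for t
    using pw_integral_nonneg pw_split[OF p that] d_curve[OF p _ that] by auto
  have le_q: "c1 * d x0 (\<gamma> t) + c2 \<le> q (?\<sigma> t)" if "a \<le> t" "t \<le> b" for t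
    using \<sigma>(2)[OF that] d_triangle[of x0 "\<gamma> t" "\<gamma> a"] c(1) by (simp add: q_def D_def)
  have "((\<lambda>s. ln (q s)) has_real_derivative c1 / q s) (at s)" if "0 \<le> s" for s
    using q[OF that] unfolding q_def by (auto intro!: derivative_eq_intros)
  from length_FTC[OF p this]
  have "((\<lambda>t. c1 / q (?\<sigma> t) * sp \<gamma> t) has_integral ln (q (?\<sigma> b)) - ln (q 0)) {a..b}" .
  moreover have "((\<lambda>t. c1 * (sp \<gamma> t / A (\<gamma> t))) has_integral c1 * integral {a..b} (conf.sp \<gamma>)) {a..b}"
    by (rule has_integral_mult_right[OF conformal_length[OF p]])
  ultimately have "ln (q (?\<sigma> b)) - ln (q 0) \<le> c1 * integral {a..b} (conf.sp \<gamma>)"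
  proof (rule nice_integral_mono[OF p])
    fix t assume t: "a < t" "t < b" and n: "nice_at \<gamma> t"
    have "A (\<gamma> t) \<le> q (?\<sigma> t)" using c(3)[of "\<gamma> t"] le_q[of t] t by simp
    then have "c1 / q (?\<sigma> t) \<le> c1 / A (\<gamma> t)" using c(1) A_pos[of "\<gamma> t"] by (intro divide_left_mono) auto
    then have "c1 / q (?\<sigma> t) * sp \<gamma> t \<le> c1 / A (\<gamma> t) * sp \<gamma> t" by (rule mult_right_mono[OF _ sp_nonneg[OF n]])
    then show "c1 / q (?\<sigma> t) * sp \<gamma> t \<le> c1 * (sp \<gamma> t / A (\<gamma> t))" by simp
  qed
  then have "exp (ln (q (?\<sigma> b))) \<le> exp (ln (q 0) + c1 * integral {a..b} (conf.sp \<gamma>))" by simp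
  then have "q (?\<sigma> b) \<le> q 0 * exp (c1 * integral {a..b} (conf.sp \<gamma>))"
    using q[of 0] q[OF \<sigma>(1)[of b]] pw_le[OF p] by (simp add: exp_add)
  then show ?thesis using le_q[of b] pw_le[OF p] by (simp add: q_def D_def)
qed

theorem linear_growth_complete:
  assumes "complete_metric \<A> g" "grows_at_most_linearly \<A> g A"
  shows "complete_metric \<A> g'"
proof (rule conf.complete_if_unit_balls_precompact)
  fix p
  \<comment> \<open>The growth condition holds from every base point; taking \<open>p\<close> itself
    makes the initial distance 0.\<close>
  obtain c1 c2 where c: "c1 > 0" "c2 > 0" "\<And>x. A x \<le> c1 * d p x + c2"
    using assms(2) unfolding grows_at_most_linearly_def by blast
  have "d p q \<le> c2 * exp c1 / c1" if less: "conf.d p q < 1" for q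
  proof -
    obtain a b \<gamma> where \<gamma>: "pw a b \<gamma>" "\<gamma> a = p" "\<gamma> b = q" "integral {a..b} (conf.sp \<gamma>) < 1"
      using conf.d_less_curve[OF less] .
    have "c1 * d p q + c2 \<le> c2 * exp (c1 * integral {a..b} (conf.sp \<gamma>))"
      using linear_growth_length[OF c \<gamma>(1)] \<gamma>(2,3) by (simp add: d_refl)
    also have "\<dots> \<le> c2 * exp (c1 * 1)" using c \<gamma>(4) by simp
    finally have "c1 * d p q \<le> c2 * exp c1" using c(2) by simp
    then show ?thesis using c(1) by (simp add: field_simps)
  qed
  then show "\<exists>C. compact C \<and> (\<forall>q. conf.d p q < 1 \<longrightarrow> q \<in> C)"
    using complete_imp_compact_cb[OF assms(1), of p "c2 * exp c1 / c1"] in_cb by blast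
qed

subsection \<open>Superlinear growth\<close>

lemma superlinear_growth_bounded:
  assumes "grows_superlinearly \<A> g A"
  shows "bounded_metric \<A> g'"
proof -
  obtain x0 :: 'a where True by blast
  obtain e c1 c2 where c: "e > 0" "c1 > 0" "c2 > 0" "\<And>x. A x \<ge> c1 * d x0 x powr (1 + e) + c2"
    using assms unfolding grows_superlinearly_def by blast
  \<comment> \<open>For s \<ge> 3 one has s - 1 \<ge> (1 + s) / 2, and for s < 3 the base (1 + s) /
    4 is at most 1; each case uses one of the two constants.\<close>
  define k where "k = min (c1 / 2 powr (1 + e)) (c2 / 4 powr (1 + e))"
  have k: "k > 0" using c by (simp add: k_def)
  have lower: "k * (1 + s) powr (1 + e) \<le> A x" if s: "s \<ge> 0" "d x0 x \<ge> s - 1" for s x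
  proof (cases "s \<ge> 3")
    case True
    have "k * (1 + s) powr (1 + e) \<le> c1 / 2 powr (1 + e) * (1 + s) powr (1 + e)"
      by (intro mult_right_mono) (auto simp: k_def)
    also have "\<dots> = c1 * ((1 + s) / 2) powr (1 + e)" using s by (simp add: powr_divide)
    also have "\<dots> \<le> c1 * d x0 x powr (1 + e)"
      using c(1,2) s True by (intro mult_left_mono powr_mono2) auto
    finally show ?thesis using c(4)[of x] c(3) by simp
  next
    case False
    have "k * (1 + s) powr (1 + e) \<le> c2 / 4 powr (1 + e) * (1 + s) powr (1 + e)"
      by (intro mult_right_mono) (auto simp: k_def)
    also have "\<dots> = c2 * ((1 + s) / 4) powr (1 + e)" using s by (simp add: powr_divide)
    also have "\<dots> \<le> c2 * 1" using c(1,3) s False by (intro mult_left_mono powr_le1) auto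
    also have "\<dots> \<le> A x"
      using c(4)[of x] mult_nonneg_nonneg[OF less_imp_le[OF c(2)] powr_ge_zero[of "d x0 x" "1 + e"]] by linarith
    finally show ?thesis .
  qed
  have bound: "conf.d x0 x \<le> 1 / (k * e)" for x
  proof -
    \<comment> \<open>Almost shortest with excess 1, so along the curve the distance from
      \<open>x0\<close> falls behind the arc length by at most 1.\<close>
    obtain a b \<gamma> where p: "pw a b \<gamma>" and \<gamma>: "\<gamma> a = x0" "\<gamma> b = x" "integral {a..b} (sp \<gamma>) < d x0 x + 1"
      using d_less_curve[of x0 x "d x0 x + 1"] by auto
    let ?\<sigma> = "\<lambda>t. integral {a..t} (sp \<gamma>)"
    \<comment> \<open>An antiderivative of (1 + s) powr (- e - 1) / k that is negative and starts at
      - 1 / (k e), so its total increase is at most 1 / (k e).\<close>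
    define \<Phi> where "\<Phi> s = - 1 / (k * e) * (1 + s) powr (- e)" for s
    have "(\<Phi> has_real_derivative (1 + s) powr (- e - 1) / k) (at s)" if "0 \<le> s" for s
    proof -
      have "((\<lambda>s. 1 + s) has_real_derivative 1) (at s)" by (auto intro!: derivative_eq_intros)
      moreover have "1 + s > 0" using that by simp
      ultimately have "((\<lambda>s. (1 + s) powr (- e)) has_real_derivative (- e) * (1 + s) powr (- e - 1) * 1) (at s)"
        by (intro DERIV_chain2[where f = "\<lambda>z. z powr (- e)" and g = "\<lambda>s. 1 + s"] has_real_derivative_powr)
      from DERIV_cmult[OF this, of "- 1 / (k * e)"] show ?thesis
        using c(1) by (simp add: \<Phi>_def[abs_def])
    qed
    from length_FTC[OF p this]
    have I: "((\<lambda>t. (1 + ?\<sigma> t) powr (- e - 1) / k * sp \<gamma> t) has_integral \<Phi> (?\<sigma> b) - \<Phi> 0) {a..b}" .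
    have "integral {a..b} (conf.sp \<gamma>) \<le> \<Phi> (?\<sigma> b) - \<Phi> 0"
    proof (rule nice_integral_mono[OF p conformal_length[OF p] I])
      fix t assume t: "a < t" "t < b" and n: "nice_at \<gamma> t"
      have \<sigma>0: "?\<sigma> t \<ge> 0" using pw_integral_nonneg pw_split[OF p, of t] t by simp
      have "d (\<gamma> t) x \<le> integral {t..b} (sp \<gamma>)" using d_curve[OF p, of t b] t \<gamma> by simp
      then have "d x0 (\<gamma> t) \<ge> ?\<sigma> t - 1"
        using d_triangle[of x0 x "\<gamma> t"] pw_integral_combine[OF p, of t] t \<gamma>(3) by simp
      then have "k * (1 + ?\<sigma> t) powr (1 + e) \<le> A (\<gamma> t)" by (rule lower[OF \<sigma>0])
      moreover have pos: "k * (1 + ?\<sigma> t) powr (1 + e) > 0" using k \<sigma>0 by simp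
      ultimately have "sp \<gamma> t / A (\<gamma> t) \<le> sp \<gamma> t / (k * (1 + ?\<sigma> t) powr (1 + e))"
        using sp_nonneg[OF n] A_pos[of "\<gamma> t"] by (intro divide_left_mono) auto
      also have "\<dots> = (1 + ?\<sigma> t) powr (- (1 + e)) / k * sp \<gamma> t"
        unfolding powr_minus_divide[of _ "1 + e"] by simp
      finally show "sp \<gamma> t / A (\<gamma> t) \<le> (1 + ?\<sigma> t) powr (- e - 1) / k * sp \<gamma> t"
        by (simp only: minus_add_distrib add.commute diff_conv_add_uminus)
    qed
    also have "\<Phi> (?\<sigma> b) - \<Phi> 0 \<le> 1 / (k * e)"
      using k c(1) by (simp add: \<Phi>_def field_simps)
    finally show ?thesis using conf.d_curve[OF p, of a b] pw_le[OF p] \<gamma> by simp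
  qed
  have "conf.d x y \<le> 1 / (k * e) + 1 / (k * e)" for x y
    using order_trans[OF conf.d_triangle[of x y x0] add_mono[OF bound[of x, unfolded conf.d_sym[of x0 x]] bound[of y]]] .
  then show ?thesis unfolding bounded_metric_def by blast
qed

lemma bounded_imp_incomplete:
  assumes "\<not> compact (UNIV :: 'a set)" "bounded_metric \<A> g'"
  shows "\<not> complete_metric \<A> g'"
proof
  assume "complete_metric \<A> g'"
  moreover obtain b where "\<And>x y. conf.d x y \<le> b" using assms(2) unfolding bounded_metric_def by blast
  then have "conf.cb undefined b = UNIV" by (auto simp: conf.in_cb)
  ultimately show False using conf.complete_imp_compact_cb[of undefined b] assms(1) by simp
qed

subsection \<open>Escaping rays\<close>

lemma ray_dom_infinity: "ray_dom \<infinity> = {0..}"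
  by (auto simp: ray_dom_def)

lemma L1_imp_incomplete:
  assumes "L1_on_escaping_curve \<A> g (\<lambda>x. 1 / A x)"
  shows "\<not> complete_metric \<A> g'"
proof
  assume complete: "complete_metric \<A> g'"
  obtain \<gamma> where ray: "escaping_ray \<A> \<infinity> \<gamma>"
    and L1: "(\<integral>\<^sup>+ s\<in>{0..}. ennreal (1 / A (\<gamma> s) * speed \<A> g {0..} \<gamma> s) \<partial>lborel) < \<infinity>"
    using assms unfolding L1_on_escaping_curve_def by blast
  define v where "v = speed \<A> g' {0..} \<gamma>"
  have reg: "regular_curve \<A> {0..} \<gamma>" using ray by (simp add: escaping_ray_def ray_dom_infinity)
  obtain t :: "nat \<Rightarrow> real" and K where tK: "\<forall>n. t n \<in> {0..}" "(\<lambda>n. ereal (t n)) \<longlonglongrightarrow> \<infinity>" "(\<Union>n. K n) = UNIV"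
    "\<forall>n. K n \<subseteq> interior (K (Suc n))" "\<forall>n\<ge>1. \<gamma> (t n) \<in> K n - K (n - 1)"
    using ray unfolding escaping_ray_def ray_dom_infinity by blast
  then have t: "t n \<ge> 0" and K: "K n \<subseteq> interior (K (Suc n))" for n by auto
  have v_cont: "continuous_on {0..} v" unfolding v_def by (rule conf.regular_speed_continuous[OF reg thick_atLeast])
  have v_sp: "v s = conf.sp \<gamma> s" if "s > 0" for s
    unfolding v_def by (rule conf.speed_interior) (use that in simp)
  have v_nonneg: "v s \<ge> 0" if "s \<ge> 0" for s
  proof (cases "s = 0")
    case False
    then show ?thesis using v_sp conf.sp_nonneg[OF conf.regular_nice_at[OF reg thick_atLeast]] that by simp
  next
    case True
    \<comment> \<open>At the end point the one-sided speed need not be \<open>sp\<close>; it is a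
      limit of nonnegative values.\<close>
    have "v 0 \<ge> 0"
    proof (rule tendsto_lowerbound)
      show "(v \<longlongrightarrow> v 0) (at 0 within {0..})" using v_cont unfolding continuous_on_def by simp
      show "eventually (\<lambda>s. 0 \<le> v s) (at 0 within {0..})"
        unfolding eventually_at_filter
        by (rule always_eventually) (use v_sp conf.sp_nonneg[OF conf.regular_nice_at[OF reg thick_atLeast]] in auto)
      show "at 0 within {0::real..} \<noteq> bot" using thick_not_bot[OF thick_atLeast, of 0 0] by simp
    qed
    then show ?thesis using True by simp
  qed
  define F where "F s = integral {0..s} v" for s
  have v_int: "v integrable_on {r..s}" if "0 \<le> r" for r s
    by (rule integrable_continuous_real[OF continuous_on_subset[OF v_cont]]) (use that in auto)
  have F_diff: "integral {r..s} v = F s - F r" if "0 \<le> r" "r \<le> s" for r s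
    using Henstock_Kurzweil_Integration.integral_combine[OF that v_int[of 0 s]] by (simp add: F_def)
  have F_mono: "F r \<le> F s" if "0 \<le> r" "r \<le> s" for r s
    using F_diff[OF that] integral_nonneg[OF v_int[OF that(1), of s]] v_nonneg that by fastforce
  let ?I = "\<integral>\<^sup>+ s\<in>{0..}. ennreal (v s) \<partial>lborel"
  have I: "?I < \<infinity>" using L1 by (simp add: v_def conformal_speed)
  have F_bound: "F s \<le> enn2real ?I" if s: "s \<ge> 0" for s
  proof -
    have si: "set_integrable lborel {0..s} v"
      by (rule borel_integrable_atLeastAtMost'[OF continuous_on_subset[OF v_cont]]) auto
    then have "F s = (LINT u:{0..s}|lborel. v u)" unfolding F_def using set_borel_integral_eq_integral(2) by metis
    also have "\<dots> = (LINT u|lborel. indicator {0..s} u *\<^sub>R v u)" by (simp add: set_lebesgue_integral_def)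
    finally have "ennreal (F s) = (\<integral>\<^sup>+ u. ennreal (indicator {0..s} u *\<^sub>R v u) \<partial>lborel)"
      using nn_integral_eq_integral[OF si[unfolded set_integrable_def]] v_nonneg
      by (simp add: indicator_def)
    also have "\<dots> \<le> ?I"
      by (rule nn_integral_mono) (auto simp: indicator_def)
    finally have "enn2real (ennreal (F s)) \<le> enn2real ?I" using I by (intro enn2real_mono) auto
    moreover have "F s \<ge> 0" using F_mono[of 0 s] s by (simp add: F_def)
    ultimately show ?thesis by simp
  qed
  \<comment> \<open>The supremum of the lengths of initial arcs: once \<open>F T > S - e\<close>,
    every arc beyond \<open>T\<close> is shorter than \<open>e\<close>.\<close>
  define S where "S = Sup (F ` {0..})"
  have bdd: "bdd_above (F ` {0..})" using F_bound by (auto intro!: bdd_aboveI)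
  have dist: "conf.d (\<gamma> r) (\<gamma> s) \<le> F s - F r" if "0 \<le> r" "r \<le> s" for r s
  proof (cases "r = s")
    case False
    then have "r < s" using that by simp
    then have "pw r s \<gamma>"
      using regular_curve_subset[OF reg thick_atLeast thick_Icc] that by (intro pw_regular) auto
    then have "conf.d (\<gamma> r) (\<gamma> s) \<le> integral {r..s} (conf.sp \<gamma>)" using conf.d_curve[of r s \<gamma> r s] that by simp
    also have "\<dots> = integral {r..s} v"
      by (rule integral_spike[of "{0}"]) (use v_sp that in auto)
    finally show ?thesis using F_diff[OF that] by simp
  qed (simp add: conf.d_refl)
  have t_large: "\<exists>N. \<forall>n\<ge>N. t n \<ge> T" for T
  proof -
    have "eventually (\<lambda>n. ereal T < ereal (t n)) sequentially"
      using tK(2) unfolding tendsto_PInfty by blast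
    then show ?thesis unfolding eventually_sequentially by (auto intro: less_imp_le)
  qed
  have "\<exists>N. \<forall>m\<ge>N. \<forall>n\<ge>N. conf.d (\<gamma> (t m)) (\<gamma> (t n)) < e" if e: "e > 0" for e
  proof -
    obtain T where T: "T \<ge> 0" "F T > S - e"
      using less_cSup_iff[OF _ bdd, of "S - e"] e unfolding S_def[symmetric] by auto
    obtain N where N: "\<And>n. n \<ge> N \<Longrightarrow> t n \<ge> T" using t_large[of T] by blast
    have le: "conf.d (\<gamma> (t m)) (\<gamma> (t n)) < e" if "m \<ge> N" "n \<ge> N" "t m \<le> t n" for m n
    proof -
      have "F (t n) \<le> S" unfolding S_def by (rule cSup_upper[OF _ bdd]) (use t in auto)
      moreover have "F T \<le> F (t m)" using F_mono[OF T(1) N[OF that(1)]] .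
      ultimately show ?thesis using dist[OF t that(3)] T(2) by linarith
    qed
    have "conf.d (\<gamma> (t m)) (\<gamma> (t n)) < e" if "m \<ge> N" "n \<ge> N" for m n
      using le[OF that] le[OF that(2,1)] conf.d_sym[of "\<gamma> (t m)" "\<gamma> (t n)"] by linarith
    then show ?thesis by blast
  qed
  then obtain x where x: "\<And>e. e > 0 \<Longrightarrow> \<exists>N. \<forall>n\<ge>N. conf.d (\<gamma> (t n)) x < e"
    using complete[unfolded conf.complete_metric_iff, rule_format, of "\<lambda>n. \<gamma> (t n)"] by blast
  obtain j where j: "x \<in> K j" using tK(3) by blast
  then have "x \<in> interior (K (Suc j))" using K by blast
  then obtain e where e: "e > 0" "\<And>y. conf.d x y < e \<Longrightarrow> y \<in> interior (K (Suc j))"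
    by (rule conf.open_contains_d_ball[OF open_interior]) blast
  obtain N where N: "\<forall>n\<ge>N. conf.d (\<gamma> (t n)) x < e" using x[OF e(1)] by blast
  \<comment> \<open>\<open>\<gamma> (t n)\<close> avoids \<open>K (n - 1)\<close>, which has to
    contain \<open>K (Suc j)\<close>, the set whose interior is a neighbourhood of the limit; hence
    j + 2.\<close>
  define n where "n = max N (j + 2)"
  have n: "n \<ge> N" "Suc j \<le> n - 1" "1 \<le> n" by (auto simp: n_def)
  have "conf.d x (\<gamma> (t n)) < e" using N n(1) conf.d_sym[of x "\<gamma> (t n)"] by simp
  then have "\<gamma> (t n) \<in> K (Suc j)" using e(2) interior_subset by blast
  moreover have "K (Suc j) \<subseteq> K (n - 1)"
    by (rule lift_Suc_mono_le[OF _ n(2)]) (use K interior_subset in blast)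
  ultimately show False using tK(5) n(3) by blast
qed

lemma incomplete_imp_L1:
  assumes complete: "complete_metric \<A> g" and incomplete: "\<not> complete_metric \<A> g'"
  shows "L1_on_escaping_curve \<A> g (\<lambda>x. 1 / A x)"
proof -
  obtain \<gamma> P r M where reg: "regular_curve \<A> {0..} \<gamma>" and P: "\<And>n::nat. \<gamma> (real n) = P n"
    and escape: "\<And>C. compact C \<Longrightarrow> \<exists>N. \<forall>n\<ge>N. P n \<notin> C" and r: "summable r" "\<And>n. r n > 0" and M: "M > 0"
    and speed: "\<And>n t. real n \<le> t \<Longrightarrow> t < real n + 1 \<Longrightarrow> speed \<A> g' {0..} \<gamma> t \<le> M * r n"
    using conf.incomplete_imp_ray[OF incomplete] by metis
  \<comment> \<open>The exhaustion has to be fitted to the ray: with radii from a subsequence of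
    these distances, the chosen points lie on the bounding spheres, hence outside all smaller
    balls.\<close>
  define D where "D n = d (\<gamma> 0) (P n)" for n
  have far: "\<exists>m>n. D m > D n + 1" for n
  proof -
    obtain N where N: "\<forall>m\<ge>N. P m \<notin> cb (\<gamma> 0) (D n + 1)"
      using escape[OF complete_imp_compact_cb[OF complete]] by blast
    then show ?thesis by (intro exI[of _ "max N (Suc n)"]) (auto simp: in_cb D_def not_le)
  qed
  then obtain nxt where nxt: "\<And>n. nxt n > n" "\<And>n. D (nxt n) > D n + 1" by metis
  \<comment> \<open>Gaps larger than 1 make the radii at least \<open>j\<close>, so the balls
    exhaust the manifold; starting at index 0 gives the ball of radius 0, which is the starting
    point alone.\<close>
  define k where "k j = (nxt ^^ j) 0" for j
  have k: "k 0 = 0" "\<And>j. k (Suc j) > k j" "\<And>j. D (k (Suc j)) > D (k j) + 1" using nxt by (auto simp: k_def)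
  have k_ge: "k j \<ge> j" for j by (induction j) (use k(2) Suc_le_eq le_less_trans in \<open>auto, blast\<close>)
  have D0: "D (k 0) = 0" using P[of 0] by (simp add: D_def k(1) d_refl)
  have D_ge: "D (k j) \<ge> real j" for j
  proof (induction j)
    case (Suc j)
    then show ?case using k(3)[of j] by simp
  qed (simp add: D0)
  define K where "K j = cb (\<gamma> 0) (D (k j))" for j
  have "escaping_ray \<A> \<infinity> \<gamma>"
    unfolding escaping_ray_def ray_dom_infinity
  proof (intro conjI exI[of _ "\<lambda>j. real (k j)"] exI[of _ K] allI impI)
    show "(\<lambda>j. ereal (real (k j))) \<longlonglongrightarrow> \<infinity>"
      unfolding tendsto_PInfty eventually_sequentially
    proof
      fix R
      show "\<exists>N. \<forall>n\<ge>N. ereal R < ereal (real (k n))"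
      proof (intro exI[of _ "nat \<lceil>R\<rceil> + 1"] allI impI)
        fix n assume "nat \<lceil>R\<rceil> + 1 \<le> n"
        then have "R < real n" by linarith
        also have "\<dots> \<le> real (k n)" using k_ge by simp
        finally show "ereal R < ereal (real (k n))" by simp
      qed
    qed
    show "compact (K n)" for n unfolding K_def by (rule complete_imp_compact_cb[OF complete])
    show "(\<Union>n. K n) = UNIV"
    proof -
      have "x \<in> K (nat \<lceil>d (\<gamma> 0) x\<rceil>)" for x
        unfolding K_def in_cb using D_ge[of "nat \<lceil>d (\<gamma> 0) x\<rceil>"] by linarith
      then show ?thesis by blast
    qed
    show "K 0 = {\<gamma> 0}"
      unfolding K_def D0 using d_eq_0 d_nonneg by (auto simp: cb_def d_refl) (metis antisym)
    show "K n \<subseteq> interior (K (Suc n))" for n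
    proof (rule order_trans[OF _ interior_maximal[OF _ open_d_ball[of "\<gamma> 0" "D (k (Suc n))"]]])
      show "K n \<subseteq> {y. d (\<gamma> 0) y < D (k (Suc n))}" using k(3)[of n] by (auto simp: K_def in_cb)
      show "{y. d (\<gamma> 0) y < D (k (Suc n))} \<subseteq> K (Suc n)" by (auto simp: K_def in_cb)
    qed
    show "\<gamma> (real (k n)) \<in> K n - K (n - 1)" if "1 \<le> n" for n
      using k(3)[of "n - 1"] that P[of "k n"] by (simp add: K_def in_cb D_def)
  qed (use reg in auto)
  moreover have "(\<integral>\<^sup>+ s\<in>{0..}. ennreal (1 / A (\<gamma> s) * speed \<A> g {0..} \<gamma> s) \<partial>lborel) < \<infinity>"
  proof -
    have "(\<integral>\<^sup>+ s\<in>{0..}. ennreal (1 / A (\<gamma> s) * speed \<A> g {0..} \<gamma> s) \<partial>lborel)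
      = (\<integral>\<^sup>+ s\<in>{0..}. ennreal (speed \<A> g' {0..} \<gamma> s) \<partial>lborel)"
      by (simp add: conformal_speed)
    \<comment> \<open>On [n, n + 1) the speed is at most \<open>M * r n\<close>, so the integral is
      at most \<open>M\<close> times the sum of the radii.\<close>
    also have "\<dots> \<le> (\<integral>\<^sup>+ s. (\<Sum>n. ennreal (M * r n) * indicator {real n..<real n + 1} s) \<partial>lborel)"
    proof (rule nn_integral_mono)
      fix s :: real
      show "ennreal (speed \<A> g' {0..} \<gamma> s) * indicator {0..} s \<le> (\<Sum>n. ennreal (M * r n) * indicator {real n..<real n + 1} s)"
      proof (cases "s \<ge> 0")
        case True
        define f where "f n = ennreal (M * r n) * indicator {real n..<real n + 1} s" for n
        define n where "n = nat \<lfloor>s\<rfloor>"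
        have n: "real n \<le> s" "s < real n + 1" using True unfolding n_def by linarith+
        have "ennreal (speed \<A> g' {0..} \<gamma> s) * indicator {0..} s \<le> sum f {n}"
          using speed[OF n] n True by (simp add: ennreal_leI f_def)
        also have "\<dots> \<le> suminf f" by (rule sum_le_suminf) auto
        finally show ?thesis unfolding f_def .
      qed simp
    qed
    also have "\<dots> = (\<Sum>n. \<integral>\<^sup>+ s. ennreal (M * r n) * indicator {real n..<real n + 1} s \<partial>lborel)"
      by (rule nn_integral_suminf) simp
    also have "\<dots> = (\<Sum>n. ennreal (M * r n))"
      by (simp add: nn_integral_cmult_indicator)
    also have "\<dots> = ennreal (\<Sum>n. M * r n)"
      using r M by (intro suminf_ennreal2 summable_mult) (auto simp: less_imp_le)
    finally show ?thesis by (simp add: order_le_less_trans)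
  qed
  ultimately show ?thesis unfolding L1_on_escaping_curve_def by blast
qed

end

theorem theorem1:
  fixes \<A> :: "('a::{t2_space,second_countable_topology}, 'e::euclidean_space) chart set"
    and g :: "('a, 'e) metric_tensor"
    and A :: "'a \<Rightarrow> real"
  assumes "smooth_atlas \<A>"
    and "connected (UNIV :: 'a set)"
    and "\<not> compact (UNIV :: 'a set)"
    and "riemannian_metric \<A> g"
    and "complete_metric \<A> g"
    and "smooth_function \<A> A"
    and "\<forall>x. A x > 0"
  shows "(complete_metric \<A> (conformal_metric g A) \<longleftrightarrow>
            \<not> L1_on_escaping_curve \<A> g (\<lambda>x. 1 / A x)) \<and>
         (grows_at_most_linearly \<A> g A \<longrightarrow>
            complete_metric \<A> (conformal_metric g A)) \<and>
         (grows_superlinearly \<A> g A \<longrightarrow>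
            bounded_metric \<A> (conformal_metric g A) \<and>
            \<not> complete_metric \<A> (conformal_metric g A))"
proof -
  interpret cont_metric \<A> g by (rule riemannian_imp_cont_metric[OF assms(1,2,4)])
  interpret conformal \<A> g A by unfold_locales (use assms(6,7) in auto)
  show ?thesis
    using L1_imp_incomplete incomplete_imp_L1[OF assms(5)] linear_growth_complete[OF assms(5)]
      superlinear_growth_bounded bounded_imp_incomplete[OF assms(3)] by blast
qed

end
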